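(* Let $n\geq 8$. Up to isomorphism, the graph $H_n$ described below is the unique graph attaining the maximum spectral radius among all connected nonregular graphs on $n$ vertices with maximum degree $3$. Construction of $H_n$. Head $A$ has vertices $a_1,a_2,a_3,a_4,h$ and edges $a_1a_2,a_1a_3,a_1a_4,a_2a_3,a_2a_4,a_3h,a_4h$. Head $B$ has vertices $b_1,\ldots,b_6,h$ and edges $b_1b_2,b_1b_3,b_1b_4,b_2b_3,b_2b_4,b_3b_5,b_4b_6,b_5b_6,b_5h,b_6h$. A diamond $D_i$ has vertices $p_i,r_i,s_i,q_i$ and edges $p_ir_i,p_is_i,r_is_i,r_iq_i,s_iq_i$. For a head $X\in\{A,B\}$ and an integer $t\ge 0$, let $X_t$ be the graph consisting of the head $X$ and disjoint diamonds $D_1,\ldots,D_t$, together with the edge $hp_1$ (if $t\ge1$) and the edges $q_ip_{i+1}$ for $1\le i\le t-1$; its end vertex is $e=q_t$ if $t\ge 1$ and $e=h$ if $t=0$. Then: if $n\equiv 1 \pmod 4$, $H_n=A_t$ with $t=(n-5)/4$; if $n\equiv 2 \pmod 4$, $H_n$ is $A_t$ with $t=(n-6)/4$ plus one new vertex adjacent only to its end vertex $e$; if $n\equiv 3 \pmod 4$, $H_n=B_t$ with $t=(n-7)/4$; if $n\equiv 0 \pmod 4$, $H_n$ is $B_t$ with $t=(n-8)/4$ plus one new vertex adjacent only to its end vertex $e$.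
   Context: All graphs are finite, simple and undirected. The spectral radius of a graph is the largest eigenvalue of its adjacency matrix. A graph is nonregular if not all its vertices have the same degree. *)

theory Defs
  imports "Graph_Theory.Graph_Theory" "Jordan_Normal_Form.Spectral_Radius"
begin

text \<open>
  A finite, simple, undirected graph is a pair digraph satisfying the locale predicate
  \<^const>\<open>pair_graph\<close>: the vertex set is finite, and the arc set is a symmetric, irreflexive
  relation on it, each edge being represented by its two orientations. The degree of a vertex is
  therefore its out-degree.
\<close>

definition max_degree :: "'a pair_pre_digraph \<Rightarrow> nat" where
  "max_degree G = Max ((\<lambda>v. out_degree (with_proj G) v) ` pverts G)"

definition nonregular :: "'a pair_pre_digraph \<Rightarrow> bool" where
  "nonregular G \<longleftrightarrow>
     (\<exists>u\<in>pverts G. \<exists>v\<in>pverts G. out_degree (with_proj G) u \<noteq> out_degree (with_proj G) v)"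

definition connected_nonregular_graphs :: "nat \<Rightarrow> nat \<Rightarrow> 'a pair_pre_digraph set" where
  "connected_nonregular_graphs n \<Delta> =
     {G. pair_graph G \<and> card (pverts G) = n \<and> Digraph_Component.connected (with_proj G) \<and>
         nonregular G \<and> max_degree G = \<Delta>}"

text \<open>The adjacency matrix, with rows and columns indexed along the enumeration \<open>vs\<close> of the vertices.\<close>

definition adjacency_matrix :: "'a list \<Rightarrow> 'a pair_pre_digraph \<Rightarrow> real mat" where
  "adjacency_matrix vs G =
     mat (length vs) (length vs) (\<lambda>(i, j). if (vs ! i, vs ! j) \<in> parcs G then 1 else 0)"

text \<open>
  The enumeration of the vertices is chosen arbitrarily; the value does not depend on it, see
  \<open>graph_spectral_radius_eq\<close> below. The matrix is real symmetric, so its real eigenvalues are all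
  its eigenvalues.
\<close>

definition graph_spectral_radius :: "'a pair_pre_digraph \<Rightarrow> real" where
  "graph_spectral_radius G =
     Max (spectrum (adjacency_matrix (SOME vs. distinct vs \<and> set vs = pverts G) G))"

lemma eigenvalue_adjacency_matrix_iff:
  assumes G: "pair_graph G" and vs: "distinct vs" "set vs = pverts G"
  shows "eigenvalue (adjacency_matrix vs G) k \<longleftrightarrow>
    (\<exists>x. (\<exists>v\<in>pverts G. x v \<noteq> 0) \<and>
         (\<forall>v\<in>pverts G. (\<Sum>u | (v, u) \<in> parcs G. x u) = k * x v))"
    (is "?L \<longleftrightarrow> (\<exists>x. ?P x)")
proof -
  interpret pair_graph G by fact
  let ?n = "length vs" and ?A = "adjacency_matrix vs G"
  have mult: "(?A *\<^sub>v vec ?n (\<lambda>i. x (vs ! i))) $ i = (\<Sum>u | (vs ! i, u) \<in> parcs G. x u)"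
    if i: "i < ?n" for x i
  proof -
    have "(?A *\<^sub>v vec ?n (\<lambda>i. x (vs ! i))) $ i
        = (\<Sum>j\<in>{0..<?n}. (if (vs ! i, vs ! j) \<in> parcs G then x (vs ! j) else 0))"
      using i by (auto simp: adjacency_matrix_def scalar_prod_def intro!: sum.cong)
    also have "\<dots> = (\<Sum>u\<in>set vs. (if (vs ! i, u) \<in> parcs G then x u else 0))"
      using sum.reindex_bij_betw[OF bij_betw_nth[OF vs(1) refl refl],
          of "\<lambda>u. if (vs ! i, u) \<in> parcs G then x u else 0"]
      by (simp add: atLeast0LessThan)
    also have "\<dots> = (\<Sum>u | u \<in> set vs \<and> (vs ! i, u) \<in> parcs G. x u)"
      by (simp add: sum.inter_filter)
    also have "{u. u \<in> set vs \<and> (vs ! i, u) \<in> parcs G} = {u. (vs ! i, u) \<in> parcs G}"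
      using vs in_arcsD2 by auto
    finally show ?thesis .
  qed
  have ev: "eigenvector ?A (vec ?n (\<lambda>i. x (vs ! i))) k \<longleftrightarrow> ?P x" for x
  proof -
    have "vec ?n (\<lambda>i. x (vs ! i)) \<noteq> 0\<^sub>v ?n \<longleftrightarrow> (\<exists>v\<in>set vs. x v \<noteq> 0)"
      by (auto simp: vec_eq_iff in_set_conv_nth Bex_def)
    moreover have "?A *\<^sub>v vec ?n (\<lambda>i. x (vs ! i)) = k \<cdot>\<^sub>v vec ?n (\<lambda>i. x (vs ! i)) \<longleftrightarrow>
        (\<forall>i<?n. (\<Sum>u | (vs ! i, u) \<in> parcs G. x u) = k * x (vs ! i))"
      unfolding vec_eq_iff using mult
      by (simp add: adjacency_matrix_def del: index_mult_mat_vec)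
    moreover have "dim_row ?A = ?n"
      by (simp add: adjacency_matrix_def)
    ultimately show ?thesis
      unfolding eigenvector_def vs(2)[symmetric] by (auto simp: all_set_conv_all_nth)
  qed
  show ?thesis
  proof
    assume ?L
    then obtain w where w: "eigenvector ?A w k" by (auto simp: eigenvalue_def)
    define x where "x v = w $ (the_inv_into {..<?n} ((!) vs) v)" for v
    have "inj_on ((!) vs) {..<?n}" using vs(1) by (simp add: inj_on_nth)
    then have "x (vs ! i) = w $ i" if "i < ?n" for i
      using that by (simp add: x_def the_inv_into_f_f)
    moreover have "dim_vec w = ?n"
      using w by (auto simp: eigenvector_def adjacency_matrix_def)
    ultimately have "vec ?n (\<lambda>i. x (vs ! i)) = w" by auto
    with w ev[of x] show "\<exists>x. ?P x" by metis
  next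
    assume "\<exists>x. ?P x"
    with ev show ?L by (auto simp: eigenvalue_def)
  qed
qed

lemma graph_spectral_radius_eq:
  assumes G: "pair_graph G" and vs: "distinct vs" "set vs = pverts G"
  shows "graph_spectral_radius G = Max (spectrum (adjacency_matrix vs G))"
proof -
  let ?ws = "SOME vs. distinct vs \<and> set vs = pverts G"
  have "distinct ?ws \<and> set ?ws = pverts G"
    by (rule someI[where x = vs]) (use vs in simp)
  then have "spectrum (adjacency_matrix ?ws G) = spectrum (adjacency_matrix vs G)"
    using eigenvalue_adjacency_matrix_iff[OF G] vs
    unfolding Spectral_Radius.spectrum_def by auto
  then show ?thesis by (simp add: graph_spectral_radius_def)
qed

text \<open>
  The vertices \<open>a\<^sub>i\<close>, \<open>b\<^sub>i\<close>, \<open>h\<close> of the heads, the vertices \<open>p\<^sub>i\<close>, \<open>r\<^sub>i\<close>, \<open>s\<^sub>i\<close>, \<open>q\<^sub>i\<close> of the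
  diamond \<open>D\<^sub>i\<close>, and the additional vertex attached to the end vertex when \<open>n\<close> is even.
\<close>

datatype vtx = a nat | b nat | h | p nat | r nat | s nat | q nat | pendant

datatype head_kind = A | B

fun head_verts :: "head_kind \<Rightarrow> vtx set" where
  "head_verts A = {a 1, a 2, a 3, a 4, h}"
| "head_verts B = {b 1, b 2, b 3, b 4, b 5, b 6, h}"

text \<open>Below, each edge is listed in one orientation only; \<open>graph_of\<close> adds the reverse arcs.\<close>

fun head_edges :: "head_kind \<Rightarrow> (vtx \<times> vtx) set" where
  "head_edges A =
     {(a 1, a 2), (a 1, a 3), (a 1, a 4), (a 2, a 3), (a 2, a 4), (a 3, h), (a 4, h)}"
| "head_edges B =
     {(b 1, b 2), (b 1, b 3), (b 1, b 4), (b 2, b 3), (b 2, b 4), (b 3, b 5), (b 4, b 6),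
      (b 5, b 6), (b 5, h), (b 6, h)}"

definition diamond_verts :: "nat \<Rightarrow> vtx set" where
  "diamond_verts i = {p i, r i, s i, q i}"

definition diamond_edges :: "nat \<Rightarrow> (vtx \<times> vtx) set" where
  "diamond_edges i = {(p i, r i), (p i, s i), (r i, s i), (r i, q i), (s i, q i)}"

definition chain_verts :: "head_kind \<Rightarrow> nat \<Rightarrow> vtx set" where
  "chain_verts X t = head_verts X \<union> (\<Union>i\<in>{1..t}. diamond_verts i)"

definition chain_edges :: "head_kind \<Rightarrow> nat \<Rightarrow> (vtx \<times> vtx) set" where
  "chain_edges X t =
     head_edges X \<union> (\<Union>i\<in>{1..t}. diamond_edges i) \<union>
     (if t \<ge> 1 then {(h, p 1)} else {}) \<union> {(q i, p (i + 1)) |i. 1 \<le> i \<and> i < t}"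

definition end_vertex :: "nat \<Rightarrow> vtx" where
  "end_vertex t = (if t \<ge> 1 then q t else h)"

definition graph_of :: "'a set \<Rightarrow> ('a \<times> 'a) set \<Rightarrow> 'a pair_pre_digraph" where
  "graph_of V E = \<lparr>pverts = V, parcs = E \<union> E\<inverse>\<rparr>"

definition chain_graph :: "head_kind \<Rightarrow> nat \<Rightarrow> vtx pair_pre_digraph" where
  "chain_graph X t = graph_of (chain_verts X t) (chain_edges X t)"

definition chain_graph_pendant :: "head_kind \<Rightarrow> nat \<Rightarrow> vtx pair_pre_digraph" where
  "chain_graph_pendant X t =
     graph_of (insert pendant (chain_verts X t)) (insert (end_vertex t, pendant) (chain_edges X t))"

definition H_graph :: "nat \<Rightarrow> vtx pair_pre_digraph" where
  "H_graph n =
     (if n mod 4 = 1 then chain_graph A ((n - 5) div 4)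
      else if n mod 4 = 2 then chain_graph_pendant A ((n - 6) div 4)
      else if n mod 4 = 3 then chain_graph B ((n - 7) div 4)
      else chain_graph_pendant B ((n - 8) div 4))"

text \<open>Short constructor names such as \<open>a\<close> and \<open>A\<close> would otherwise capture variables.\<close>

hide_const (open) a b h p r s q pendant A B

end

theory Submission
  imports Defs "HOL-Analysis.Function_Topology"
begin

text \<open>
  Join every vertex of degree below 3 by additional edges to a boundary vertex, so that all degrees
  become 3. Then \<open>\<lambda> = 3 - \<rho>(G)\<close> is the minimum of \<open>E(y) / |y|\<^sup>2\<close>, where \<open>E(y)\<close> is the sum of
  \<open>(y u - y v)\<^sup>2\<close> over all edges and \<open>y\<close> vanishes at the boundary. Number the vertices by decreasing
  entries of the Perron vector \<open>z\<close>. In terms of the gaps \<open>d j = z j - z (j + 1)\<close> the energy is a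
  quadratic form whose coefficients count the edges running across pairs of gaps. Degree and
  parity bound these coefficients from below by numbers that depend only on the set \<open>B\<close> of bridge
  positions, at which a single edge leaves the initial segment; two bridges are at least 4 apart, and
  the first one is at position 5 or later.

  Let \<open>x = \<lambda> z\<close> with partial sums \<open>f j\<close>. The maximum of \<open>2 \<langle>x, y\<rangle> - E(y)\<close> over \<open>y\<close> equals
  \<open>|x|\<^sup>2 / \<lambda>\<close>, so it suffices to compare these maxima for one and the same \<open>x\<close>. A bridge at
  position \<open>j\<close> contributes \<open>(f j)\<^sup>2\<close> and \<open>f\<close> is increasing, so the bridges should be as close to the
  end as possible. The best set has spacing 4 and is realised, with equality in all estimates, by
  the diamonds of \<open>H\<^sub>n\<close>. If \<open>\<rho>(G) = \<rho>(H\<^sub>n)\<close>, then \<open>G\<close> has the same numbers of edges as \<open>H\<^sub>n\<close> across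
  all pairs of gaps with \<open>d j > 0\<close>, and these determine \<open>G\<close>.
\<close>

section \<open>The spectral radius as a maximum of the quadratic form\<close>

text \<open>Moving a bridge raises some coefficients of the energy and lowers others, so inserting
  the gaps of \<open>z\<close> into the form of the best set need not lower the energy. The vector
  of gaps has to change together with \<open>B\<close> while \<open>x\<close> stays fixed; hence the
  dual problem. It is tractable because the minimal cuts 1 at a bridge and 2 at its even neighbours
  give the coupling 1 + 2 - 3 = 0. The gap at a bridge is thus isolated from the adjacent gaps,
  which explains the clean summand \<open>(f j)\<^sup>2\<close>, and the form falls into independent
  pieces between bridges.

  Only the vertices of \<open>G\<close> are sorted by a Perron vector. For \<open>H\<^sub>n\<close>
  the natural numbering is used and nothing is claimed about the order of its Perron entries: its
  Rayleigh inequality for arbitrary \<open>y\<close> suffices. The obstacle is the case of odd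
  \<open>n\<close> with at least three edges leaving at the end. There the last odd gap is not
  isolated, and numerical estimates on the decay of \<open>z\<close> have to pay for it.\<close>

definition quad_form :: "'a set \<Rightarrow> ('a \<Rightarrow> 'a \<Rightarrow> real) \<Rightarrow> ('a \<Rightarrow> real) \<Rightarrow> real" where
  "quad_form V A x = (\<Sum>u\<in>V. \<Sum>v\<in>V. A u v * x u * x v)"

lemma quad_form_max_exists:
  fixes A :: "'a \<Rightarrow> 'a \<Rightarrow> real"
  assumes fin: "finite V" and ne: "V \<noteq> {}"
  shows "\<exists>\<mu> x. (\<exists>v\<in>V. x v \<noteq> 0) \<and> quad_form V A x = \<mu> * (\<Sum>v\<in>V. (x v)\<^sup>2) \<and>
    (\<forall>y. quad_form V A y \<le> \<mu> * (\<Sum>v\<in>V. (y v)\<^sup>2))"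
proof -
  \<comment> \<open>Coordinates outside \<open>V\<close> are pinned to 0, so the box is a product of
    compact sets even when the vertex type is infinite.\<close>
  define S where "S v = (if v \<in> V then {-1..1} else {0::real})" for v
  define K where "K = Pi\<^sub>E UNIV S \<inter> {x. (\<Sum>v\<in>V. (x v)\<^sup>2) = 1}"
  have cont: "continuous_on UNIV (\<lambda>x::'a \<Rightarrow> real. x v)" for v
    by (rule continuous_on_product_coordinates)
  have "compactin (product_topology (\<lambda>_. euclidean) UNIV) (Pi\<^sub>E UNIV S)"
    unfolding compactin_PiE by (auto simp: S_def)
  then have "compact (Pi\<^sub>E UNIV S)"
    by (simp add: euclidean_product_topology)
  moreover have "closed {x. (\<Sum>v\<in>V. (x v)\<^sup>2) = (1::real)}"
    by (intro closed_Collect_eq continuous_intros cont)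
  ultimately have K: "compact K" unfolding K_def by (rule compact_Int_closed)
  obtain v0 where v0: "v0 \<in> V" using ne by blast
  have "(\<lambda>v. if v = v0 then 1 else 0) \<in> K"
    using v0 fin by (auto simp: K_def S_def if_distrib[of "\<lambda>t. t\<^sup>2"] sum.delta cong: if_cong)
  then have "K \<noteq> {}" by blast
  moreover have "continuous_on K (quad_form V A)"
    unfolding quad_form_def
    by (intro continuous_intros continuous_on_subset[OF cont]) auto
  ultimately obtain x where x: "x \<in> K" "\<And>y. y \<in> K \<Longrightarrow> quad_form V A y \<le> quad_form V A x"
    using continuous_attains_sup[OF K] by blast
  have x1: "(\<Sum>v\<in>V. (x v)\<^sup>2) = 1" using x(1) by (simp add: K_def)
  have "\<exists>v\<in>V. x v \<noteq> 0"
  proof (rule ccontr)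
    assume "\<not> (\<exists>v\<in>V. x v \<noteq> 0)"
    then have "(\<Sum>v\<in>V. (x v)\<^sup>2) = 0" by simp
    then show False using x1 by simp
  qed
  moreover have "quad_form V A y \<le> quad_form V A x * (\<Sum>v\<in>V. (y v)\<^sup>2)" for y
  proof (cases "(\<Sum>v\<in>V. (y v)\<^sup>2) = 0")
    case True
    then have "\<forall>v\<in>V. y v = 0" using fin by (simp add: sum_nonneg_eq_0_iff)
    then show ?thesis by (simp add: quad_form_def)
  next
    case False
    define s where "s = sqrt (\<Sum>v\<in>V. (y v)\<^sup>2)"
    have s2: "s\<^sup>2 = (\<Sum>v\<in>V. (y v)\<^sup>2)" unfolding s_def by (simp add: sum_nonneg)
    then have s: "s \<noteq> 0" using False by auto
    define w where "w v = (if v \<in> V then y v / s else 0)" for v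
    have w1: "(\<Sum>v\<in>V. (w v)\<^sup>2) = 1"
    proof -
      have "(\<Sum>v\<in>V. (w v)\<^sup>2) = (\<Sum>v\<in>V. (y v)\<^sup>2) / s\<^sup>2"
        unfolding sum_divide_distrib by (simp add: w_def power_divide)
      then show ?thesis using s unfolding s2[symmetric] by simp
    qed
    have "w v \<in> S v" for v
    proof (cases "v \<in> V")
      case True
      then have "(w v)\<^sup>2 \<le> 1"
        using member_le_sum[OF True _ fin, of "\<lambda>v. (w v)\<^sup>2"] w1 by simp
      then show ?thesis using True by (simp add: S_def abs_square_le_1 abs_le_iff)
    qed (simp add: w_def S_def)
    then have "w \<in> K" using w1 by (auto simp: K_def)
    from x(2)[OF this] have "quad_form V A w \<le> quad_form V A x" .
    moreover have "quad_form V A w * s\<^sup>2 = quad_form V A y"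
      unfolding quad_form_def sum_distrib_right using s
      by (intro sum.cong) (auto simp: w_def power2_eq_square)
    ultimately show ?thesis by (metis mult_right_mono s2 zero_le_power2)
  qed
  ultimately show ?thesis using x1 by (intro exI[of _ "quad_form V A x"] exI[of _ x]) auto
qed

lemma linear_coeff_zero:
  fixes b c :: real
  assumes "\<And>t. 2 * t * b + t\<^sup>2 * c \<le> 0"
  shows "b = 0"
proof (rule ccontr)
  assume b: "b \<noteq> 0"
  \<comment> \<open>At \<open>t = b / k\<close> with \<open>k > \<bar>c\<bar>\<close> the linear
    term dominates: the polynomial is at least \<open>b\<^sup>2 / k\<close> there.\<close>
  define k where "k = \<bar>c\<bar> + 1"
  have k: "k > 0" "c \<ge> - k" by (auto simp: k_def)
  have "0 < b\<^sup>2 / k" using b k by simp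
  also have "b\<^sup>2 / k = 2 * (b / k) * b + (b / k)\<^sup>2 * (- k)"
    using k by (simp add: field_simps power2_eq_square)
  also have "\<dots> \<le> 2 * (b / k) * b + (b / k)\<^sup>2 * c"
    using k by (intro add_left_mono mult_left_mono) auto
  also have "\<dots> \<le> 0" by (rule assms)
  finally show False by simp
qed

lemma quad_form_add:
  assumes sym: "\<And>u v. u \<in> V \<Longrightarrow> v \<in> V \<Longrightarrow> A u v = A v u"
  shows "quad_form V A (\<lambda>v. x v + t * w v) = quad_form V A x +
    2 * t * (\<Sum>v\<in>V. w v * (\<Sum>u\<in>V. A v u * x u)) + t\<^sup>2 * quad_form V A w"
proof -
  have "(\<Sum>u\<in>V. \<Sum>v\<in>V. A u v * x u * w v) = (\<Sum>v\<in>V. \<Sum>u\<in>V. A u v * x u * w v)"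
    by (rule sum.swap)
  also have "\<dots> = (\<Sum>v\<in>V. w v * (\<Sum>u\<in>V. A v u * x u))"
    by (auto simp: sum_distrib_left sym mult_ac intro!: sum.cong)
  finally have 1: "(\<Sum>u\<in>V. \<Sum>v\<in>V. A u v * x u * w v) = (\<Sum>v\<in>V. w v * (\<Sum>u\<in>V. A v u * x u))" .
  have 2: "(\<Sum>u\<in>V. \<Sum>v\<in>V. A u v * w u * x v) = (\<Sum>v\<in>V. w v * (\<Sum>u\<in>V. A v u * x u))"
    by (auto simp: sum_distrib_left mult_ac intro!: sum.cong)
  have "quad_form V A (\<lambda>v. x v + t * w v) = (\<Sum>u\<in>V. \<Sum>v\<in>V. A u v * x u * x v +
     t * (A u v * x u * w v) + t * (A u v * w u * x v) + t\<^sup>2 * (A u v * w u * w v))"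
    unfolding quad_form_def by (intro sum.cong refl) (simp add: algebra_simps power2_eq_square)
  also have "\<dots> = quad_form V A x + t * (\<Sum>u\<in>V. \<Sum>v\<in>V. A u v * x u * w v)
     + t * (\<Sum>u\<in>V. \<Sum>v\<in>V. A u v * w u * x v) + t\<^sup>2 * quad_form V A w"
    by (simp add: quad_form_def sum.distrib sum_distrib_left)
  finally show ?thesis unfolding 1 2 by simp
qed

text \<open>First variation: along \<open>x + t * w\<close> the difference of the two sides of
  \<open>le\<close> is a quadratic polynomial in \<open>t\<close> that is nowhere positive and
  vanishes at 0, so its linear coefficient is 0.\<close>

lemma quad_form_max_variation:
  fixes A :: "'a \<Rightarrow> 'a \<Rightarrow> real"
  assumes sym: "\<And>u v. u \<in> V \<Longrightarrow> v \<in> V \<Longrightarrow> A u v = A v u"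
    and le: "\<And>y. quad_form V A y \<le> \<mu> * (\<Sum>v\<in>V. (y v)\<^sup>2)"
    and eq: "quad_form V A x = \<mu> * (\<Sum>v\<in>V. (x v)\<^sup>2)"
  shows "(\<Sum>v\<in>V. w v * (\<Sum>u\<in>V. A v u * x u)) = \<mu> * (\<Sum>v\<in>V. w v * x v)"
proof -
  let ?b = "(\<Sum>v\<in>V. w v * (\<Sum>u\<in>V. A v u * x u)) - \<mu> * (\<Sum>v\<in>V. w v * x v)"
  let ?c = "quad_form V A w - \<mu> * (\<Sum>v\<in>V. (w v)\<^sup>2)"
  have "2 * t * ?b + t\<^sup>2 * ?c \<le> 0" for t
  proof -
    have "(\<Sum>v\<in>V. (x v + t * w v)\<^sup>2)
        = (\<Sum>v\<in>V. (x v)\<^sup>2) + 2 * t * (\<Sum>v\<in>V. w v * x v) + t\<^sup>2 * (\<Sum>v\<in>V. (w v)\<^sup>2)"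
      by (simp add: power2_sum sum.distrib sum_distrib_left power_mult_distrib mult_ac)
    then show ?thesis
      using le[of "\<lambda>v. x v + t * w v"] eq by (simp add: quad_form_add[OF sym] algebra_simps)
  qed
  then have "?b = 0" by (rule linear_coeff_zero)
  then show ?thesis by simp
qed

lemma quad_form_max_eigen:
  fixes A :: "'a \<Rightarrow> 'a \<Rightarrow> real"
  assumes "finite V" and "\<And>u v. u \<in> V \<Longrightarrow> v \<in> V \<Longrightarrow> A u v = A v u"
    and "\<And>y. quad_form V A y \<le> \<mu> * (\<Sum>v\<in>V. (y v)\<^sup>2)"
    and "quad_form V A x = \<mu> * (\<Sum>v\<in>V. (x v)\<^sup>2)" and v: "v \<in> V"
  shows "(\<Sum>u\<in>V. A v u * x u) = \<mu> * x v"
  using quad_form_max_variation[OF assms(2-4), of "\<lambda>u. if u = v then 1 else 0"] assms(1) v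
  by (simp add: if_distrib[of "\<lambda>t. t * _"] sum.delta cong: if_cong)

section \<open>Rayleigh quotient and Perron vector of a graph\<close>

definition adj :: "'a pair_pre_digraph \<Rightarrow> 'a \<Rightarrow> 'a \<Rightarrow> real" where
  "adj G u v = (if (u, v) \<in> parcs G then 1 else 0)"

lemma pair_graph_sym:
  assumes "pair_graph G"
  shows "(u, v) \<in> parcs G \<longleftrightarrow> (v, u) \<in> parcs G"
proof -
  interpret pair_graph G by fact
  have "sym (parcs G)" using pair_sym_arcs by (simp add: symmetric_def)
  then show ?thesis by (meson symE)
qed

lemma adj_sym: "pair_graph G \<Longrightarrow> adj G u v = adj G v u"
  using pair_graph_sym[of G u v] by (simp add: adj_def)

lemma pair_graph_finite: "pair_graph G \<Longrightarrow> finite (pverts G)"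
  by (meson pair_graph.axioms(1) pair_digraph.axioms(1) pair_fin_digraph.pair_finite_verts)

lemma pair_graph_wf: "pair_graph G \<Longrightarrow> (u, v) \<in> parcs G \<Longrightarrow> u \<in> pverts G \<and> v \<in> pverts G"
  by (meson pair_graph.axioms(1) pair_digraph.axioms(1) pair_fin_digraph.axioms(1)
      pair_wf_digraph.in_arcsD1 pair_wf_digraph.in_arcsD2)

lemma pair_graph_irrefl: "pair_graph G \<Longrightarrow> (u, u) \<notin> parcs G"
  by (metis fst_conv snd_conv pair_graph.axioms(1) pair_digraph.axioms(2)
      pair_loopfree_digraph.pair_no_loops)

lemma sum_adj:
  assumes "pair_graph G"
  shows "(\<Sum>u\<in>pverts G. adj G v u * x u) = (\<Sum>u | (v, u) \<in> parcs G. x u)"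
proof -
  have "(\<Sum>u\<in>pverts G. adj G v u * x u) = (\<Sum>u\<in>pverts G. if (v, u) \<in> parcs G then x u else 0)"
    by (intro sum.cong) (auto simp: adj_def)
  also have "\<dots> = (\<Sum>u | u \<in> pverts G \<and> (v, u) \<in> parcs G. x u)"
    using pair_graph_finite[OF assms] by (simp add: sum.inter_filter)
  also have "{u. u \<in> pverts G \<and> (v, u) \<in> parcs G} = {u. (v, u) \<in> parcs G}"
    using pair_graph_wf[OF assms] by auto
  finally show ?thesis .
qed

text \<open>The maximum of the form is attained at an eigenvector, and each eigenvector returns its
  eigenvalue as a Rayleigh quotient; hence the largest eigenvalue is that maximum.\<close>

lemma graph_spectral_radius_rayleigh:
  assumes G: "pair_graph G" and ne: "pverts G \<noteq> {}"
  shows "quad_form (pverts G) (adj G) y \<le> graph_spectral_radius G * (\<Sum>v\<in>pverts G. (y v)\<^sup>2)"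
    and "\<exists>x. (\<exists>v\<in>pverts G. x v \<noteq> 0) \<and>
      quad_form (pverts G) (adj G) x = graph_spectral_radius G * (\<Sum>v\<in>pverts G. (x v)\<^sup>2)"
proof -
  let ?V = "pverts G" and ?R = "graph_spectral_radius G"
  note fin = pair_graph_finite[OF G]
  obtain vs where vs: "distinct vs" "set vs = ?V" using finite_distinct_list[OF fin] by blast
  let ?M = "adjacency_matrix vs G"
  have R: "?R = Max (spectrum ?M)" by (rule graph_spectral_radius_eq[OF G vs])
  have fs: "finite (spectrum ?M)"
    by (rule card_finite_spectrum[of _ "length vs"]) (simp add: adjacency_matrix_def)
  have ev: "k \<in> spectrum ?M \<longleftrightarrow> (\<exists>x. (\<exists>v\<in>?V. x v \<noteq> 0) \<and>
         (\<forall>v\<in>?V. (\<Sum>u\<in>?V. adj G v u * x u) = k * x v))" for k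
    using eigenvalue_adjacency_matrix_iff[OF G vs, of k]
    by (simp add: Spectral_Radius.spectrum_def sum_adj[OF G])
  obtain \<mu> x where x: "\<exists>v\<in>?V. x v \<noteq> 0" "quad_form ?V (adj G) x = \<mu> * (\<Sum>v\<in>?V. (x v)\<^sup>2)"
    and mu: "\<And>y. quad_form ?V (adj G) y \<le> \<mu> * (\<Sum>v\<in>?V. (y v)\<^sup>2)"
    using quad_form_max_exists[OF fin ne] by blast
  have "\<mu> \<in> spectrum ?M"
    using quad_form_max_eigen[OF fin adj_sym[OF G] mu x(2)] x(1) unfolding ev by blast
  moreover have "k \<le> \<mu>" if k: "k \<in> spectrum ?M" for k
  proof -
    obtain w where w: "\<exists>v\<in>?V. w v \<noteq> 0" "\<forall>v\<in>?V. (\<Sum>u\<in>?V. adj G v u * w u) = k * w v"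
      using k unfolding ev by blast
    have "quad_form ?V (adj G) w = (\<Sum>v\<in>?V. w v * (\<Sum>u\<in>?V. adj G v u * w u))"
      by (simp add: quad_form_def sum_distrib_left mult_ac)
    also have "\<dots> = k * (\<Sum>v\<in>?V. (w v)\<^sup>2)"
      using w(2) by (simp add: sum_distrib_left power2_eq_square mult_ac)
    finally have "k * (\<Sum>v\<in>?V. (w v)\<^sup>2) \<le> \<mu> * (\<Sum>v\<in>?V. (w v)\<^sup>2)" using mu[of w] by simp
    moreover have "(\<Sum>v\<in>?V. (w v)\<^sup>2) > 0"
      using w(1) fin by (metis sum_pos2 zero_le_power2 zero_less_power2)
    ultimately show ?thesis by (simp add: mult_le_cancel_right)
  qed
  ultimately have "?R = \<mu>" unfolding R using fs by (intro Max_eqI) auto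
  with x mu show "quad_form ?V (adj G) y \<le> ?R * (\<Sum>v\<in>?V. (y v)\<^sup>2)"
    and "\<exists>x. (\<exists>v\<in>?V. x v \<noteq> 0) \<and> quad_form ?V (adj G) x = ?R * (\<Sum>v\<in>?V. (x v)\<^sup>2)"
    by auto
qed

lemma connected_pair_graph_iff:
  assumes "pair_graph G"
  shows "Digraph_Component.connected (with_proj G) \<longleftrightarrow>
    pverts G \<noteq> {} \<and> (\<forall>u\<in>pverts G. \<forall>v\<in>pverts G. (u, v) \<in> (parcs G)\<^sup>*)"
proof -
  interpret pair_graph G by fact
  have sc: "(parcs G)\<^sup>s = parcs G"
    using pair_graph_sym[OF assms] by (auto simp: symcl_def)
  have "(u, v) \<in> rtrancl_on (pverts G) (parcs G) \<longleftrightarrow> (u, v) \<in> (parcs G)\<^sup>*"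
    if "u \<in> pverts G" for u v
  proof
    assume "(u, v) \<in> rtrancl_on (pverts G) (parcs G)"
    then show "(u, v) \<in> (parcs G)\<^sup>*" by (rule rtrancl_on_rtranclI)
  next
    assume "(u, v) \<in> (parcs G)\<^sup>*"
    then show "(u, v) \<in> rtrancl_on (pverts G) (parcs G)"
    proof (induction rule: rtrancl_induct)
      case base then show ?case using that by (rule rtrancl_on_refl)
    next
      case (step y z) then show ?case
        using in_arcsD2 by (meson rtrancl_on_into_rtrancl_on)
    qed
  qed
  then show ?thesis by (auto simp: connected_conv sc)
qed

text \<open>Entries of \<open>adj\<close> are nonnegative, so passing to absolute values does not
  decrease the form and gives another maximiser. Its eigenvalue equation spreads a zero to all
  neighbours, hence by connectedness to all vertices.\<close>

lemma perron_vector_exists: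
  assumes G: "pair_graph G" and con: "Digraph_Component.connected (with_proj G)"
  shows "\<exists>x. (\<forall>v\<in>pverts G. x v > 0) \<and>
    quad_form (pverts G) (adj G) x = graph_spectral_radius G * (\<Sum>v\<in>pverts G. (x v)\<^sup>2)"
proof -
  let ?V = "pverts G" and ?R = "graph_spectral_radius G"
  note fin = pair_graph_finite[OF G]
  have ne: "?V \<noteq> {}" and reach: "\<And>u v. u \<in> ?V \<Longrightarrow> v \<in> ?V \<Longrightarrow> (u, v) \<in> (parcs G)\<^sup>*"
    using con connected_pair_graph_iff[OF G] by auto
  note ray = graph_spectral_radius_rayleigh(1)[OF G ne]
  obtain x0 where x0: "\<exists>v\<in>?V. x0 v \<noteq> 0" "quad_form ?V (adj G) x0 = ?R * (\<Sum>v\<in>?V. (x0 v)\<^sup>2)"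
    using graph_spectral_radius_rayleigh(2)[OF G ne] by blast
  define x where "x v = \<bar>x0 v\<bar>" for v
  have "quad_form ?V (adj G) x0 \<le> quad_form ?V (adj G) x"
    unfolding quad_form_def x_def
    by (intro sum_mono) (auto simp: adj_def abs_mult[symmetric])
  moreover have sq: "(\<Sum>v\<in>?V. (x v)\<^sup>2) = (\<Sum>v\<in>?V. (x0 v)\<^sup>2)" by (simp add: x_def)
  ultimately have eq: "quad_form ?V (adj G) x = ?R * (\<Sum>v\<in>?V. (x v)\<^sup>2)"
    using x0(2) ray[of x] by (metis order_antisym)
  have eig: "(\<Sum>u\<in>?V. adj G v u * x u) = ?R * x v" if "v \<in> ?V" for v
    using that by (rule quad_form_max_eigen[OF fin adj_sym[OF G] ray eq])
  have x_nn: "x v \<ge> 0" for v by (simp add: x_def)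
  have step: "x v = 0" if "x u = 0" "(u, v) \<in> parcs G" for u v
  proof -
    have uv: "u \<in> ?V" "v \<in> ?V" using pair_graph_wf[OF G] that by auto
    have "(\<Sum>w\<in>?V. adj G u w * x w) = 0" using eig[OF uv(1)] that by simp
    then have "adj G u v * x v = 0"
      using fin uv x_nn by (subst (asm) sum_nonneg_eq_0_iff) (auto simp: adj_def)
    then show ?thesis using that by (simp add: adj_def)
  qed
  have "x v > 0" if v: "v \<in> ?V" for v
  proof (rule ccontr)
    assume "\<not> x v > 0"
    then have v0: "x v = 0" using x_nn[of v] by simp
    have "x u = 0" if u: "u \<in> ?V" for u
      using reach[OF v u]
    proof (induction rule: rtrancl_induct)
      case base then show ?case by (rule v0)
    next
      case (step y z) then show ?case using \<open>\<And>u v. x u = 0 \<Longrightarrow> (u, v) \<in> parcs G \<Longrightarrow> x v = 0\<close> by blast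
    qed
    then show False using x0(1) by (auto simp: x_def)
  qed
  with eq show ?thesis by blast
qed

section \<open>Degrees and isomorphisms in terms of vertices and arcs\<close>

lemma out_degree_pair_graph:
  assumes "pair_graph G"
  shows "out_degree (with_proj G) v = card {u. (v, u) \<in> parcs G}"
proof -
  have "out_arcs (with_proj G) v = Pair v ` {u. (v, u) \<in> parcs G}"
    by (auto simp: out_arcs_def)
  then show ?thesis unfolding out_degree_def by (simp add: card_image inj_on_def)
qed

text \<open>The general notion carries separate maps for vertices, arcs, heads and tails. Since arcs
  here are pairs of vertices, the arc map is forced to act componentwise by the vertex map, and only
  an adjacency preserving bijection remains.\<close>

lemma digraph_iso_pair_graph_iff:
  assumes G: "pair_graph G" and H: "pair_graph H"
  shows "digraph_iso (with_proj G) (with_proj H) \<longleftrightarrow>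
    (\<exists>f. bij_betw f (pverts G) (pverts H) \<and>
      (\<forall>u\<in>pverts G. \<forall>v\<in>pverts G. (u, v) \<in> parcs G \<longleftrightarrow> (f u, f v) \<in> parcs H))"
    (is "?L \<longleftrightarrow> (\<exists>f. ?P f)")
proof
  interpret G: pair_graph G by fact
  assume ?L
  then obtain hom where hom: "pre_digraph.digraph_isomorphism (with_proj G) hom"
    and eq: "with_proj H = app_iso hom (with_proj G)" by (auto simp: digraph_iso_def)
  have inj: "inj_on (iso_verts hom) (pverts G)" "inj_on (iso_arcs hom) (parcs G)"
    and hd: "\<And>e. e \<in> parcs G \<Longrightarrow> iso_verts hom (fst e) = iso_tail hom (iso_arcs hom e)"
       "\<And>e. e \<in> parcs G \<Longrightarrow> iso_verts hom (snd e) = iso_head hom (iso_arcs hom e)"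
    using hom by (auto simp: G.digraph_isomorphism_def)
  have V: "pverts H = iso_verts hom ` pverts G" and A: "parcs H = iso_arcs hom ` parcs G"
    and "iso_tail hom = fst" "iso_head hom = snd"
    using eq by (auto simp: with_proj_def app_iso_def)
  then have arc: "iso_arcs hom e = (iso_verts hom (fst e), iso_verts hom (snd e))"
    if "e \<in> parcs G" for e
    using hd that by (simp add: prod_eq_iff)
  have "?P (iso_verts hom)"
  proof (intro conjI ballI iffI)
    show "bij_betw (iso_verts hom) (pverts G) (pverts H)" using inj V by (simp add: bij_betw_def)
  next
    fix u v assume uv: "(u, v) \<in> parcs G"
    then show "(iso_verts hom u, iso_verts hom v) \<in> parcs H" using arc[OF uv] A by force
  next
    fix u v assume uv: "u \<in> pverts G" "v \<in> pverts G" "(iso_verts hom u, iso_verts hom v) \<in> parcs H"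
    then obtain u' v' where e: "(u', v') \<in> parcs G"
      "(iso_verts hom u, iso_verts hom v) = iso_arcs hom (u', v')" using A by auto
    then have "iso_verts hom u = iso_verts hom u'" "iso_verts hom v = iso_verts hom v'"
      using arc by auto
    then have "u = u'" "v = v'" using inj uv G.wellformed'[OF e(1)] by (auto dest: inj_onD)
    then show "(u, v) \<in> parcs G" using e by simp
  qed
  then show "\<exists>f. ?P f" by blast
next
  interpret G: pair_graph G by fact
  assume "\<exists>f. ?P f"
  then obtain f where f: "bij_betw f (pverts G) (pverts H)"
    "\<And>u v. u\<in>pverts G \<Longrightarrow> v\<in>pverts G \<Longrightarrow> (u, v) \<in> parcs G \<longleftrightarrow> (f u, f v) \<in> parcs H" by blast
  have inj: "inj_on f (pverts G)" and im: "f ` pverts G = pverts H"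
    using f(1) by (auto simp: bij_betw_def)
  define hom where "hom = \<lparr>iso_verts = f, iso_arcs = map_prod f f, iso_head = snd, iso_tail = fst\<rparr>"
  have injA: "inj_on (map_prod f f) (parcs G)"
    using inj G.wellformed' by (auto simp: inj_on_def) 
  have arcs: "map_prod f f ` parcs G = parcs H"
  proof (rule Set.set_eqI, rule iffI)
    fix e assume "e \<in> map_prod f f ` parcs G"
    then obtain u v where uv: "(u, v) \<in> parcs G" "e = (f u, f v)" by auto
    show "e \<in> parcs H" unfolding uv(2) using f(2) G.wellformed'[OF uv(1)] uv(1) by blast
  next
    fix e assume e: "e \<in> parcs H"
    obtain c d where cd: "e = (c, d)" by (cases e)
    then obtain u v where uv: "u \<in> pverts G" "v \<in> pverts G" "c = f u" "d = f v"
    proof -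
      have "c \<in> f ` pverts G" "d \<in> f ` pverts G"
        using pair_graph_wf[OF H, of c d] e cd im by auto
      then show ?thesis using that by blast
    qed
    then have "(u, v) \<in> parcs G" using f(2)[OF uv(1,2)] e cd by metis
    then show "e \<in> map_prod f f ` parcs G" using uv cd by (metis map_prod_simp image_eqI)
  qed
  have "G.digraph_isomorphism hom"
    unfolding G.digraph_isomorphism_def using inj injA G.wf_digraph_axioms
    by (auto simp: hom_def)
  moreover have "with_proj H = app_iso hom (with_proj G)"
    using im arcs by (simp add: with_proj_def app_iso_def hom_def)
  ultimately show ?L unfolding digraph_iso_def by blast
qed

section \<open>Energies and cuts of a linearly ordered cubic network\<close>

definition gap :: "(nat \<Rightarrow> real) \<Rightarrow> nat \<Rightarrow> real" where
  "gap y j = y j - y (Suc j)"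

text \<open>
  For \<open>i < k\<close>, \<open>W i k\<close> is the number of edges joining \<open>i\<close> and \<open>k\<close>; \<open>Suc n\<close> is the boundary vertex.
  Only \<open>l \<le> m\<close> is meaningful in \<open>cut n W l m\<close>.
\<close>

definition cut :: "nat \<Rightarrow> (nat \<Rightarrow> nat \<Rightarrow> nat) \<Rightarrow> nat \<Rightarrow> nat \<Rightarrow> nat" where
  "cut n W l m = (\<Sum>i=1..l. \<Sum>k=Suc m..Suc n. W i k)"

definition energy :: "nat \<Rightarrow> (nat \<Rightarrow> nat \<Rightarrow> nat) \<Rightarrow> (nat \<Rightarrow> real) \<Rightarrow> real" where
  "energy n W y = (\<Sum>i=1..n. \<Sum>k=Suc i..Suc n. real (W i k) * (y i - y k)\<^sup>2)"

definition band_form :: "nat \<Rightarrow> (nat \<Rightarrow> nat \<Rightarrow> real) \<Rightarrow> (nat \<Rightarrow> real) \<Rightarrow> real" where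
  "band_form n C d = (\<Sum>l=1..n. \<Sum>m=1..n. C (min l m) (max l m) * d l * d m)"

lemma sum_gap: "i \<le> k \<Longrightarrow> (\<Sum>j=i..<k. gap y j) = y i - y k"
  by (induction k rule: dec_induct) (auto simp: gap_def)

text \<open>An edge from \<open>i\<close> to \<open>k\<close> stretches over the gaps
  \<open>i, ..., k - 1\<close>. When their sum is squared, the product of gaps \<open>l\<close> and
  \<open>m\<close> occurs exactly if \<open>i \<le> min l m\<close> and \<open>max l m < k\<close>;
  the edges with this property are those counted by the cut.\<close>

lemma energy_eq_band_form:
  "energy n W y = band_form n (\<lambda>l m. real (cut n W l m)) (gap y)"
proof -
  define P where "P i k j = (of_bool (i \<le> j \<and> j < k) :: real)" for i k j :: nat
  have sq: "(y i - y k)\<^sup>2 = (\<Sum>l=1..n. \<Sum>m=1..n. P i k l * P i k m * (gap y l * gap y m))"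
    if ik: "1 \<le> i" "i \<le> k" "k \<le> Suc n" for i k
  proof -
    have "y i - y k = (\<Sum>j\<in>{1..n} \<inter> {i..<k}. gap y j)"
      using ik by (subst sum_gap[symmetric]) (auto intro!: sum.cong)
    also have "\<dots> = (\<Sum>j=1..n. if j \<in> {i..<k} then gap y j else 0)"
      by (rule sum.inter_restrict) simp
    also have "\<dots> = (\<Sum>j=1..n. P i k j * gap y j)"
      by (intro sum.cong) (auto simp: P_def)
    finally have "(y i - y k)\<^sup>2 = (\<Sum>l=1..n. P i k l * gap y l) * (\<Sum>m=1..n. P i k m * gap y m)"
      by (simp add: power2_eq_square)
    then show ?thesis unfolding sum_product by (simp add: mult_ac)
  qed
  have cutP: "real (cut n W (min l m) (max l m)) =
      (\<Sum>i=1..n. \<Sum>k=Suc i..Suc n. real (W i k) * (P i k l * P i k m))"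
    if lm: "l \<in> {1..n}" "m \<in> {1..n}" for l m
  proof -
    have inner: "(\<Sum>k=Suc i..Suc n. real (W i k) * (P i k l * P i k m)) =
       (if i \<le> min l m then \<Sum>k=Suc (max l m)..Suc n. real (W i k) else 0)" for i
    proof (cases "i \<le> min l m")
      case True
      have "(\<Sum>k=Suc i..Suc n. real (W i k) * (P i k l * P i k m)) =
        (\<Sum>k\<in>{Suc i..Suc n}. if k \<in> {Suc (max l m)..Suc n} then real (W i k) else 0)"
        using True by (intro sum.cong) (auto simp: P_def)
      also have "\<dots> = (\<Sum>k\<in>{Suc i..Suc n} \<inter> {Suc (max l m)..Suc n}. real (W i k))"
        by (rule sum.inter_restrict[symmetric]) simp
      also have "{Suc i..Suc n} \<inter> {Suc (max l m)..Suc n} = {Suc (max l m)..Suc n}"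
        using True by auto
      finally show ?thesis using True by simp
    next
      case False
      then show ?thesis by (auto simp: P_def intro!: sum.neutral)
    qed
    have "(\<Sum>i=1..n. \<Sum>k=Suc i..Suc n. real (W i k) * (P i k l * P i k m)) =
      (\<Sum>i=1..n. if i \<in> {1..min l m} then \<Sum>k=Suc (max l m)..Suc n. real (W i k) else 0)"
      unfolding inner by (intro sum.cong) auto
    also have "\<dots> = (\<Sum>i\<in>{1..n} \<inter> {1..min l m}. \<Sum>k=Suc (max l m)..Suc n. real (W i k))"
      by (rule sum.inter_restrict[symmetric]) simp
    also have "{1..n} \<inter> {1..min l m} = {1..min l m}" using lm by auto
    finally show ?thesis by (simp add: cut_def del: sum.cl_ivl_Suc)
  qed
  have "energy n W y = (\<Sum>i=1..n. \<Sum>k=Suc i..Suc n. \<Sum>l=1..n. \<Sum>m=1..n.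
      real (W i k) * (P i k l * P i k m) * (gap y l * gap y m))"
    unfolding energy_def
  proof (intro sum.cong refl)
    fix i k assume "i \<in> {1..n}" "k \<in> {Suc i..Suc n}"
    then have "(y i - y k)\<^sup>2 = (\<Sum>l=1..n. \<Sum>m=1..n. P i k l * P i k m * (gap y l * gap y m))"
      by (intro sq) auto
    then show "real (W i k) * (y i - y k)\<^sup>2 = (\<Sum>l=1..n. \<Sum>m=1..n.
      real (W i k) * (P i k l * P i k m) * (gap y l * gap y m))"
      by (simp add: sum_distrib_left mult_ac)
  qed
  also have "\<dots> = (\<Sum>i=1..n. \<Sum>l=1..n. \<Sum>k=Suc i..Suc n. \<Sum>m=1..n.
      real (W i k) * (P i k l * P i k m) * (gap y l * gap y m))"
    by (intro sum.cong refl sum.swap)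
  also have "\<dots> = (\<Sum>l=1..n. \<Sum>i=1..n. \<Sum>k=Suc i..Suc n. \<Sum>m=1..n.
      real (W i k) * (P i k l * P i k m) * (gap y l * gap y m))"
    by (rule sum.swap)
  also have "\<dots> = (\<Sum>l=1..n. \<Sum>i=1..n. \<Sum>m=1..n. \<Sum>k=Suc i..Suc n.
      real (W i k) * (P i k l * P i k m) * (gap y l * gap y m))"
    by (intro sum.cong refl sum.swap)
  also have "\<dots> = (\<Sum>l=1..n. \<Sum>m=1..n. \<Sum>i=1..n. \<Sum>k=Suc i..Suc n.
      real (W i k) * (P i k l * P i k m) * (gap y l * gap y m))"
    by (intro sum.cong refl sum.swap)
  also have "\<dots> = band_form n (\<lambda>l m. real (cut n W l m)) (gap y)"
    unfolding band_form_def
    by (intro sum.cong refl) (simp only: cutP sum_distrib_right mult.assoc)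
  finally show ?thesis .
qed

text \<open>Summation by parts; the boundary value 0 removes the last term.\<close>

lemma sum_mult_gap:
  assumes "y (Suc n) = 0"
  shows "(\<Sum>i=1..n. x i * y i) = (\<Sum>j=1..n. (\<Sum>i=1..j. x i) * gap y j)"
proof -
  have "(\<Sum>i=1..N. x i * y i) = (\<Sum>j=1..N. (\<Sum>i=1..j. x i) * gap y j) + (\<Sum>i=1..N. x i) * y (Suc N)"
    for N by (induction N) (auto simp: gap_def algebra_simps)
  then show ?thesis using assms by simp
qed

text \<open>Multiple edges occur only towards the boundary \<open>Suc n\<close>. The condition
  \<open>cut_pos\<close> is what connectedness and nonregularity contribute.\<close>

locale network =
  fixes n :: nat and W :: "nat \<Rightarrow> nat \<Rightarrow> nat"
  assumes n_ge: "8 \<le> n"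
    and simple: "1 \<le> i \<Longrightarrow> i < k \<Longrightarrow> k \<le> n \<Longrightarrow> W i k \<le> 1"
    and degree: "1 \<le> j \<Longrightarrow> j \<le> n \<Longrightarrow> (\<Sum>i=1..<j. W i j) + (\<Sum>k=Suc j..Suc n. W j k) = 3"
    and cut_pos: "1 \<le> j \<Longrightarrow> j \<le> n \<Longrightarrow> 1 \<le> cut n W j j"
begin

definition lower :: "nat \<Rightarrow> nat" where "lower j = (\<Sum>i=1..<j. W i j)"

lemma cut_Suc_left: "cut n W (Suc l) m = cut n W l m + (\<Sum>k=Suc m..Suc n. W (Suc l) k)"
  by (simp add: cut_def)

lemma cut_Suc_right:
  assumes "m \<le> n"
  shows "cut n W l m = cut n W l (Suc m) + (\<Sum>i=1..l. W i (Suc m))"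
proof -
  have "(\<Sum>k=Suc m..Suc n. W i k) = W i (Suc m) + (\<Sum>k=Suc (Suc m)..Suc n. W i k)" for i
    by (rule sum.atLeast_Suc_atMost) (use assms in simp)
  then show ?thesis by (simp add: cut_def sum.distrib)
qed

lemma lower_Suc: "lower (Suc j) = (\<Sum>i=1..j. W i (Suc j))"
  by (simp add: lower_def atLeastLessThanSuc_atLeastAtMost)

text \<open>Of the three edges at vertex \<open>Suc j\<close>, those going back leave the cut and
  those going forward enter it. The first identity expresses the off-diagonal cut through diagonal
  ones, so lower bounds are mainly needed on the diagonal.\<close>

lemma cut_diag_Suc:
  assumes "Suc j \<le> n"
  shows "cut n W j j + cut n W (Suc j) (Suc j) = 2 * cut n W j (Suc j) + 3"
    and "cut n W (Suc j) (Suc j) + 2 * lower (Suc j) = cut n W j j + 3"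
proof -
  have 1: "cut n W j j = cut n W j (Suc j) + lower (Suc j)"
    using assms by (simp add: cut_Suc_right[of j] lower_Suc)
  have 2: "cut n W (Suc j) (Suc j) = cut n W j (Suc j) + (\<Sum>k=Suc (Suc j)..Suc n. W (Suc j) k)"
    by (rule cut_Suc_left)
  have 3: "lower (Suc j) + (\<Sum>k=Suc (Suc j)..Suc n. W (Suc j) k) = 3"
    using degree[of "Suc j"] assms by (simp add: lower_def)
  show "cut n W j j + cut n W (Suc j) (Suc j) = 2 * cut n W j (Suc j) + 3" using 1 2 3 by simp
  show "cut n W (Suc j) (Suc j) + 2 * lower (Suc j) = cut n W j j + 3" using 1 2 3 by simp
qed

lemma cut_0: "cut n W 0 m = 0" by (simp add: cut_def)

text \<open>Each step changes the cut by 3 minus an even number.\<close>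

lemma cut_diag_parity: "j \<le> n \<Longrightarrow> even (cut n W j j) \<longleftrightarrow> even j"
proof (induction j)
  case (Suc j)
  have "even (cut n W (Suc j) (Suc j) + 2 * lower (Suc j)) \<longleftrightarrow> even (cut n W j j + 3)"
    using cut_diag_Suc(2)[OF Suc.prems] by simp
  then show ?case using Suc by simp
qed (simp add: cut_0)

lemma lower_le: "Suc j \<le> n \<Longrightarrow> lower (Suc j) \<le> j"
proof -
  assume "Suc j \<le> n"
  then have "lower (Suc j) \<le> (\<Sum>i=1..j. 1)"
    unfolding lower_Suc by (intro sum_mono simple) auto
  then show ?thesis by simp
qed

text \<open>Simplicity leaves at most one edge back from vertex 2 and two from vertex 3. This
  excludes bridges at positions 1 and 3 and produces the exceptional value 4 at position 2.\<close>

lemma cut_diag_small: "cut n W 1 1 = 3" "4 \<le> cut n W 2 2" "3 \<le> cut n W 3 3"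
proof -
  have e1: "cut n W 1 1 + 2 * lower 1 = 3" using cut_diag_Suc(2)[of 0] n_ge by (simp add: cut_0)
  have b: "lower 1 = 0" by (simp add: lower_def)
  show "cut n W 1 1 = 3" using e1 b by simp
  have e2: "cut n W 2 2 + 2 * lower 2 = cut n W 1 1 + 3"
    using cut_diag_Suc(2)[of 1] n_ge by (simp add: numeral_2_eq_2)
  have e3: "cut n W 3 3 + 2 * lower 3 = cut n W 2 2 + 3"
    using cut_diag_Suc(2)[of 2] n_ge by (simp add: numeral_3_eq_3 numeral_2_eq_2)
  have "lower 2 \<le> 1" "lower 3 \<le> 2"
    using lower_le[of 1] lower_le[of 2] n_ge by (simp_all add: numeral_3_eq_3 numeral_2_eq_2)
  then show "4 \<le> cut n W 2 2" "3 \<le> cut n W 3 3" using e1 e2 e3 b by linarith+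
qed

lemma cut_diag_even: "j \<le> n \<Longrightarrow> even j \<Longrightarrow> 2 \<le> j \<Longrightarrow> 2 \<le> cut n W j j"
  using cut_diag_parity[of j] cut_pos[of j] by (cases "cut n W j j = 1") auto

lemma cut_diag_odd: "j \<le> n \<Longrightarrow> odd j \<Longrightarrow> cut n W j j \<noteq> 1 \<Longrightarrow> 3 \<le> cut n W j j"
  using cut_diag_parity[of j] by (cases "cut n W j j = 2"; cases "cut n W j j = 0") auto

text \<open>Vertices \<open>j + 1\<close> and \<open>j + 2\<close> can have back edges only through
  the single bridge edge and the edge joining them. With at most two back edges the cut grows by at
  least 6 - 4 over these two steps.\<close>

lemma bridge_separation:
  assumes "1 \<le> j" "j + 2 \<le> n" "cut n W j j = 1"
  shows "cut n W (j + 2) (j + 2) \<noteq> 1"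
proof -
  have 1: "cut n W j j = cut n W j (Suc j) + (\<Sum>i=1..j. W i (Suc j))"
    using assms by (intro cut_Suc_right) auto
  have 2: "cut n W j (Suc j) = cut n W j (Suc (Suc j)) + (\<Sum>i=1..j. W i (Suc (Suc j)))"
    using assms by (intro cut_Suc_right) auto
  have 3: "lower (Suc (Suc j)) = (\<Sum>i=1..j. W i (Suc (Suc j))) + W (Suc j) (Suc (Suc j))"
    using assms by (simp add: lower_Suc)
  have 4: "W (Suc j) (Suc (Suc j)) \<le> 1" using assms by (intro simple) auto
  have "lower (Suc j) + lower (Suc (Suc j)) \<le> 2" using 1 2 3 4 assms by (simp add: lower_Suc)
  then show ?thesis
    using cut_diag_Suc(2)[of j] cut_diag_Suc(2)[of "Suc j"] assms by simp
qed

text \<open>Vertex 1 has three forward edges, of which at most one ends at 2 and at most one at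
  3.\<close>

lemma cut_1_3: "1 \<le> cut n W 1 3"
proof -
  have "3 = cut n W 1 1" using cut_diag_small by simp
  also have "\<dots> = cut n W 1 2 + W 1 2" using cut_Suc_right[of 1 1] n_ge by (simp add: numeral_2_eq_2)
  also have "cut n W 1 2 = cut n W 1 3 + W 1 3"
    using cut_Suc_right[of 2 1] n_ge by (simp add: numeral_3_eq_3 numeral_2_eq_2)
  finally show ?thesis using simple[of 1 2] simple[of 1 3] n_ge by simp
qed

text \<open>By parity and the bounds at positions 1 and 3, these are all the positions left by
  exactly one edge.\<close>

definition bridges :: "nat set" where
  "bridges = {j. 5 \<le> j \<and> j \<le> n \<and> odd j \<and> cut n W j j = 1}"

end

text \<open>
  The smallest cut sizes compatible with the set \<open>B\<close> of bridge positions, and the smallest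
  numbers \<open>model B l m\<close> of edges running from \<open>{1..l}\<close> to beyond \<open>m\<close>.
\<close>

definition min_cut :: "nat set \<Rightarrow> nat \<Rightarrow> real" where
  "min_cut B j = (if j = 0 then 0 else if j = 2 then 4 else if even j then 2 else if j \<in> B then 1 else 3)"

definition model :: "nat set \<Rightarrow> nat \<Rightarrow> nat \<Rightarrow> real" where
  "model B l m = (if l = m then min_cut B l
     else if m = Suc l then (min_cut B l + min_cut B m - 3) / 2
     else if l = 1 \<and> m = 3 then 1 else 0)"

context network
begin

lemma min_cut_le:
  assumes "B \<supseteq> bridges" "1 \<le> j" "j \<le> n" "1 \<notin> B" "3 \<notin> B"
  shows "min_cut B j \<le> real (cut n W j j)"
proof -
  consider "j = 1" | "j = 2" | "j = 3" | "even j" "j \<noteq> 2" | "odd j" "j \<in> B" | "odd j" "j \<notin> B" "j \<noteq> 1" "j \<noteq> 3"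
    by blast
  then show ?thesis
  proof cases
    case 1 then show ?thesis using assms cut_diag_small by (simp add: min_cut_def)
  next
    case 2 then show ?thesis using cut_diag_small by (simp add: min_cut_def)
  next
    case 3 then show ?thesis using assms cut_diag_small by (simp add: min_cut_def)
  next
    case 4 then show ?thesis using assms cut_diag_even[of j] by (cases "j = 1") (auto simp: min_cut_def)
  next
    case 5 then show ?thesis using assms cut_pos[of j] by (auto simp: min_cut_def)
  next
    case 6
    then have "j \<ge> 5" using assms by presburger
    with 6 have "cut n W j j \<noteq> 1" using assms by (auto simp: bridges_def)
    with 6 have "3 \<le> cut n W j j" using assms by (intro cut_diag_odd) auto
    with 6 show ?thesis by (auto simp: min_cut_def)
  qed
qed

text \<open>By \<open>cut_diag_Suc\<close> a cut next to the diagonal is half of two diagonal cuts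
  minus 3, so it inherits their bounds. Only the entry at 1 and 3 has a reason of its own.\<close>

lemma model_le_cut:
  assumes B: "B \<supseteq> bridges" "1 \<notin> B" "3 \<notin> B" and lm: "1 \<le> l" "l \<le> m" "m \<le> n"
  shows "model B l m \<le> real (cut n W l m)"
proof -
  consider "l = m" | "m = Suc l" | "l = 1 \<and> m = 3" | "l \<noteq> m" "m \<noteq> Suc l" "\<not> (l = 1 \<and> m = 3)" by blast
  then show ?thesis
  proof cases
    case 1 then show ?thesis using min_cut_le[OF B(1)] assms by (simp add: model_def)
  next
    case 2
    have "real (cut n W l l) + real (cut n W m m) = 2 * real (cut n W l m) + 3"
      using cut_diag_Suc(1)[of l] lm 2 by (metis of_nat_add of_nat_mult of_nat_numeral)
    then show ?thesis
      using min_cut_le[OF B(1), of l] min_cut_le[OF B(1), of m] assms 2 by (simp add: model_def)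
  next
    case 3 then show ?thesis using cut_1_3 by (simp add: model_def)
  qed (auto simp: model_def)
qed

end

text \<open>The form is tridiagonal apart from the product of gaps 1 and 3. The convention
  \<open>min_cut B 0 = 0\<close> makes the coefficient 0 + 3 - 3 at \<open>i = 1\<close> vanish, so
  the meaningless \<open>d 0\<close> drops out.\<close>

lemma band_form_model:
  assumes "3 \<le> n" "1 \<notin> B"
  shows "band_form n (model B) d = (\<Sum>i=1..n. min_cut B i * (d i)\<^sup>2 +
    (min_cut B (i - 1) + min_cut B i - 3) * d (i - 1) * d i) + 2 * d 1 * d 3"
  using assms(1)
proof (induction n rule: dec_induct)
  case base
  have *: "{1..3} = {1, 2, 3::nat}" by auto
  show ?case using assms(2) unfolding band_form_def *
    by (simp add: model_def min_cut_def algebra_simps power2_eq_square)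
next
  case (step N)
  have "(\<Sum>l=1..N. model B (min l (Suc N)) (max l (Suc N)) * d l * d (Suc N))
     = (\<Sum>l=1..N. if l = N then model B N (Suc N) * d N * d (Suc N) else 0)"
    using step(1) by (intro sum.cong) (auto simp: model_def)
  also have "\<dots> = model B N (Suc N) * d N * d (Suc N)" using step(1) by simp
  finally have 1: "(\<Sum>l=1..N. model B (min l (Suc N)) (max l (Suc N)) * d l * d (Suc N)) =
     model B N (Suc N) * d N * d (Suc N)" .
  have 2: "(\<Sum>l=1..N. model B (min (Suc N) l) (max (Suc N) l) * d (Suc N) * d l) =
     model B N (Suc N) * d N * d (Suc N)"
    unfolding 1[symmetric] by (intro sum.cong) (auto simp: min.commute max.commute)
  have cl: "sum g {1..Suc N} = sum g {1..N} + g (Suc N)" for g :: "nat \<Rightarrow> real" by simp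
  have "band_form (Suc N) (model B) d = band_form N (model B) d +
      2 * (model B N (Suc N) * d N * d (Suc N)) + model B (Suc N) (Suc N) * d (Suc N) * d (Suc N)"
    unfolding band_form_def cl sum.distrib 1 2 by simp
  moreover have "model B N (Suc N) = (min_cut B N + min_cut B (Suc N) - 3) / 2"
    "model B (Suc N) (Suc N) = min_cut B (Suc N)" by (simp_all add: model_def)
  ultimately show ?case using step by (simp add: power2_eq_square)
qed

section \<open>The dual problem and shifting a bridge\<close>

text \<open>A product of neighbouring gaps is charged to the larger index; a partial sum up to an
  even index then leaves just one coupling open.\<close>

definition dual_term :: "nat set \<Rightarrow> (nat \<Rightarrow> real) \<Rightarrow> (nat \<Rightarrow> real) \<Rightarrow> nat \<Rightarrow> real" where
  "dual_term B f d i = 2 * f i * d i - min_cut B i * (d i)\<^sup>2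
     - (min_cut B (i - 1) + min_cut B i - 3) * d (i - 1) * d i"

definition dual_val :: "nat \<Rightarrow> nat set \<Rightarrow> (nat \<Rightarrow> real) \<Rightarrow> (nat \<Rightarrow> real) \<Rightarrow> real" where
  "dual_val n B f d = (\<Sum>i=1..n. dual_term B f d i) - 2 * d 1 * d 3"

lemma dual_val_eq:
  assumes "3 \<le> n" "1 \<notin> B"
  shows "dual_val n B f d = 2 * (\<Sum>i=1..n. f i * d i) - band_form n (model B) d"
  unfolding band_form_model[OF assms] dual_val_def dual_term_def
  by (simp add: sum_subtractf sum.distrib sum_distrib_left algebra_simps)

definition bend :: "(nat \<Rightarrow> real) \<Rightarrow> nat \<Rightarrow> real" where
  "bend f i = 2 * f i - f (i - 1) - f (Suc i)"

text \<open>
  Maximising \<^const>\<open>dual_term\<close> over the gaps of even index first leaves, at the odd indices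
  outside \<open>B\<close>, only the second differences of \<open>f\<close>.
\<close>

definition term_bound :: "nat set \<Rightarrow> (nat \<Rightarrow> real) \<Rightarrow> nat \<Rightarrow> real" where
  "term_bound B f i = (if i = 2 then (f i)\<^sup>2 / 4 else if even i then (f i)\<^sup>2 / 2
     else if i \<in> B then (f i)\<^sup>2 else (bend f i)\<^sup>2 / 4)"

lemma square_bound: "2 * p * x - x\<^sup>2 \<le> (p::real)\<^sup>2"
  using zero_le_power2[of "x - p"] by (simp add: power2_eq_square algebra_simps)

text \<open>Treats an odd gap together with the following even one; \<open>t\<close> is the coupling
  still open at \<open>N + 2\<close>. The coupling of gap \<open>N + 1\<close> with its even
  neighbours is 0 at a bridge and 2 elsewhere, hence the conditional value. Used as the
  \<open>t\<close> of the bound ending at \<open>N\<close>, that value makes its linear term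
  \<open>f N\<close> and its square cancel.\<close>

lemma dual_term_two_step:
  assumes N: "even N" "4 \<le> N"
  shows "dual_term B f d (N + 1) + dual_term B f d (N + 2) - 2 * d (N + 2) * t
    \<le> - 2 * d N * (if N + 1 \<in> B then 0 else d (N + 1))
      + f N * (if N + 1 \<in> B then 0 else d (N + 1)) - (if N + 1 \<in> B then 0 else d (N + 1))\<^sup>2
      + term_bound B f (N + 1) + term_bound B f (N + 2) - f (N + 2) * t + t\<^sup>2"
proof -
  define x y where "x = d (N + 1)" and "y = d (N + 2)"
  define b where "b = (if N + 1 \<in> B then 0 else x)"
  have odd: "odd (N + 1)" "even (N + 2)" using N by auto
  have t1: "dual_term B f d (N + 1) =
     (if N + 1 \<in> B then 2 * f (N + 1) * x - x\<^sup>2 else 2 * f (N + 1) * x - 3 * x\<^sup>2 - 2 * d N * x)"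
    using N odd by (auto simp: dual_term_def min_cut_def x_def)
  have t2: "dual_term B f d (N + 2) = 2 * f (N + 2) * y - 2 * y\<^sup>2 - 2 * b * y"
    using N odd by (auto simp: dual_term_def min_cut_def x_def y_def b_def)
  \<comment> \<open>First maximise over the even gap \<open>y\<close>, then separate
    \<open>b\<close> and \<open>t\<close> by bounding the square of their sum by twice the sum of
    their squares. The resulting \<open>b\<^sup>2\<close> is paid for by the coefficient 3 of the
    odd gap.\<close>
  have "2 * (f (N + 2) - b - t) * y - 2 * y\<^sup>2 \<le> (f (N + 2) - b - t)\<^sup>2 / 2"
    using zero_le_power2[of "2 * y - (f (N + 2) - b - t)"] by (simp add: power2_eq_square field_simps)
  also have "\<dots> \<le> (f (N + 2))\<^sup>2 / 2 - f (N + 2) * b - f (N + 2) * t + b\<^sup>2 + t\<^sup>2"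
    using zero_le_power2[of "b - t"] by (simp add: power2_eq_square field_simps)
  finally have e: "dual_term B f d (N + 2) - 2 * y * t
     \<le> (f (N + 2))\<^sup>2 / 2 - f (N + 2) * b - f (N + 2) * t + b\<^sup>2 + t\<^sup>2"
    unfolding t2 by (simp add: algebra_simps)
  have u2: "term_bound B f (N + 2) = (f (N + 2))\<^sup>2 / 2" using N by (simp add: term_bound_def)
  show ?thesis
  proof (cases "N + 1 \<in> B")
    case True
    then have "term_bound B f (N + 1) = (f (N + 1))\<^sup>2" using odd by (auto simp: term_bound_def)
    then show ?thesis using e t1 True square_bound[of "f (N + 1)" x] u2
      by (simp add: b_def y_def)
  next
    case False
    have u1: "term_bound B f (N + 1) = (bend f (N + 1))\<^sup>2 / 4" using odd False by (auto simp: term_bound_def)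
    \<comment> \<open>Two halves of the linear coefficient have been spent at the even neighbours:
      \<open>f (N + 2)\<close> here and \<open>f N\<close> in the preceding step. What remains is
      the second difference.\<close>
    have s: "2 * f (N + 1) - f (N + 2) = bend f (N + 1) + f N" by (simp add: bend_def)
    have "bend f (N + 1) * x - x\<^sup>2 \<le> (bend f (N + 1))\<^sup>2 / 4"
      using square_bound[of "bend f (N + 1) / 2" x] by (simp add: power2_eq_square field_simps)
    moreover have "2 * f (N + 1) * x - f (N + 2) * x = bend f (N + 1) * x + f N * x"
      using s by (metis left_diff_distrib distrib_right)
    ultimately show ?thesis using e t1 False u1 u2
      unfolding b_def x_def[symmetric] y_def[symmetric] by simp
  qed
qed

lemma sum_two_step: "(\<Sum>i=Suc j..N + 2. g i) = (\<Sum>i=Suc j..N. g i) + g (N + 1) + (g (N + 2)::real)"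
  if "j \<le> N" for j N :: nat
  using that by simp

lemma dual_sum_two_step:
  assumes N: "even N" "4 \<le> N" "j \<le> N"
    and IH: "\<And>t. (\<Sum>i=Suc j..N. dual_term B f d i) - c - 2 * d N * t
      \<le> (\<Sum>i=Suc j..N. term_bound B f i) - f N * t + t\<^sup>2"
  shows "(\<Sum>i=Suc j..N + 2. dual_term B f d i) - c - 2 * d (N + 2) * t
      \<le> (\<Sum>i=Suc j..N + 2. term_bound B f i) - f (N + 2) * t + t\<^sup>2"
  unfolding sum_two_step[OF N(3)]
  \<comment> \<open>The gap coupled to gap \<open>N\<close> is the next odd one, or none if
    \<open>N + 1\<close> is a bridge.\<close>
  using IH[of "if N + 1 \<in> B then 0 else d (N + 1)"] dual_term_two_step[OF N(1,2), of B f d t]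
  by linarith

text \<open>The auxiliary \<open>t\<close> stands for the next gap, coupled to the last one of even index.\<close>

lemma dual_tail_even:
  assumes "j \<in> B" "odd j" "5 \<le> j" "even N" "j < N"
  shows "(\<Sum>i=Suc j..N. dual_term B f d i) - 2 * d N * t
    \<le> (\<Sum>i=Suc j..N. term_bound B f i) - f N * t + t\<^sup>2"
proof -
  have "\<forall>t. (\<Sum>i=Suc j..Suc j + 2 * m. dual_term B f d i) - 2 * d (Suc j + 2 * m) * t
    \<le> (\<Sum>i=Suc j..Suc j + 2 * m. term_bound B f i) - f (Suc j + 2 * m) * t + t\<^sup>2" for m
  proof (induction m)
    case 0
    define y where "y = d (Suc j)"
    have "2 * (f (Suc j) - t) * y - 2 * y\<^sup>2 \<le> (f (Suc j) - t)\<^sup>2 / 2" for t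
      using zero_le_power2[of "2 * y - (f (Suc j) - t)"] by (simp add: power2_eq_square field_simps)
    also have "(f (Suc j) - t)\<^sup>2 / 2 \<le> (f (Suc j))\<^sup>2 / 2 - f (Suc j) * t + t\<^sup>2" for t
      by (simp add: power2_eq_square field_simps)
    finally show ?case using assms
      by (auto simp: dual_term_def min_cut_def term_bound_def algebra_simps simp flip: y_def)
  next
    case (Suc m)
    let ?N = "Suc j + 2 * m"
    have IH: "(\<Sum>i=Suc j..?N. dual_term B f d i) - 0 - 2 * d ?N * t
      \<le> (\<Sum>i=Suc j..?N. term_bound B f i) - f ?N * t + t\<^sup>2" for t
      using Suc.IH by simp
    have "even ?N" "4 \<le> ?N" "j \<le> ?N" using assms by auto
    from dual_sum_two_step[OF this IH]
    have *: "(\<Sum>i=Suc j..?N + 2. dual_term B f d i) - 2 * d (?N + 2) * t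
      \<le> (\<Sum>i=Suc j..?N + 2. term_bound B f i) - f (?N + 2) * t + t\<^sup>2" for t
      by simp
    have **: "?N + 2 = Suc j + 2 * Suc m" by simp
    show ?case using * unfolding ** by blast
  qed
  moreover obtain m where "N = Suc j + 2 * m"
  proof -
    have "even (N - Suc j)" using assms by auto
    then obtain m where "N - Suc j = 2 * m" by (elim evenE)
    then have "N = Suc j + 2 * m" using assms by simp
    then show ?thesis using that by blast
  qed
  ultimately show ?thesis by blast
qed

text \<open>The same induction, started at the head. The minimal cut 4 at position 2 and the extra
  product of gaps 1 and 3 are absorbed in the base case \<open>N = 4\<close>.\<close>

lemma dual_head:
  assumes "1 \<notin> B" "3 \<notin> B" "even N" "4 \<le> N" and f0: "f 0 = 0"
  shows "(\<Sum>i=1..N. dual_term B f d i) - 2 * d 1 * d 3 - 2 * d N * t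
    \<le> (\<Sum>i=1..N. term_bound B f i) - f N * t + t\<^sup>2"
proof -
  have "\<forall>t. (\<Sum>i=Suc 0..4 + 2 * m. dual_term B f d i) - 2 * d 1 * d 3 - 2 * d (4 + 2 * m) * t
    \<le> (\<Sum>i=Suc 0..4 + 2 * m. term_bound B f i) - f (4 + 2 * m) * t + t\<^sup>2" for m
  proof (induction m)
    case 0
    have *: "{Suc 0..4} = {1, 2, 3, 4}" by auto
    define x1 x2 x3 x4 where "x1 = d 1" and "x2 = d 2" and "x3 = d 3" and "x4 = d 4"
    define f1 f2 f3 f4 where "f1 = f 1" and "f2 = f 2" and "f3 = f 3" and "f4 = f 4"
    have 1: "(\<Sum>i=Suc 0..4. dual_term B f d i) = 2 * f1 * x1 - 3 * x1\<^sup>2 + 2 * f2 * x2 - 4 * x2\<^sup>2 - 4 * x1 * x2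
       + 2 * f3 * x3 - 3 * x3\<^sup>2 - 4 * x2 * x3 + 2 * f4 * x4 - 2 * x4\<^sup>2 - 2 * x3 * x4"
      unfolding * using assms by (simp add: dual_term_def min_cut_def x1_def x2_def x3_def x4_def
        f1_def f2_def f3_def f4_def)
    have 2: "(\<Sum>i=Suc 0..4. term_bound B f i) = (2 * f1 - f2)\<^sup>2 / 4 + f2\<^sup>2 / 4 + (2 * f3 - f2 - f4)\<^sup>2 / 4 + f4\<^sup>2 / 2"
    proof -
      have "bend f 1 = 2 * f1 - f2" "bend f 3 = 2 * f3 - f2 - f4"
        using f0 by (simp_all add: bend_def f1_def f2_def f3_def f4_def eval_nat_numeral)
      then have "term_bound B f 1 = (2 * f1 - f2)\<^sup>2 / 4" "term_bound B f 2 = f2\<^sup>2 / 4"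
        "term_bound B f 3 = (2 * f3 - f2 - f4)\<^sup>2 / 4" "term_bound B f 4 = f4\<^sup>2 / 2"
        using assms by (simp_all add: term_bound_def f2_def f4_def)
      then show ?thesis unfolding * by simp
    qed
    have "2 * f1 * x1 - 3 * x1\<^sup>2 + 2 * f2 * x2 - 4 * x2\<^sup>2 - 4 * x1 * x2
       + 2 * f3 * x3 - 3 * x3\<^sup>2 - 4 * x2 * x3 + 2 * f4 * x4 - 2 * x4\<^sup>2 - 2 * x3 * x4
       - 2 * x1 * x3 - 2 * x4 * t \<le>
      (2 * f1 - f2)\<^sup>2 / 4 + f2\<^sup>2 / 4 + (2 * f3 - f2 - f4)\<^sup>2 / 4 + f4\<^sup>2 / 2 - f4 * t + t\<^sup>2" for t
    proof -
      \<comment> \<open>Squares are completed in the even gaps \<open>x2\<close> and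
        \<open>x4\<close> first. The extra product \<open>2 * x1 * x3\<close> is exactly the cross
        term demanded by the square around \<open>2 * x2\<close>.\<close>
      have "(2 * f1 - f2)\<^sup>2 / 4 + f2\<^sup>2 / 4 + (2 * f3 - f2 - f4)\<^sup>2 / 4 + f4\<^sup>2 / 2 - f4 * t + t\<^sup>2
        - (2 * f1 * x1 - 3 * x1\<^sup>2 + 2 * f2 * x2 - 4 * x2\<^sup>2 - 4 * x1 * x2
       + 2 * f3 * x3 - 3 * x3\<^sup>2 - 4 * x2 * x3 + 2 * f4 * x4 - 2 * x4\<^sup>2 - 2 * x3 * x4
       - 2 * x1 * x3 - 2 * x4 * t) =
        (2 * x2 + x1 + x3 - f2 / 2)\<^sup>2 + (x1 - (2 * f1 - f2) / 2)\<^sup>2 + x1\<^sup>2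
        + (x3 - (2 * f3 - f2 - f4) / 2)\<^sup>2 + (2 * x4 - (f4 - x3 - t))\<^sup>2 / 2 + (x3 - t)\<^sup>2 / 2"
        by (simp add: power2_eq_square field_simps)
      also have "\<dots> \<ge> 0" by simp
      finally show ?thesis by simp
    qed
    then show ?case using 1 2 by (simp add: x1_def x3_def x4_def f4_def)
  next
    case (Suc m)
    let ?N = "4 + 2 * m"
    have IH: "(\<Sum>i=Suc 0..?N. dual_term B f d i) - 2 * d 1 * d 3 - 2 * d ?N * t
      \<le> (\<Sum>i=Suc 0..?N. term_bound B f i) - f ?N * t + t\<^sup>2" for t
      using Suc.IH by blast
    have "even ?N" "4 \<le> ?N" "0 \<le> ?N" by auto
    note * = dual_sum_two_step[OF this IH]
    have **: "?N + 2 = 4 + 2 * Suc m" by simp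
    show ?case using * unfolding ** by blast
  qed
  moreover obtain m where "N = 4 + 2 * m"
  proof -
    have "even (N - 4)" using assms by auto
    then obtain m where "N - 4 = 2 * m" by (elim evenE)
    then have "N = 4 + 2 * m" using assms by simp
    then show ?thesis using that by blast
  qed
  ultimately show ?thesis by (metis One_nat_def)
qed

text \<open>For even \<open>n\<close> nothing follows, so \<open>t = 0\<close>. For odd
  \<open>n\<close> in \<open>B\<close> the last gap is isolated and contributes at most
  \<open>(f n)\<^sup>2\<close> by itself.\<close>

lemma dual_tail:
  assumes B: "j \<in> B" "odd j" "5 \<le> j" and n: "j < n" "even n \<or> n \<in> B"
  shows "(\<Sum>i=Suc j..n. dual_term B f d i) \<le> (\<Sum>i=Suc j..n. term_bound B f i)"
proof (cases "even n")
  case True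
  then show ?thesis using dual_tail_even[of j B n f d 0] B n by simp
next
  case False
  then have N: "even (n - 1)" "j < n - 1" "n = Suc (n - 1)" "n \<in> B" using n B by presburger+
  have "dual_term B f d n = 2 * f n * d n - (d n)\<^sup>2"
    using N False n B by (auto simp: dual_term_def min_cut_def)
  also have "\<dots> \<le> term_bound B f n"
    using square_bound N False by (auto simp: term_bound_def)
  finally have 1: "dual_term B f d n \<le> term_bound B f n" .
  have "(\<Sum>i=Suc j..n-1. dual_term B f d i) \<le> (\<Sum>i=Suc j..n-1. term_bound B f i)"
    using dual_tail_even[of j B "n - 1" f d 0] B N by simp
  moreover have "sum g {Suc j..n} = sum g {Suc j..n-1} + g n" for g :: "nat \<Rightarrow> real"
    using N sum.cl_ivl_Suc[of g "Suc j" "n - 1"] by simp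
  ultimately show ?thesis using 1 by simp
qed

section \<open>Adding and shifting a bridge for decreasing weights\<close>

locale weights =
  fixes n :: nat and x f :: "nat \<Rightarrow> real"
  assumes n8: "8 \<le> n"
    and x_pos: "1 \<le> i \<Longrightarrow> i \<le> n \<Longrightarrow> 0 < x i"
    and x_anti: "1 \<le> i \<Longrightarrow> i \<le> k \<Longrightarrow> k \<le> n \<Longrightarrow> x k \<le> x i"
    and f_def: "f j = (\<Sum>i=1..j. x i)"
begin

lemma f_0 [simp]: "f 0 = 0" by (simp add: f_def)

lemma f_Suc: "f (Suc j) = f j + x (Suc j)" by (simp add: f_def)

lemma f_nonneg: "j \<le> n \<Longrightarrow> 0 \<le> f j"
  unfolding f_def by (auto intro!: sum_nonneg less_imp_le[OF x_pos])

lemma f_mono: "j \<le> k \<Longrightarrow> k \<le> n \<Longrightarrow> f j \<le> f k"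
proof (induction k rule: dec_induct)
  case (step k) then show ?case using x_pos[of "Suc k"] by (auto simp: f_Suc)
qed simp

lemma f_pos: "1 \<le> j \<Longrightarrow> j \<le> n \<Longrightarrow> 0 < f j"
  using f_mono[of 1 j] x_pos[of 1] by (simp add: f_def)

lemma bend_eq: "1 \<le> i \<Longrightarrow> bend f i = x i - x (Suc i)"
  using f_Suc[of "i - 1"] f_Suc[of i] by (simp add: bend_def)

text \<open>For decreasing \<open>x\<close> the second differences are nonnegative and at most
  \<open>x p\<close>, and they telescope to \<open>x p - x n\<close>.\<close>

lemma sum_bend_sq:
  assumes "1 \<le> p" "T \<subseteq> {p..<n}"
  shows "(\<Sum>i\<in>T. (bend f i)\<^sup>2) \<le> (x p)\<^sup>2"
proof (cases "p < n")
  case True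
  have nn: "0 \<le> bend f i" "bend f i \<le> x p" if "i \<in> {p..<n}" for i
    using that assms x_anti[of i "Suc i"] x_anti[of p i] x_pos[of "Suc i"] bend_eq[of i] by auto
  have "(\<Sum>i\<in>T. (bend f i)\<^sup>2) \<le> (\<Sum>i\<in>{p..<n}. (bend f i)\<^sup>2)"
    using assms by (intro sum_mono2) auto
  also have "\<dots> \<le> (\<Sum>i\<in>{p..<n}. x p * bend f i)"
    using nn by (intro sum_mono) (simp add: power2_eq_square mult_right_mono)
  also have "\<dots> = x p * (\<Sum>i\<in>{p..<n}. x i - x (Suc i))"
    using assms by (simp add: sum_distrib_left bend_eq)
  also have "(\<Sum>i\<in>{p..<n}. x i - x (Suc i)) = x p - x n"
    using sum_gap[of p n x] True by (simp add: gap_def)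
  also have "x p * (x p - x n) \<le> (x p)\<^sup>2"
    using x_pos[of p] x_pos[of n] True assms by (simp add: power2_eq_square algebra_simps)
  finally show ?thesis .
next
  case False then show ?thesis using assms by simp
qed

text \<open>A bridge at \<open>k\<close> removes both couplings of gap \<open>k\<close>, which cost
  a nonnegative amount because \<open>d\<close> is nonnegative, and lowers the coefficient of its
  square from 3 to 1. The isolated gap is then optimal at \<open>f k\<close>.\<close>

lemma dual_val_add:
  assumes "k \<notin> B" "odd k" "5 \<le> k" "k \<le> n" and d: "\<And>i. 0 \<le> d i"
  shows "dual_val n B f d < dual_val n (insert k B) f (d(k := f k))"
proof -
  define d' where "d' = d(k := f k)"
  have le: "dual_term B f d i \<le> dual_term (insert k B) f d' i" if i: "i \<in> {1..n}" for i
  proof -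
    have "3 * (d k)\<^sup>2 \<ge> 0" "d (k - 1) * d k \<ge> 0" "d k * d (Suc k) \<ge> 0" using d by simp_all
    consider "i = k" | "i = Suc k" | "i \<noteq> k" "i \<noteq> Suc k" by blast
    then show ?thesis
    proof cases
      case 1
      have "2 * f k * d k - 3 * (d k)\<^sup>2 - 2 * d (k - 1) * d k \<le> (f k)\<^sup>2"
        using square_bound[of "f k" "d k"] \<open>3 * (d k)\<^sup>2 \<ge> 0\<close> \<open>d (k - 1) * d k \<ge> 0\<close> by linarith
      then show ?thesis using 1 assms
        by (auto simp: dual_term_def min_cut_def d'_def power2_eq_square)
    next
      case 2
      then show ?thesis using assms d by (auto simp: dual_term_def min_cut_def d'_def)
    next
      case 3
      then have "i - 1 \<noteq> k" "i - Suc 0 \<noteq> k" using i by auto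
      then show ?thesis using 3 by (auto simp: dual_term_def min_cut_def d'_def)
    qed
  qed
  have "2 * f k * d k - 3 * (d k)\<^sup>2 - 2 * d (k - 1) * d k < (f k)\<^sup>2"
  proof -
    have "(f k)\<^sup>2 - (2 * f k * d k - 3 * (d k)\<^sup>2) = (f k - d k)\<^sup>2 + 2 * (d k)\<^sup>2"
      by (simp add: power2_eq_square algebra_simps)
    moreover have "0 < (f k - d k)\<^sup>2 + 2 * (d k)\<^sup>2"
      using f_pos[of k] assms by (cases "d k = 0") (auto simp: add_nonneg_pos)
    moreover have "0 \<le> 2 * d (k - 1) * d k" using d by simp
    ultimately show ?thesis by linarith
  qed
  then have "dual_term B f d k < dual_term (insert k B) f d' k"
    using assms by (auto simp: dual_term_def min_cut_def d'_def power2_eq_square)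
  then have "(\<Sum>i=1..n. dual_term B f d i) < (\<Sum>i=1..n. dual_term (insert k B) f d' i)"
    using le assms by (intro sum_strict_mono_ex1) auto
  moreover have "d' 1 = d 1" "d' 3 = d 3" using assms by (auto simp: d'_def)
  ultimately show ?thesis by (simp add: dual_val_def flip: d'_def)
qed

text \<open>The bridge at \<open>j\<close> separates the gaps below from those above. Below nothing
  changes; above, the old value is bounded by \<open>term_bound\<close> and the new gaps are given
  explicitly. The gain \<open>(f (j + 2))\<^sup>2 - (f j)\<^sup>2\<close> exceeds the loss, a
  quarter of the squared second differences, which is at most
  \<open>(x (j + 2))\<^sup>2 / 4\<close>.\<close>

lemma dual_val_move:
  assumes j: "j \<in> B" "j + 2 \<notin> B" "odd j" "5 \<le> j" "j + 2 \<le> n" and n: "even n \<or> n \<in> B"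
    and d: "\<And>i. 0 \<le> d i"
  shows "\<exists>d'. (\<forall>i. 0 \<le> d' i) \<and> dual_val n B f d < dual_val n (insert (j + 2) (B - {j})) f d'"
proof -
  define B1 where "B1 = insert (j + 2) (B - {j})"
  \<comment> \<open>Odd gaps outside \<open>B1\<close>, among them gap \<open>j\<close>, are set to
    0, which switches off every coupling above \<open>j\<close>. The remaining terms separate and
    are maximal at \<open>f i / 2\<close> for even \<open>i\<close> and at \<open>f i\<close> for
    bridges.\<close>
  define d' where "d' i = (if i < j then d i else if n < i then 0 else if odd i then (if i \<in> B1 then f i else 0)
     else f i / 2)" for i
  have nn: "0 \<le> d' i" for i using d f_nonneg by (auto simp: d'_def)
  define v where "v i = (if even i then (f i)\<^sup>2 / 2 else if i \<in> B1 then (f i)\<^sup>2 else 0)" for i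
  have split: "sum g {1..n} = sum g {1..<j} + g j + sum g {Suc j..n}" for g :: "nat \<Rightarrow> real"
    using sum.atLeastLessThan_concat[of 1 j "Suc n" g] sum.atLeast_Suc_atMost[of j n g] j
    by (simp add: atLeastLessThanSuc_atLeastAtMost)
  have low: "dual_term B1 f d' i = dual_term B f d i" if "i \<in> {1..<j}" for i
    using that by (auto simp: dual_term_def min_cut_def B1_def d'_def)
  have mid: "dual_term B f d j \<le> (f j)\<^sup>2" "dual_term B1 f d' j = 0"
  proof -
    have "dual_term B f d j = 2 * f j * d j - (d j)\<^sup>2"
      using j by (auto simp: dual_term_def min_cut_def)
    then show "dual_term B f d j \<le> (f j)\<^sup>2" using square_bound by simp
    show "dual_term B1 f d' j = 0"
      using j by (auto simp: dual_term_def min_cut_def B1_def d'_def)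
  qed
  have high: "dual_term B1 f d' i = v i" if "i \<in> {Suc j..n}" for i
  proof (cases "even i")
    case True
    have "(min_cut B1 (i - 1) + min_cut B1 i - 3) * d' (i - 1) = 0"
      using True that j by (auto simp: min_cut_def d'_def)
    then show ?thesis using True that j
      by (auto simp: dual_term_def d'_def v_def min_cut_def power2_eq_square)
  next
    case False
    then show ?thesis using that j
      by (auto simp: dual_term_def d'_def v_def min_cut_def power2_eq_square)
  qed
  define T where "T = {i \<in> {Suc j..n}. odd i \<and> i \<notin> B}"
  have T: "T \<subseteq> {j + 2..<n}"
  proof
    fix i assume "i \<in> T"
    then have "odd i" "i \<notin> B" "Suc j \<le> i" "i \<le> n" by (auto simp: T_def)
    \<comment> \<open>The second difference at \<open>n\<close> would involve
      \<open>x (n + 1)\<close>, beyond the range where \<open>x\<close> is known to be positive and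
      decreasing.\<close>
    moreover have "i \<noteq> n" using n \<open>odd i\<close> \<open>i \<notin> B\<close> by auto
    moreover have "i \<noteq> Suc j" using \<open>odd i\<close> j by auto
    ultimately show "i \<in> {j + 2..<n}" by auto
  qed
  have jT: "j + 2 \<in> T" using j by (auto simp: T_def)
  have fT: "finite T" by (simp add: T_def)
  have "(\<Sum>i=Suc j..n. term_bound B f i) - (\<Sum>i=Suc j..n. v i)
     = (\<Sum>i=Suc j..n. term_bound B f i - v i)" by (simp add: sum_subtractf)
  also have "\<dots> = (\<Sum>i=Suc j..n. if i \<in> T then (bend f i)\<^sup>2 / 4 - (if i = j + 2 then (f i)\<^sup>2 else 0) else 0)"
    using j by (intro sum.cong) (auto simp: term_bound_def v_def T_def B1_def)
  also have "\<dots> = (\<Sum>i\<in>{Suc j..n} \<inter> T. (bend f i)\<^sup>2 / 4 - (if i = j + 2 then (f i)\<^sup>2 else 0))"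
    by (rule sum.inter_restrict[symmetric]) simp
  also have "{Suc j..n} \<inter> T = T" by (auto simp: T_def)
  also have "(\<Sum>i\<in>T. (bend f i)\<^sup>2 / 4 - (if i = j + 2 then (f i)\<^sup>2 else 0))
      = (\<Sum>i\<in>T. (bend f i)\<^sup>2) / 4 - (f (j + 2))\<^sup>2"
    using fT jT by (simp add: sum_subtractf sum_divide_distrib sum.delta)
  also have "\<dots> \<le> (x (j + 2))\<^sup>2 / 4 - (f (j + 2))\<^sup>2"
    using sum_bend_sq[OF _ T] by simp
  finally have tail: "(\<Sum>i=Suc j..n. term_bound B f i) - (\<Sum>i=Suc j..n. v i) \<le> (x (j + 2))\<^sup>2 / 4 - (f (j + 2))\<^sup>2" .
  have gain: "(x (j + 2))\<^sup>2 / 4 + (f j)\<^sup>2 < (f (j + 2))\<^sup>2"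
  proof -
    have 1: "f (j + 2) = f j + (x (j + 1) + x (j + 2))" by (simp add: f_Suc)
    have 2: "0 < x (j + 1)" "0 < x (j + 2)" "0 \<le> f j"
      using x_pos[of "j + 1"] x_pos[of "j + 2"] f_nonneg j by auto
    have "(f j)\<^sup>2 + (x (j + 1) + x (j + 2))\<^sup>2 \<le> (f (j + 2))\<^sup>2" using 1 2 by (simp add: power2_sum)
    moreover have "(x (j + 2))\<^sup>2 < (x (j + 1) + x (j + 2))\<^sup>2" using 2 by (intro power_strict_mono) auto
    moreover have "0 \<le> (x (j + 2))\<^sup>2" by simp
    ultimately show ?thesis by linarith
  qed
  have "(\<Sum>i=1..n. dual_term B f d i) \<le> (\<Sum>i\<in>{1..<j}. dual_term B f d i) + (f j)\<^sup>2 + (\<Sum>i=Suc j..n. term_bound B f i)"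
    using split[of "dual_term B f d"] mid(1) dual_tail[of j B n f d] j n by linarith
  moreover have "(\<Sum>i=1..n. dual_term B1 f d' i) = (\<Sum>i\<in>{1..<j}. dual_term B f d i) + (\<Sum>i=Suc j..n. v i)"
    using split[of "dual_term B1 f d'"] mid(2) by (simp add: low high)
  ultimately have "(\<Sum>i=1..n. dual_term B f d i) < (\<Sum>i=1..n. dual_term B1 f d' i)"
    using tail gain by linarith
  moreover have "d' 1 = d 1" "d' 3 = d 3" using j by (auto simp: d'_def)
  ultimately have "dual_val n B f d < dual_val n B1 f d'" by (simp add: dual_val_def)
  then show ?thesis using nn unfolding B1_def by blast
qed

end

section \<open>The optimal set of bridges\<close>

text \<open>The positions congruent to \<open>n\<close> modulo 4 if \<open>n\<close> is odd, and to
  \<open>n - 1\<close> if \<open>n\<close> is even; the oddness of \<open>k\<close> selects the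
  right alternative.\<close>

definition best_bridges :: "nat \<Rightarrow> nat set" where
  "best_bridges n = {k. 5 \<le> k \<and> odd k \<and> (\<exists>m. n = k + 4 * m \<or> n = k + 4 * m + 1)}"

definition separated :: "nat \<Rightarrow> nat set \<Rightarrow> bool" where
  "separated n B \<longleftrightarrow> (\<forall>j\<in>B. 5 \<le> j \<and> j \<le> n \<and> odd j \<and> j + 2 \<notin> B)"

lemma best_bridges_le: "k \<in> best_bridges n \<Longrightarrow> k \<le> n" by (auto simp: best_bridges_def)

lemma finite_opt: "finite (best_bridges n)"
  by (rule finite_subset[of _ "{..n}"]) (auto dest: best_bridges_le)

lemma best_bridges_odd: "k \<in> best_bridges n \<Longrightarrow> odd k" by (simp add: best_bridges_def)

lemma best_bridges_shift_notin:
  assumes "k \<in> best_bridges n"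
  shows "k + 2 \<notin> best_bridges n"
proof
  assume "k + 2 \<in> best_bridges n"
  then obtain m where m: "n = k + 2 + 4 * m \<or> n = k + 2 + 4 * m + 1" by (auto simp: best_bridges_def)
  obtain m' where m': "n = k + 4 * m' \<or> n = k + 4 * m' + 1" using assms by (auto simp: best_bridges_def)
  show False using m m' by presburger
qed

lemma best_bridges_shift_mem:
  assumes "odd b" "5 \<le> b" "b \<le> n" "b \<notin> best_bridges n"
  shows "b + 2 \<in> best_bridges n"
proof -
  define m where "m = (n - b) div 4"
  have "n = b + 4 * m \<or> n = b + 4 * m + 1 \<or> n = b + 4 * m + 2 \<or> n = b + 4 * m + 3"
    using assms(3) unfolding m_def by presburger
  moreover have "\<not> (n = b + 4 * m \<or> n = b + 4 * m + 1)" using assms by (auto simp: best_bridges_def)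
  ultimately have "n = b + 2 + 4 * m \<or> n = b + 2 + 4 * m + 1" by arith
  then show ?thesis using assms by (auto simp: best_bridges_def)
qed

lemma best_bridges_next:
  assumes "k \<in> best_bridges n" "k + 2 \<le> n"
  shows "k + 4 \<in> best_bridges n"
proof -
  obtain m where m: "n = k + 4 * m \<or> n = k + 4 * m + 1" using assms by (auto simp: best_bridges_def)
  then obtain m' where "m = Suc m'" using assms by (cases m) auto
  then have "n = (k + 4) + 4 * m' \<or> n = (k + 4) + 4 * m' + 1" using m by arith
  then show ?thesis using assms by (auto simp: best_bridges_def)
qed

lemma best_bridges_add_4: "odd N \<Longrightarrow> best_bridges (N + 4) = insert (N + 4) (best_bridges N)"
proof -
  assume N: "odd N"
  have "k \<in> best_bridges (N + 4) \<longleftrightarrow> k = N + 4 \<or> k \<in> best_bridges N" for k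
  proof
    assume k: "k \<in> best_bridges (N + 4)"
    then obtain m where "N + 4 = k + 4 * m \<or> N + 4 = k + 4 * m + 1" by (auto simp: best_bridges_def)
    then have m: "N + 4 = k + 4 * m" using N best_bridges_odd[OF k] by presburger
    then show "k = N + 4 \<or> k \<in> best_bridges N" using k by (cases m) (auto simp: best_bridges_def)
  next
    assume "k = N + 4 \<or> k \<in> best_bridges N"
    then show "k \<in> best_bridges (N + 4)"
    proof
      assume "k = N + 4"
      then have "5 \<le> k" "odd k" "N + 4 = k + 4 * 0" using N by presburger+
      then show ?thesis unfolding best_bridges_def by blast
    next
      assume k: "k \<in> best_bridges N"
      then obtain m where "N = k + 4 * m \<or> N = k + 4 * m + 1" by (auto simp: best_bridges_def)
      then have "N + 4 = k + 4 * Suc m \<or> N + 4 = k + 4 * Suc m + 1" by simp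
      then show ?thesis using k unfolding best_bridges_def by blast
    qed
  qed
  then show ?thesis by blast
qed

context weights
begin

text \<open>Take the largest best position \<open>k\<close> missing from \<open>B\<close>. Then
  \<open>k + 2\<close> is not in \<open>B\<close>, as it would be too close to \<open>k + 4\<close>,
  which is best and hence present. So \<open>k\<close> can be filled: by shifting the bridge at
  \<open>k - 2\<close> if there is one, otherwise by adding \<open>k\<close>. As
  \<open>k - 2\<close> is not a best position, fewer best positions are missing afterwards.\<close>

lemma dual_val_step:
  assumes B: "separated n B" "B \<noteq> best_bridges n" and n: "even n \<or> n \<in> B" and d: "\<And>i. 0 \<le> d i"
  shows "\<exists>B1 d1. separated n B1 \<and> (even n \<or> n \<in> B1) \<and> (\<forall>i. 0 \<le> d1 i) \<and>
    dual_val n B f d < dual_val n B1 f d1 \<and> card (best_bridges n - B1) < card (best_bridges n - B)"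
proof -
  have "best_bridges n - B \<noteq> {}"
  proof
    assume sub: "best_bridges n - B = {}"
    have "b \<in> best_bridges n" if "b \<in> B" for b
    proof (rule ccontr)
      assume "b \<notin> best_bridges n"
      with that B(1) have "b + 2 \<in> best_bridges n" by (intro best_bridges_shift_mem) (auto simp: separated_def)
      then show False using sub that B(1) by (auto simp: separated_def)
    qed
    then show False using sub B(2) by blast
  qed
  define k where "k = Max (best_bridges n - B)"
  have fin: "finite (best_bridges n - B)" using finite_opt by blast
  have k: "k \<in> best_bridges n" "k \<notin> B" and kmax: "\<And>i. i \<in> best_bridges n \<Longrightarrow> i \<notin> B \<Longrightarrow> i \<le> k"
    using Max_in[OF fin \<open>best_bridges n - B \<noteq> {}\<close>] Max_ge[OF fin] by (auto simp: k_def)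
  have k': "5 \<le> k" "k \<le> n" "odd k" using k best_bridges_odd[of k n] best_bridges_le[of k n] by (auto simp: best_bridges_def)
  have k2: "k + 2 \<notin> B"
  proof
    assume a: "k + 2 \<in> B"
    then have "k + 2 \<le> n" using B(1) by (auto simp: separated_def)
    then have "k + 4 \<in> best_bridges n" using best_bridges_next k by blast
    then have "k + 4 \<in> B" using kmax[of "k + 4"] by force
    then show False using a B(1) by (auto simp: separated_def numeral_eq_Suc)
  qed
  show ?thesis
  proof (cases "k - 2 \<in> B")
    case False
    define B1 where "B1 = insert k B"
    have "separated n B1"
      unfolding separated_def
    proof
      fix j assume j: "j \<in> B1"
      have jk: "j + 2 \<noteq> k" if "j \<in> B" using that False by (metis add_diff_cancel_right')
      from j consider "j = k" | "j \<in> B" by (auto simp: B1_def)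
      then show "5 \<le> j \<and> j \<le> n \<and> odd j \<and> j + 2 \<notin> B1"
      proof cases
        case 1 then show ?thesis using k' k2 by (simp add: B1_def)
      next
        case 2 then show ?thesis using B(1) jk by (simp add: B1_def separated_def)
      qed
    qed
    moreover have "dual_val n B f d < dual_val n B1 f (d(k := f k))"
      unfolding B1_def using k k' d by (intro dual_val_add) auto
    moreover have "\<forall>i. 0 \<le> (d(k := f k)) i" using d f_nonneg k' by auto
    moreover have "card (best_bridges n - B1) < card (best_bridges n - B)"
      using fin k by (intro psubset_card_mono) (auto simp: B1_def)
    ultimately show ?thesis using n unfolding B1_def by blast
  next
    case True
    define j where "j = k - 2"
    have jk: "k = j + 2" using k' by (simp add: j_def)
    have j: "j \<in> B" using True by (simp add: j_def)
    define B1 where "B1 = insert (j + 2) (B - {j})"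
    have nj: "n \<noteq> j" using k' jk by auto
    have "separated n B1"
      unfolding separated_def
    proof
      fix i assume i: "i \<in> B1"
      from i consider "i = k" | "i \<in> B" "i \<noteq> j" by (auto simp: B1_def jk)
      then show "5 \<le> i \<and> i \<le> n \<and> odd i \<and> i + 2 \<notin> B1"
      proof cases
        case 1 then show ?thesis using k' k2 by (simp add: B1_def jk)
      next
        case 2 then show ?thesis using B(1) by (simp add: B1_def separated_def)
      qed
    qed
    moreover have "\<exists>d'. (\<forall>i. 0 \<le> d' i) \<and> dual_val n B f d < dual_val n B1 f d'"
      unfolding B1_def using j k k' jk n d B(1) by (intro dual_val_move) (auto simp: separated_def)
    moreover have "card (best_bridges n - B1) < card (best_bridges n - B)"
    proof (rule psubset_card_mono[OF fin])
      have "j \<notin> best_bridges n" using k(1) jk best_bridges_shift_notin by blast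
      then show "best_bridges n - B1 \<subset> best_bridges n - B" using k jk by (auto simp: B1_def)
    qed
    moreover have "even n \<or> n \<in> B1" using n nj by (auto simp: B1_def)
    ultimately show ?thesis by blast
  qed
qed

lemma dual_val_opt:
  assumes "separated n B" "B \<noteq> best_bridges n" "even n \<or> n \<in> B" "\<And>i. 0 \<le> d i"
  shows "\<exists>d'. dual_val n B f d < dual_val n (best_bridges n) f d'"
  using assms
proof (induction "card (best_bridges n - B)" arbitrary: B d rule: less_induct)
  case less
  obtain B1 d1 where "separated n B1 \<and> (even n \<or> n \<in> B1) \<and> (\<forall>i. 0 \<le> d1 i) \<and>
      dual_val n B f d < dual_val n B1 f d1 \<and> card (best_bridges n - B1) < card (best_bridges n - B)"
    using dual_val_step[OF less.prems(1-3), of d] less.prems(4) by auto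
  then have 1: "separated n B1" "even n \<or> n \<in> B1" "\<And>i. 0 \<le> d1 i"
    "dual_val n B f d < dual_val n B1 f d1" "card (best_bridges n - B1) < card (best_bridges n - B)"
    by auto
  show ?case
  proof (cases "B1 = best_bridges n")
    case True
    then show ?thesis using 1 by blast
  next
    case False
    from less.hyps[OF 1(5) 1(1) False 1(2,3)] 1(4) show ?thesis by (meson less_trans)
  qed
qed

section \<open>The case of odd n without a bridge at n\<close>

lemma f_ge_mult: "1 \<le> j \<Longrightarrow> j \<le> n \<Longrightarrow> real j * x j \<le> f j"
proof -
  assume j: "1 \<le> j" "j \<le> n"
  have "(\<Sum>i=1..j. x j) \<le> (\<Sum>i=1..j. x i)" using j x_anti by (intro sum_mono) auto
  then show ?thesis by (simp add: f_def)
qed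

text \<open>Let \<open>u\<close> and \<open>v\<close> be the increments of \<open>f\<close> before
  and after \<open>N\<close>. Monotonicity of \<open>x\<close> gives \<open>v \<le> u\<close>, and
  \<open>f (N - 2) \<ge> 3 * x (N - 2)\<close> gives \<open>2 * f N \<ge> 5 * u\<close>. The latter
  is exactly what the ratio 3 : 2 requires in the worst case \<open>v = u\<close>.\<close>

lemma f_square_increment:
  assumes "5 \<le> N" "N + 2 \<le> n"
  shows "2 * ((f (N + 2))\<^sup>2 - (f N)\<^sup>2) \<le> 3 * ((f N)\<^sup>2 - (f (N - 2))\<^sup>2)"
proof -
  define u v F where "u = x (N - 1) + x N" and "v = x (N + 1) + x (N + 2)" and "F = f N"
  have N: "N = Suc (Suc (N - 2))" "N - 1 = Suc (N - 2)" using assms by auto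
  have "f N = f (N - 2) + x (N - 1) + x N"
    using f_Suc[of "N - 2"] f_Suc[of "N - 1"] N by simp
  then have 1: "f (N - 2) = F - u" by (simp add: u_def F_def)
  have 2: "f (N + 2) = F + v" by (simp add: v_def F_def f_Suc)
  have uv: "0 \<le> v" "v \<le> u" "0 \<le> u"
    using x_pos[of "N - 1"] x_pos[of N] x_pos[of "N + 1"] x_pos[of "N + 2"]
      x_anti[of "N - 1" "N + 1"] x_anti[of N "N + 2"] assms
    unfolding u_def v_def by linarith+
  have "real (N - 2) * x (N - 2) \<le> f (N - 2)" using assms by (intro f_ge_mult) auto
  moreover have "3 * x (N - 2) \<le> real (N - 2) * x (N - 2)"
    using assms by (intro mult_right_mono less_imp_le[OF x_pos]) auto
  moreover have "x (N - 1) \<le> x (N - 2)" "x N \<le> x (N - 2)"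
    using assms by (auto intro!: x_anti)
  ultimately have F: "2 * F \<ge> 5 * u" using 1 by (simp add: u_def)
  have "2 * (v * (2 * F + v)) \<le> 2 * (u * (2 * F + u))"
    using uv F by (intro mult_left_mono mult_mono) auto
  also have "\<dots> \<le> 3 * (u * (2 * F - u))"
    using mult_left_mono[OF F uv(3)] by (simp add: algebra_simps)
  finally show ?thesis unfolding 1 2 F_def[symmetric] by (simp add: power2_eq_square algebra_simps)
qed

text \<open>The weights 2, 3 and 5 are chosen so that the induction step from \<open>M\<close> to
  \<open>M + 4\<close> becomes \<open>f_square_increment\<close> at \<open>M\<close>: the best set
  acquires \<open>M + 4\<close>, while \<open>B\<close> acquires at most one of \<open>M\<close> and
  \<open>M + 2\<close>. The term with \<open>f 5\<close> stems from the start at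
  \<open>N = 7\<close>, where the best set is \<open>{7}\<close> and \<open>B\<close> may be
  \<open>{5}\<close>.\<close>

lemma sum_sq_opt_gain:
  assumes "odd N" "5 \<le> N" "N \<le> n" and B: "separated (N - 2) B"
  shows "2 * ((f N)\<^sup>2 - (if N mod 4 = 3 then (f 5)\<^sup>2 else 0)) + 3 * ((f N)\<^sup>2 - (f (N - 2))\<^sup>2)
    \<le> 5 * ((\<Sum>i\<in>best_bridges N. (f i)\<^sup>2) - (\<Sum>i\<in>B. (f i)\<^sup>2))"
  using assms
proof (induction N arbitrary: B rule: less_induct)
  case (less N)
  have finB: "finite B" using less.prems(4) by (intro finite_subset[of B "{..N}"]) (auto simp: separated_def)
  consider "N = 5" | "N = 7" | M where "N = M + 4" "odd M" "5 \<le> M"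
  proof -
    have "N = 5 \<or> N = 7 \<or> (\<exists>M. N = M + 4 \<and> odd M \<and> 5 \<le> M)"
      using less.prems(1,2) by presburger
    then show ?thesis using that by blast
  qed
  then show ?case
  proof cases
    case 1
    have "best_bridges N = {5}" using 1 by (auto simp: best_bridges_def)
    moreover have "B = {}" using less.prems(4) 1 by (force simp: separated_def)
    moreover have "2 * (f 5)\<^sup>2 + 3 * ((f 5)\<^sup>2 - (f 3)\<^sup>2) \<le> 5 * (f 5)\<^sup>2" by simp
    ultimately show ?thesis using 1 by simp
  next
    case 2
    have "k = 7" if k: "k \<in> best_bridges 7" for k
    proof -
      obtain m where "7 = k + 4 * m \<or> 7 = k + 4 * m + 1" "5 \<le> k" "odd k"
        using k by (auto simp: best_bridges_def)
      then show ?thesis by presburger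
    qed
    moreover have "7 \<in> best_bridges 7" by (auto simp: best_bridges_def)
    ultimately have "best_bridges N = {7}" using 2 by blast
    moreover have "B \<subseteq> {5}" using less.prems(4) 2 by (force simp: separated_def)
    then have "(\<Sum>i\<in>B. (f i)\<^sup>2) \<le> (\<Sum>i\<in>{5}. (f i)\<^sup>2)" by (intro sum_mono2) auto
    ultimately show ?thesis using 2 by simp
  next
    case 3
    define B' where "B' = B \<inter> {..M - 2}"
    have sep: "separated (M - 2) B'" using less.prems(4) by (auto simp: separated_def B'_def)
    have IH: "2 * ((f M)\<^sup>2 - (if M mod 4 = 3 then (f 5)\<^sup>2 else 0)) + 3 * ((f M)\<^sup>2 - (f (M - 2))\<^sup>2)
      \<le> 5 * ((\<Sum>i\<in>best_bridges M. (f i)\<^sup>2) - (\<Sum>i\<in>B'. (f i)\<^sup>2))"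
      using 3 less.prems(3) sep by (intro less.IH) auto
    have sub: "B - B' \<subseteq> {M, M + 2}"
    proof
      fix i assume i: "i \<in> B - B'"
      then have "odd i" "M - 2 < i" "i \<le> M + 2"
        using less.prems(4) 3 by (auto simp: separated_def B'_def)
      then have "i = M \<or> i = M + 2" using 3 by presburger
      then show "i \<in> {M, M + 2}" by simp
    qed
    moreover have "\<not> (M \<in> B \<and> M + 2 \<in> B)" using less.prems(4) by (auto simp: separated_def)
    ultimately have "B - B' \<subseteq> {M} \<or> B - B' \<subseteq> {M + 2}" by blast
    moreover have mono: "(f M)\<^sup>2 \<le> (f (M + 2))\<^sup>2"
      using 3 less.prems f_mono[of M "M + 2"] f_nonneg[of M] by (intro power_mono) auto
    ultimately have "(\<Sum>i\<in>B - B'. (f i)\<^sup>2) \<le> (f (M + 2))\<^sup>2"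
    proof (elim disjE)
      assume "B - B' \<subseteq> {M}"
      then have "(\<Sum>i\<in>B - B'. (f i)\<^sup>2) \<le> (\<Sum>i\<in>{M}. (f i)\<^sup>2)" by (intro sum_mono2) auto
      then show ?thesis using mono by simp
    next
      assume "B - B' \<subseteq> {M + 2}"
      then have "(\<Sum>i\<in>B - B'. (f i)\<^sup>2) \<le> (\<Sum>i\<in>{M + 2}. (f i)\<^sup>2)" by (intro sum_mono2) auto
      then show ?thesis by simp
    qed
    moreover have "(\<Sum>i\<in>B. (f i)\<^sup>2) = (\<Sum>i\<in>B'. (f i)\<^sup>2) + (\<Sum>i\<in>B - B'. (f i)\<^sup>2)"
      using finB by (subst sum.subset_diff[of B' B]) (auto simp: B'_def)
    moreover have "(\<Sum>i\<in>best_bridges N. (f i)\<^sup>2) = (f (M + 4))\<^sup>2 + (\<Sum>i\<in>best_bridges M. (f i)\<^sup>2)"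
      unfolding 3(1) best_bridges_add_4[OF 3(2)] using finite_opt best_bridges_le[of "M + 4" M] by (subst sum.insert) auto
    moreover have "2 * ((f (M + 2))\<^sup>2 - (f M)\<^sup>2) \<le> 3 * ((f M)\<^sup>2 - (f (M - 2))\<^sup>2)"
      using 3 less.prems by (intro f_square_increment) auto
    moreover have "N mod 4 = M mod 4" "N - 2 = M + 2" using 3 by auto
    ultimately show ?thesis using IH 3(1) by (auto split: if_splits)
  qed
qed

text \<open>
  The remaining case: \<open>n\<close> is odd and at least three edges leave position \<open>n\<close>. A single shift of a
  bridge from \<open>n - 2\<close> to \<open>n\<close> can be a loss here, but shifting all the bridges at once is a gain.
\<close>

lemma dual_val_opt_odd:
  assumes B: "separated n B" "odd n" "n \<notin> B"
    and head: "4 * x 1 \<le> 3 * f n"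
    and conc: "n mod 4 = 3 \<Longrightarrow> 20 * (f 5)\<^sup>2 \<le> 11 * (f n)\<^sup>2 \<and> 5 * x 1 \<le> f n"
  shows "\<exists>d'. dual_val n B f d < dual_val n (best_bridges n) f d'"
proof -
  define N where "N = n - 1"
  have n: "n = Suc N" "even N" "4 \<le> N" using n8 B(2) by (auto simp: N_def)
  have B13: "1 \<notin> B" "3 \<notin> B" using B(1) by (auto simp: separated_def)
  have sep: "separated (n - 2) B"
    unfolding separated_def
  proof
    fix j assume j: "j \<in> B"
    then have "5 \<le> j" "j \<le> n" "odd j" "j + 2 \<notin> B" "j \<noteq> n" using B by (auto simp: separated_def)
    then show "5 \<le> j \<and> j \<le> n - 2 \<and> odd j \<and> j + 2 \<notin> B" using B(2) by presburger
  qed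
  define v where "v i = (if i = 2 then (f i)\<^sup>2 / 4 else if even i then (f i)\<^sup>2 / 2 else 0)" for i
  have finB: "finite B" using B(1) by (intro finite_subset[of B "{..n}"]) (auto simp: separated_def)
  have upper: "dual_val n B f d \<le> (\<Sum>i=1..n. v i) + (\<Sum>i\<in>B. (f i)\<^sup>2) + (x 1)\<^sup>2 / 4 + (f n + x n)\<^sup>2 / 8"
  proof -
    define y where "y = d n"
    have "dual_term B f d n = 2 * f n * y - 3 * y\<^sup>2 - 2 * d N * y"
      using n B by (auto simp: dual_term_def min_cut_def y_def)
    then have "dual_val n B f d = ((\<Sum>i=1..N. dual_term B f d i) - 2 * d 1 * d 3 - 2 * d N * y) + 2 * f n * y - 3 * y\<^sup>2"
      unfolding dual_val_def using n(1) by simp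
    \<comment> \<open>The head estimate stops at the even position \<open>n - 1\<close>, with the
      last gap \<open>y\<close> in the role of \<open>t\<close>. It returns one
      \<open>y\<^sup>2\<close>, so the square of \<open>y\<close> keeps the coefficient 3 -
      1.\<close>
    also have "\<dots> \<le> (\<Sum>i=1..N. term_bound B f i) + (- f N * y + y\<^sup>2 + 2 * f n * y - 3 * y\<^sup>2)"
      using dual_head[where f = f and N = N and t = y and d = d, OF B13 n(2,3) f_0] by simp
    also have "- f N * y + y\<^sup>2 + 2 * f n * y - 3 * y\<^sup>2 \<le> (2 * f n - f N)\<^sup>2 / 8"
      using zero_le_power2[of "4 * y - (2 * f n - f N)"] by (simp add: power2_eq_square field_simps)
    also have "2 * f n - f N = f n + x n" using n f_Suc[of N] by simp
    finally have 1: "dual_val n B f d \<le> (\<Sum>i=1..N. term_bound B f i) + (f n + x n)\<^sup>2 / 8" by simp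
    define T where "T = {i\<in>{1..N}. odd i \<and> i \<notin> B}"
    have "term_bound B f i = v i + (if i \<in> B then (f i)\<^sup>2 else 0) + (if i \<in> T then (bend f i)\<^sup>2 / 4 else 0)"
      if "i \<in> {1..N}" for i
      using that B(1) by (auto simp: term_bound_def v_def T_def separated_def)
    then have "(\<Sum>i=1..N. term_bound B f i) = (\<Sum>i=1..N. v i) + (\<Sum>i=1..N. if i \<in> B then (f i)\<^sup>2 else 0)
       + (\<Sum>i=1..N. if i \<in> T then (bend f i)\<^sup>2 / 4 else 0)"
      by (simp add: sum.distrib)
    also have "(\<Sum>i=1..N. if i \<in> B then (f i)\<^sup>2 else 0) = (\<Sum>i\<in>B. (f i)\<^sup>2)"
    proof -
      have "{1..N} \<inter> B = B" using sep n by (force simp: separated_def)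
      then show ?thesis by (simp flip: sum.inter_restrict)
    qed
    also have "(\<Sum>i=1..N. if i \<in> T then (bend f i)\<^sup>2 / 4 else 0) = (\<Sum>i\<in>T. (bend f i)\<^sup>2) / 4"
    proof -
      have "{1..N} \<inter> T = T" by (auto simp: T_def)
      then show ?thesis by (simp add: sum_divide_distrib flip: sum.inter_restrict)
    qed
    also have "(\<Sum>i\<in>T. (bend f i)\<^sup>2) \<le> (x 1)\<^sup>2"
      using n by (intro sum_bend_sq) (auto simp: T_def)
    also have "(\<Sum>i=1..N. v i) = (\<Sum>i=1..n. v i)" using n by (simp add: v_def)
    finally show ?thesis using 1 by simp
  qed
  \<comment> \<open>Odd gaps outside the best set are 0, so all couplings vanish. The divisor 4 at
    position 2 reflects the minimal cut 4 there.\<close>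
  define d' where "d' i = (if n < i then 0 else if i = 2 then f i / 4 else if even i then f i / 2 else if i \<in> best_bridges n then f i else 0)" for i
  have opt13: "1 \<notin> best_bridges n" "3 \<notin> best_bridges n" by (auto simp: best_bridges_def)
  have best_bridges: "odd i" if "i \<in> best_bridges n" for i using best_bridges_odd that by simp
  have terms: "dual_term (best_bridges n) f d' i = v i + (if i \<in> best_bridges n then (f i)\<^sup>2 else 0)" if "i \<in> {1..n}" for i
  proof (cases "even i")
    case True
    have c0: "(min_cut (best_bridges n) (i - 1) + min_cut (best_bridges n) i - 3) * d' (i - 1) = 0"
      using True that opt13 by (auto simp: min_cut_def d'_def)
    have "i \<notin> best_bridges n" using True best_bridges by blast
    moreover have "i \<noteq> 0" "\<not> n < i" using that by auto
    ultimately show ?thesis unfolding dual_term_def c0 using True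
      by (cases "i = 2") (simp_all add: d'_def v_def min_cut_def power2_eq_square)
  next
    case False
    have i0: "min_cut (best_bridges n) (i - 1) = 2"
      if i: "i \<in> best_bridges n"
    proof -
      have "5 \<le> i" using i by (simp add: best_bridges_def)
      then have "even (i - 1)" "i - 1 \<noteq> 0" "i - 1 \<noteq> 2" "i \<noteq> 0" "i \<noteq> 2" using False by auto
      then show ?thesis unfolding min_cut_def by metis
    qed
    show ?thesis
    proof (cases "i \<in> best_bridges n")
      case True
      then have "d' i = f i" "min_cut (best_bridges n) i = 1" using \<open>odd i\<close> \<open>i \<in> {1..n}\<close>
        by (auto simp: d'_def min_cut_def)
      moreover have "v i = 0" using \<open>odd i\<close> by (auto simp: v_def)
      ultimately show ?thesis using True i0[OF True] by (simp add: dual_term_def power2_eq_square)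
    next
      case False
      then have "d' i = 0" "v i = 0" using \<open>odd i\<close> by (auto simp: d'_def v_def)
      then show ?thesis using False by (simp add: dual_term_def)
    qed
  qed
  have "dual_val n (best_bridges n) f d' = (\<Sum>i=1..n. v i + (if i \<in> best_bridges n then (f i)\<^sup>2 else 0))"
    unfolding dual_val_def using opt13 by (simp add: terms d'_def)
  also have "\<dots> = (\<Sum>i=1..n. v i) + (\<Sum>i\<in>{1..n} \<inter> best_bridges n. (f i)\<^sup>2)"
    by (simp add: sum.distrib sum.inter_restrict)
  also have "{1..n} \<inter> best_bridges n = best_bridges n" using best_bridges_le by (auto simp: best_bridges_def)
  finally have lower: "dual_val n (best_bridges n) f d' = (\<Sum>i=1..n. v i) + (\<Sum>i\<in>best_bridges n. (f i)\<^sup>2)" .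
  have "(f (n - 2))\<^sup>2 \<le> (f n)\<^sup>2" using f_mono[of "n - 2" n] f_nonneg by (intro power_mono) auto
  then have gain: "2 * ((f n)\<^sup>2 - (if n mod 4 = 3 then (f 5)\<^sup>2 else 0)) \<le> 5 * ((\<Sum>i\<in>best_bridges n. (f i)\<^sup>2) - (\<Sum>i\<in>B. (f i)\<^sup>2))"
  proof -
    have "5 \<le> n" "n \<le> n" using n8 by auto
    from sum_sq_opt_gain[OF B(2) this sep] \<open>(f (n - 2))\<^sup>2 \<le> (f n)\<^sup>2\<close> show ?thesis by argo
  qed
  have fp: "0 < f n" and xp: "0 < x 1" "0 < x n" using f_pos x_pos n8 by auto
  have xn: "real n * x n \<le> f n" using n8 by (intro f_ge_mult) auto
  \<comment> \<open>In units of \<open>(f n)\<^sup>2\<close>: for \<open>n mod 4 = 3\<close> the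
    left side is at most about 0.79, from the factor 12/11 for \<open>f n + x n\<close> and 1/5 for
    \<open>x 1\<close>, against at least 0.9. Otherwise it is at most about 1.48, from 10/9 and 3/4,
    against 2.\<close>
  have loss: "5 * ((x 1)\<^sup>2 / 4 + (f n + x n)\<^sup>2 / 8) < 2 * ((f n)\<^sup>2 - (if n mod 4 = 3 then (f 5)\<^sup>2 else 0))"
  proof (cases "n mod 4 = 3")
    case True
    have "11 \<le> n" using True n8 by presburger
    then have "11 * x n \<le> real n * x n" using xp by (intro mult_right_mono) auto
    then have "f n + x n \<le> 12 / 11 * f n" using xn by simp
    then have "11 * (f n + x n) \<le> 12 * f n" by simp
    then have "(11 * (f n + x n))\<^sup>2 \<le> (12 * f n)\<^sup>2" using fp xp by (intro power_mono) auto
    then have 1: "121 * (f n + x n)\<^sup>2 \<le> 144 * (f n)\<^sup>2" unfolding power_mult_distrib by simp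
    have "(5 * x 1)\<^sup>2 \<le> (f n)\<^sup>2" using conc[OF True] xp by (intro power_mono) auto
    then have 2: "25 * (x 1)\<^sup>2 \<le> (f n)\<^sup>2" unfolding power_mult_distrib by simp
    have "0 < (f n)\<^sup>2" using fp by simp
    then show ?thesis using conc[OF True] True 1 2 by argo
  next
    case False
    have "9 \<le> n" using B(2) n8 by presburger
    then have "9 * x n \<le> real n * x n" using xp by (intro mult_right_mono) auto
    then have "f n + x n \<le> 10 / 9 * f n" using xn by simp
    then have "9 * (f n + x n) \<le> 10 * f n" by simp
    then have "(9 * (f n + x n))\<^sup>2 \<le> (10 * f n)\<^sup>2" using fp xp by (intro power_mono) auto
    then have 1: "81 * (f n + x n)\<^sup>2 \<le> 100 * (f n)\<^sup>2" unfolding power_mult_distrib by simp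
    have "(4 * x 1)\<^sup>2 \<le> (3 * f n)\<^sup>2" using head xp by (intro power_mono) auto
    then have 2: "16 * (x 1)\<^sup>2 \<le> 9 * (f n)\<^sup>2" unfolding power_mult_distrib by simp
    have "0 < (f n)\<^sup>2" using fp by simp
    then show ?thesis using False 1 2 by argo
  qed
  have "dual_val n B f d < dual_val n (best_bridges n) f d'"
    using upper gain loss lower by argo
  then show ?thesis by blast
qed

end

section \<open>The graph \<open>H\<^sub>n\<close> as an ordered network\<close>

text \<open>
  The vertices of \<open>H\<^sub>n\<close> are numbered from the head, which occupies \<open>{1..c}\<close>, to the end;
  \<open>hadj c i k\<close> says that \<open>i\<close> is a neighbour of \<open>k\<close> with smaller number.
\<close>

definition hadj :: "nat \<Rightarrow> nat \<Rightarrow> nat \<Rightarrow> bool" where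
  "hadj c i k \<longleftrightarrow>
    (if k \<le> 4 then k = 2 \<and> i = 1 \<or> (k = 3 \<or> k = 4) \<and> (i = 1 \<or> i = 2)
     else if k \<le> c then
       (if c = 5 then i = 3 \<or> i = 4 else k = 5 \<and> i = 3 \<or> k = 6 \<and> (i = 4 \<or> i = 5) \<or> k = 7 \<and> (i = 5 \<or> i = 6))
     else i + 1 = k \<or> ((k - c) mod 4 = 0 \<or> (k - c) mod 4 = 3) \<and> i + 2 = k)"

lemma hadj_small:
  "hadj c i (Suc 0) \<longleftrightarrow> False"
  "hadj c i 2 \<longleftrightarrow> i = 1"
  "hadj c i 3 \<longleftrightarrow> i = 1 \<or> i = 2"
  "hadj c i 4 \<longleftrightarrow> i = 1 \<or> i = 2"
  "hadj 5 i 5 \<longleftrightarrow> i = 3 \<or> i = 4"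
  "hadj 7 i 5 \<longleftrightarrow> i = 3"
  "hadj 7 i 6 \<longleftrightarrow> i = 4 \<or> i = 5"
  "hadj 7 i 7 \<longleftrightarrow> i = 5 \<or> i = 6"
  by (auto simp: hadj_def)

lemma hadj_diamond:
  assumes "4 \<le> c"
  shows "hadj c i (c + 4 * m + 1) \<longleftrightarrow> i = c + 4 * m"
    and "hadj c i (c + 4 * m + 2) \<longleftrightarrow> i = c + 4 * m + 1"
    and "hadj c i (c + 4 * m + 3) \<longleftrightarrow> i = c + 4 * m + 1 \<or> i = c + 4 * m + 2"
    and "hadj c i (c + 4 * m + 4) \<longleftrightarrow> i = c + 4 * m + 2 \<or> i = c + 4 * m + 3"
proof -
  have "(c + 4 * m + 1 - c) mod 4 = 1" "(c + 4 * m + 2 - c) mod 4 = 2"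
    "(c + 4 * m + 3 - c) mod 4 = 3" "(c + 4 * m + 4 - c) mod 4 = 0"
    by (simp_all add: add.assoc) presburger+
  then show "hadj c i (c + 4 * m + 1) \<longleftrightarrow> i = c + 4 * m"
    and "hadj c i (c + 4 * m + 2) \<longleftrightarrow> i = c + 4 * m + 1"
    and "hadj c i (c + 4 * m + 3) \<longleftrightarrow> i = c + 4 * m + 1 \<or> i = c + 4 * m + 2"
    and "hadj c i (c + 4 * m + 4) \<longleftrightarrow> i = c + 4 * m + 2 \<or> i = c + 4 * m + 3"
    using assms unfolding hadj_def by auto
qed

lemma position_cases:
  fixes c j :: nat
  assumes "c < j"
  obtains m r where "j = c + 4 * m + r" "r = 1 \<or> r = 2 \<or> r = 3 \<or> r = 4"
proof -
  define u where "u = j - c - 1"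
  define m where "m = u div 4"
  define r where "r = u mod 4 + 1"
  have "u = 4 * m + u mod 4" by (simp add: m_def)
  then have "j = c + 4 * m + r" using assms unfolding u_def r_def by simp
  moreover have "u mod 4 < 4" by simp
  then have "r = 1 \<or> r = 2 \<or> r = 3 \<or> r = 4" unfolding r_def by linarith
  ultimately show ?thesis using that by blast
qed

lemma best_bridges_eq:
  assumes "c = 5 \<or> c = 7" "n = c + 4 * t \<or> n = c + 4 * t + 1"
  shows "best_bridges n = {c + 4 * m |m. m \<le> t}"
proof (rule Set.set_eqI, rule iffI)
  fix k assume "k \<in> best_bridges n"
  then obtain m where "5 \<le> k" "odd k" "n = k + 4 * m \<or> n = k + 4 * m + 1" by (auto simp: best_bridges_def)
  moreover have "odd c" "c \<le> 7" using assms by auto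
  ultimately have e: "k + 4 * m = c + 4 * t" using assms(2) by presburger
  then have "m \<le> t" using \<open>5 \<le> k\<close> \<open>c \<le> 7\<close> by linarith
  then have "m \<le> t \<and> k = c + 4 * (t - m)" using e by simp
  then show "k \<in> {c + 4 * m |m. m \<le> t}" by auto
next
  fix k assume "k \<in> {c + 4 * m |m. m \<le> t}"
  then obtain m where m: "k = c + 4 * m" "m \<le> t" by blast
  then have "n = k + 4 * (t - m) \<or> n = k + 4 * (t - m) + 1" using assms by auto
  moreover have "5 \<le> k" "odd k" using m assms(1) by auto
  ultimately show "k \<in> best_bridges n" unfolding best_bridges_def by blast
qed

context network
begin

lemma cut_mono_right: "m \<le> m' \<Longrightarrow> cut n W l m' \<le> cut n W l m"
  unfolding cut_def by (intro sum_mono sum_mono2) auto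

lemma cut_diag_Suc_Suc:
  assumes "Suc (Suc j) \<le> n"
  shows "cut n W (Suc (Suc j)) (Suc (Suc j)) + 2 * (lower (Suc j) + lower (Suc (Suc j))) = cut n W j j + 6"
  using cut_diag_Suc(2)[of j] cut_diag_Suc(2)[of "Suc j"] assms by simp

lemma column_zero:
  assumes "m < n" "cut n W l m = 0" "1 \<le> i" "i \<le> l" "m < k" "k \<le> n"
  shows "W i k = 0"
proof -
  have "W i k \<le> (\<Sum>k=Suc m..Suc n. W i k)" using assms by (intro member_le_sum) auto
  also have "\<dots> \<le> cut n W l m" unfolding cut_def using assms by (intro member_le_sum) auto
  finally show ?thesis using assms by simp
qed

end

section \<open>Cut sizes of the graph in its natural numbering\<close>

locale model_network = network n W for n W +
  fixes c t :: nat
  assumes c: "c = 5 \<or> c = 7" and n: "n = c + 4 * t \<or> n = c + 4 * t + 1"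
    and W_eq: "1 \<le> i \<Longrightarrow> i < k \<Longrightarrow> k \<le> n \<Longrightarrow> W i k = (if hadj c i k then 1 else 0)"
begin

lemma sum_W:
  assumes "l < k" "k \<le> n"
  shows "(\<Sum>i=1..l. W i k) = card {i. 1 \<le> i \<and> i \<le> l \<and> hadj c i k}"
proof -
  have "(\<Sum>i=1..l. W i k) = (\<Sum>i\<in>{1..l}. if i \<in> {i. hadj c i k} then 1 else 0)"
    using assms by (intro sum.cong) (auto simp: W_eq)
  also have "\<dots> = card ({1..l} \<inter> {i. hadj c i k})" by (subst sum.inter_restrict[symmetric]) simp_all
  also have "{1..l} \<inter> {i. hadj c i k} = {i. 1 \<le> i \<and> i \<le> l \<and> hadj c i k}" by auto
  finally show ?thesis .
qed

lemma lower_card: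
  assumes "1 \<le> k" "k \<le> n"
  shows "lower k = card {i. 1 \<le> i \<and> i < k \<and> hadj c i k}"
proof -
  obtain j where "k = Suc j" using assms by (cases k) auto
  then show ?thesis using sum_W[of j k] lower_Suc[of j] assms by (simp add: less_Suc_eq_le)
qed

lemma c_le: "c \<le> n" using n by auto

lemma lower_small:
  "lower 1 = 0" "lower 2 = 1" "lower 3 = 2" "lower 4 = 2"
  "c = 5 \<Longrightarrow> lower 5 = 2"
  "c = 7 \<Longrightarrow> lower 5 = 1" "c = 7 \<Longrightarrow> lower 6 = 2" "c = 7 \<Longrightarrow> lower 7 = 2"
proof -
  have s1: "{i. 1 \<le> i \<and> i < k \<and> i = u} = {u}" if "1 \<le> u" "u < k" for u k :: nat using that by auto
  have s2: "{i. 1 \<le> i \<and> i < k \<and> (i = u \<or> i = v)} = {u, v}" if "1 \<le> u" "u < k" "1 \<le> v" "v < k" for u v k :: nat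
    using that by auto
  show "lower 1 = 0" by (simp add: lower_def)
  show "lower 2 = 1" "lower 3 = 2" "lower 4 = 2"
    using n_ge by (simp_all only: lower_card hadj_small s1 s2) simp_all
  show "c = 5 \<Longrightarrow> lower 5 = 2"
    "c = 7 \<Longrightarrow> lower 5 = 1" "c = 7 \<Longrightarrow> lower 6 = 2" "c = 7 \<Longrightarrow> lower 7 = 2"
    using n_ge by (simp_all only: lower_card hadj_small s1 s2) simp_all
qed

lemma lower_diamond:
  "c + 4 * m + 1 \<le> n \<Longrightarrow> lower (c + 4 * m + 1) = 1"
  "c + 4 * m + 2 \<le> n \<Longrightarrow> lower (c + 4 * m + 2) = 1"
  "c + 4 * m + 3 \<le> n \<Longrightarrow> lower (c + 4 * m + 3) = 2"
  "c + 4 * m + 4 \<le> n \<Longrightarrow> lower (c + 4 * m + 4) = 2"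
proof -
  have c4: "4 \<le> c" using c by auto
  have s1: "{i. 1 \<le> i \<and> i < k \<and> i = u} = {u}" if "1 \<le> u" "u < k" for u k :: nat using that by auto
  have s2: "{i. 1 \<le> i \<and> i < k \<and> (i = u \<or> i = v)} = {u, v}" if "1 \<le> u" "u < k" "1 \<le> v" "v < k" for u v k :: nat
    using that by auto
  show "c + 4 * m + 1 \<le> n \<Longrightarrow> lower (c + 4 * m + 1) = 1"
    using c4 by (subst lower_card) (simp_all only: hadj_diamond s1, simp_all)
  show "c + 4 * m + 2 \<le> n \<Longrightarrow> lower (c + 4 * m + 2) = 1"
    using c4 by (subst lower_card) (simp_all only: hadj_diamond s1, simp_all)
  show "c + 4 * m + 3 \<le> n \<Longrightarrow> lower (c + 4 * m + 3) = 2"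
    using c4 by (subst lower_card) (simp_all only: hadj_diamond s2, simp_all)
  show "c + 4 * m + 4 \<le> n \<Longrightarrow> lower (c + 4 * m + 4) = 2"
    using c4 by (subst lower_card) (simp_all only: hadj_diamond s2, simp_all)
qed

lemma cut_small:
  "cut n W 2 2 = 4" "cut n W 3 3 = 3" "cut n W 4 4 = 2"
  "c = 5 \<Longrightarrow> cut n W 5 5 = 1"
  "c = 7 \<Longrightarrow> cut n W 5 5 = 3" "c = 7 \<Longrightarrow> cut n W 6 6 = 2" "c = 7 \<Longrightarrow> cut n W 7 7 = 1"
proof -
  have e: "cut n W 2 2 + 2 * lower 2 = cut n W 1 1 + 3" "cut n W 3 3 + 2 * lower 3 = cut n W 2 2 + 3"
    "cut n W 4 4 + 2 * lower 4 = cut n W 3 3 + 3" "cut n W 5 5 + 2 * lower 5 = cut n W 4 4 + 3"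
    "cut n W 6 6 + 2 * lower 6 = cut n W 5 5 + 3" "cut n W 7 7 + 2 * lower 7 = cut n W 6 6 + 3"
    using cut_diag_Suc(2)[of 1] cut_diag_Suc(2)[of 2] cut_diag_Suc(2)[of 3]
      cut_diag_Suc(2)[of 4] cut_diag_Suc(2)[of 5] cut_diag_Suc(2)[of 6] n_ge
    by (simp_all add: eval_nat_numeral)
  show "cut n W 2 2 = 4" "cut n W 3 3 = 3" "cut n W 4 4 = 2"
    "c = 5 \<Longrightarrow> cut n W 5 5 = 1"
    "c = 7 \<Longrightarrow> cut n W 5 5 = 3" "c = 7 \<Longrightarrow> cut n W 6 6 = 2" "c = 7 \<Longrightarrow> cut n W 7 7 = 1"
    using e cut_diag_small(1) lower_small by simp_all
qed

lemma cut_diamond: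
  "c + 4 * m \<le> n \<Longrightarrow> cut n W (c + 4 * m) (c + 4 * m) = 1"
  "c + 4 * m + 1 \<le> n \<Longrightarrow> cut n W (c + 4 * m + 1) (c + 4 * m + 1) = 2"
  "c + 4 * m + 2 \<le> n \<Longrightarrow> cut n W (c + 4 * m + 2) (c + 4 * m + 2) = 3"
  "c + 4 * m + 3 \<le> n \<Longrightarrow> cut n W (c + 4 * m + 3) (c + 4 * m + 3) = 2"
proof -
  have s1: "cut n W (c + 4 * m + 1) (c + 4 * m + 1) + 2 * 1 = cut n W (c + 4 * m) (c + 4 * m) + 3"
    if "c + 4 * m + 1 \<le> n" for m using cut_diag_Suc(2)[of "c + 4 * m"] lower_diamond(1) that by simp
  have s2: "cut n W (c + 4 * m + 2) (c + 4 * m + 2) + 2 * 1 = cut n W (c + 4 * m + 1) (c + 4 * m + 1) + 3"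
    if "c + 4 * m + 2 \<le> n" for m using cut_diag_Suc(2)[of "c + 4 * m + 1"] lower_diamond(2) that by simp
  have s3: "cut n W (c + 4 * m + 3) (c + 4 * m + 3) + 2 * 2 = cut n W (c + 4 * m + 2) (c + 4 * m + 2) + 3"
    if "c + 4 * m + 3 \<le> n" for m using cut_diag_Suc(2)[of "c + 4 * m + 2"] lower_diamond(3) that
    by (simp add: eval_nat_numeral)
  have s4: "cut n W (c + 4 * m + 4) (c + 4 * m + 4) + 2 * 2 = cut n W (c + 4 * m + 3) (c + 4 * m + 3) + 3"
    if "c + 4 * m + 4 \<le> n" for m using cut_diag_Suc(2)[of "c + 4 * m + 3"] lower_diamond(4) that
    by (simp add: eval_nat_numeral)
  have base: "cut n W (c + 4 * m) (c + 4 * m) = 1" if "c + 4 * m \<le> n" for m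
    using that
  proof (induction m)
    case 0 then show ?case using c cut_small by auto
  next
    case (Suc m)
    have eq: "c + 4 * Suc m = c + 4 * m + 4" by simp
    show ?case unfolding eq using Suc s1[of m] s2[of m] s3[of m] s4[of m] by simp
  qed
  show "c + 4 * m \<le> n \<Longrightarrow> cut n W (c + 4 * m) (c + 4 * m) = 1" by (rule base)
  show "c + 4 * m + 1 \<le> n \<Longrightarrow> cut n W (c + 4 * m + 1) (c + 4 * m + 1) = 2"
    using base[of m] s1[of m] by simp
  show "c + 4 * m + 2 \<le> n \<Longrightarrow> cut n W (c + 4 * m + 2) (c + 4 * m + 2) = 3"
    using base[of m] s1[of m] s2[of m] by simp
  show "c + 4 * m + 3 \<le> n \<Longrightarrow> cut n W (c + 4 * m + 3) (c + 4 * m + 3) = 2"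
    using base[of m] s1[of m] s2[of m] s3[of m] by simp
qed

lemma best_bridges_iff: "k \<in> best_bridges n \<longleftrightarrow> (\<exists>m. k = c + 4 * m \<and> m \<le> t)"
  using best_bridges_eq[OF c n] by auto

lemma best_bridges_diamond:
  "c + 4 * m \<le> n \<Longrightarrow> c + 4 * m \<in> best_bridges n"
  "c + 4 * m + 2 \<notin> best_bridges n"
  using n by (auto simp: best_bridges_iff) presburger+

lemma cut_diag_eq: "1 \<le> j \<Longrightarrow> j \<le> n \<Longrightarrow> real (cut n W j j) = min_cut (best_bridges n) j"
proof -
  assume j: "1 \<le> j" "j \<le> n"
  have nopt: "k \<notin> best_bridges n" if "k < c" for k using that by (auto simp: best_bridges_iff)
  show ?thesis
  proof (cases "j \<le> c")
    case True
    then consider "j = 1" | "j = 2" | "j = 3" | "j = 4" | "j = 5" "c = 5" | "j = 5" "c = 7"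
      | "j = 6" "c = 7" | "j = 7" "c = 7" using j c by force
    then show ?thesis
    proof cases
      case 5
      then have "j \<in> best_bridges n" using best_bridges_diamond(1)[of 0] c_le by simp
      then show ?thesis using cut_small 5 by (simp add: min_cut_def)
    next
      case 8
      then have "j \<in> best_bridges n" using best_bridges_diamond(1)[of 0] c_le by simp
      then show ?thesis using cut_small 8 by (simp add: min_cut_def)
    qed (use cut_small cut_diag_small(1) nopt[of j] c in \<open>auto simp: min_cut_def\<close>)
  next
    case False
    then obtain m r where r: "j = c + 4 * m + r" "r = 1 \<or> r = 2 \<or> r = 3 \<or> r = 4"
      using position_cases[of c j] by auto
    have odd: "odd c" "2 < c" using c by auto
    from r(2) show ?thesis
    proof (elim disjE)
      assume "r = 1"
      then show ?thesis using r j odd cut_diamond(2)[of m] by (simp add: min_cut_def)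
    next
      assume "r = 2"
      then show ?thesis using r j odd cut_diamond(3)[of m] best_bridges_diamond(2)[of m] by (simp add: min_cut_def)
    next
      assume "r = 3"
      then show ?thesis using r j odd cut_diamond(4)[of m] by (simp add: min_cut_def)
    next
      assume "r = 4"
      then have "j = c + 4 * Suc m" using r by simp
      then show ?thesis using j odd cut_diamond(1)[of "Suc m"] best_bridges_diamond(1)[of "Suc m"] by (simp add: min_cut_def)
    qed
  qed
qed

text \<open>No edge passes over both \<open>l + 1\<close> and \<open>l + 2\<close>. The diagonal
  cuts determine how many edges pass over \<open>l + 1\<close>, and the edges from
  \<open>{1..l}\<close> to \<open>l + 2\<close> account for all of them.\<close>

lemma cut_two_apart:
  assumes "2 \<le> l" "l + 2 \<le> n"
  shows "cut n W l (l + 2) = 0"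
proof -
  have e1: "cut n W l l + cut n W (l + 1) (l + 1) = 2 * cut n W l (l + 1) + 3"
    using cut_diag_Suc(1)[of l] assms by simp
  have e2: "cut n W l (l + 1) = cut n W l (l + 2) + card {i. 1 \<le> i \<and> i \<le> l \<and> hadj c i (l + 2)}"
    using cut_Suc_right[of "l + 1" l] sum_W[of l "l + 2"] assms by simp
  have c4: "4 \<le> c" using c by auto
  show ?thesis
  proof (cases "l + 2 \<le> c")
    case True
    then consider "l = 2" | "l = 3" "c = 5" | "l = 3" "c = 7" | "l = 4" "c = 7" | "l = 5" "c = 7"
      using assms c by force
    then show ?thesis
    proof cases
      case 1
      have "{i. 1 \<le> i \<and> i \<le> l \<and> hadj c i (l + 2)} = {1, 2}" using 1 by (auto simp: hadj_small)
      then show ?thesis using e1 e2 1 cut_small by simp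
    next
      case 2
      have "{i. 1 \<le> i \<and> i \<le> l \<and> hadj c i (l + 2)} = {3}" using 2 by (auto simp: hadj_small)
      then show ?thesis using e1 e2 2 cut_small by simp
    next
      case 3
      have "{i. 1 \<le> i \<and> i \<le> l \<and> hadj c i (l + 2)} = {3}" using 3 by (auto simp: hadj_small)
      then show ?thesis using e1 e2 3 cut_small by simp
    next
      case 4
      have "{i. 1 \<le> i \<and> i \<le> l \<and> hadj c i (l + 2)} = {4}" using 4 by (auto simp: hadj_small)
      then show ?thesis using e1 e2 4 cut_small by simp
    next
      case 5
      have "{i. 1 \<le> i \<and> i \<le> l \<and> hadj c i (l + 2)} = {5}" using 5 by (auto simp: hadj_small)
      then show ?thesis using e1 e2 5 cut_small by simp
    qed
  next
    case False
    show ?thesis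
    proof (cases "l + 1 = c")
      case True
      then have "cut n W l l = 2" using c cut_small by auto
      moreover have "cut n W (l + 1) (l + 1) = 1" using True cut_diamond(1)[of 0] assms by simp
      ultimately show ?thesis using e1 e2 by simp
    next
      case False
      with \<open>\<not> l + 2 \<le> c\<close> have "c < l + 1" by simp
      then obtain m r where r: "l + 1 = c + 4 * m + r" "r = 1 \<or> r = 2 \<or> r = 3 \<or> r = 4"
        using position_cases[of c "l + 1"] by auto
      from r(2) show ?thesis
      proof (elim disjE)
        assume "r = 1"
        then have "l = c + 4 * m" using r by simp
        then show ?thesis using e1 e2 assms cut_diamond(1,2)[of m] by simp
      next
        assume "r = 2"
        then have l: "l = c + 4 * m + 1" using r by simp
        then have "l + 2 = c + 4 * m + 3" by simp
        then have "{i. 1 \<le> i \<and> i \<le> l \<and> hadj c i (l + 2)} = {l}"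
          using l by (auto simp only: hadj_diamond[OF c4])
        moreover have "cut n W l l = 2" "cut n W (l + 1) (l + 1) = 3"
          using cut_diamond(2,3)[of m] l assms by (simp_all add: eval_nat_numeral)
        ultimately show ?thesis using e1 e2 by simp
      next
        assume "r = 3"
        then have l: "l = c + 4 * m + 2" using r by simp
        then have "l + 2 = c + 4 * m + 4" by simp
        then have "{i. 1 \<le> i \<and> i \<le> l \<and> hadj c i (l + 2)} = {l}"
          using l by (auto simp only: hadj_diamond[OF c4])
        moreover have "cut n W l l = 3" "cut n W (l + 1) (l + 1) = 2"
          using cut_diamond(3,4)[of m] l assms by (simp_all add: eval_nat_numeral)
        ultimately show ?thesis using e1 e2 by simp
      next
        assume "r = 4"
        then have l: "l = c + 4 * m + 3" "l + 1 = c + 4 * Suc m" using r by simp_all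
        have "c + 4 * Suc m \<le> n" using l assms by simp
        then have "cut n W (l + 1) (l + 1) = 1" unfolding l(2) by (rule cut_diamond(1))
        moreover have "cut n W l l = 2" using cut_diamond(4)[of m] l(1) assms by simp
        ultimately show ?thesis using e1 e2 by simp
      qed
    qed
  qed
qed

text \<open>For this graph the model form with the best bridges is therefore the energy itself, not
  only a lower bound. Row 1 is computed by hand because the edge from 1 to 4 is the only one
  spanning three positions.\<close>

theorem cut_eq_model:
  assumes "1 \<le> l" "l \<le> m" "m \<le> n"
  shows "real (cut n W l m) = model (best_bridges n) l m"
proof -
  consider "l = m" | "m = Suc l" | "l = 1" "m = 3" | "l = 1" "4 \<le> m" | "2 \<le> l" "l + 2 \<le> m"
    using assms by linarith
  then show ?thesis
  proof cases
    case 1 then show ?thesis using assms cut_diag_eq by (simp add: model_def)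
  next
    case 2
    have "real (cut n W l l) + real (cut n W m m) = 2 * real (cut n W l m) + 3"
      using cut_diag_Suc(1)[of l] assms 2 by (metis of_nat_add of_nat_mult of_nat_numeral)
    then show ?thesis using cut_diag_eq[of l] cut_diag_eq[of m] assms 2 by (simp add: model_def)
  next
    case 3
    have "cut n W 1 1 = cut n W 1 2 + W 1 2" "cut n W 1 2 = cut n W 1 3 + W 1 3"
      using cut_Suc_right[of 1 1] cut_Suc_right[of 2 1] n_ge by (simp_all add: eval_nat_numeral)
    moreover have "W 1 2 = 1" "W 1 3 = 1" using W_eq n_ge by (simp_all add: hadj_small)
    ultimately show ?thesis using cut_diag_small(1) 3 by (simp add: model_def)
  next
    case 4
    have "cut n W 1 1 = cut n W 1 2 + W 1 2" "cut n W 1 2 = cut n W 1 3 + W 1 3" "cut n W 1 3 = cut n W 1 4 + W 1 4"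
      using cut_Suc_right[of 1 1] cut_Suc_right[of 2 1] cut_Suc_right[of 3 1] n_ge by (simp_all add: eval_nat_numeral)
    moreover have "W 1 2 = 1" "W 1 3 = 1" "W 1 4 = 1" using W_eq n_ge by (simp_all add: hadj_small)
    ultimately have "cut n W 1 4 = 0" using cut_diag_small(1) by simp
    then have "cut n W l m = 0" using 4 cut_mono_right[of 4 m 1] by simp
    then show ?thesis using 4 by (simp add: model_def)
  next
    case 5
    then have "cut n W l m = 0" using cut_two_apart[of l] cut_mono_right[of "l + 2" m l] assms by simp
    then show ?thesis using 5 by (simp add: model_def)
  qed
qed

end

text \<open>For \<open>c = 7\<close> the vertices 5 and 6 are adjacent to each other and both to 7.
  Exchanging them turns one perfect matching between \<open>{3, 4}\<close> and \<open>{5, 6}\<close>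
  into the other and changes no other edge.\<close>

definition swap56 :: "nat \<Rightarrow> nat" where
  "swap56 i = (if i = 5 then 6 else if i = 6 then 5 else i)"

section \<open>Recovering the edges from the cuts\<close>

lemma sum_eq_last:
  fixes g :: "nat \<Rightarrow> nat"
  assumes "\<And>i. 1 \<le> i \<Longrightarrow> i \<le> l \<Longrightarrow> g i = 0"
  shows "(\<Sum>i=1..l + 1. g i) = g (l + 1)" "(\<Sum>i=1..l + 2. g i) = g (l + 1) + g (l + 2)"
proof -
  have "(\<Sum>i=1..l. g i) = 0" using assms by (intro sum.neutral) auto
  then show "(\<Sum>i=1..l + 1. g i) = g (l + 1)" "(\<Sum>i=1..l + 2. g i) = g (l + 1) + g (l + 2)" by simp_all
qed

context network
begin

text \<open>
  The cuts at the positions in \<open>P\<close> determine the numbers of edges between the blocks into which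
  \<open>P\<close> divides the vertices, and hence all edges except those between \<open>{3, 4}\<close> and \<open>{5, 6}\<close>
  when \<open>c = 7\<close>; there two perfect matchings are possible.
\<close>

lemma edges_determined:
  assumes c: "c = 5 \<or> c = 7" and n: "n = c + 4 * t \<or> n = c + 4 * t + 1"
    and P: "P = {l. 1 \<le> l \<and> l \<le> n \<and> (even l \<or> l \<in> best_bridges n)}"
    and diag: "\<And>l. l \<in> P \<Longrightarrow> real (cut n W l l) = min_cut (best_bridges n) l"
    and off: "\<And>l m. l \<in> P \<Longrightarrow> m \<in> P \<Longrightarrow> l < m \<Longrightarrow> cut n W l m = 0"
  shows "(\<forall>i k. 1 \<le> i \<longrightarrow> i < k \<longrightarrow> k \<le> n \<longrightarrow> W i k = (if hadj c i k then 1 else 0)) \<or>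
    c = 7 \<and> (\<forall>i k. 1 \<le> i \<longrightarrow> i < k \<longrightarrow> k \<le> n \<longrightarrow>
      W i k = (if hadj c (swap56 i) (swap56 k) \<or> hadj c (swap56 k) (swap56 i) then 1 else 0))"
proof -
  note oeq = best_bridges_eq[OF c n] and sle = simple[unfolded One_nat_def]
  have cn: "c \<le> n" using n by auto
  have zero: "W i k = 0" if "l \<in> P" "m \<in> P" "l < m" "1 \<le> i" "i \<le> l" "m < k" "k \<le> n" for i k l m
    using column_zero[of m l i k] off[of l m] that by auto
  have Peven: "l \<in> P" if "even l" "1 \<le> l" "l \<le> n" for l using that P by auto
  have Popt: "c + 4 * m \<in> P" if "c + 4 * m \<le> n" for m
  proof -
    have "m \<le> t" using that n by auto
    then show ?thesis using that c unfolding P oeq by auto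
  qed
  have even2: "cut n W l l = 2" if "even l" "4 \<le> l" "l \<le> n" for l
    using diag[OF Peven[of l]] that by (simp add: min_cut_def)
  have opt1: "cut n W (c + 4 * m) (c + 4 * m) = 1" if "c + 4 * m \<le> n" for m
  proof -
    have "m \<le> t" using that n by auto
    then have "c + 4 * m \<in> best_bridges n" using oeq by auto
    moreover have "odd (c + 4 * m)" "c + 4 * m \<noteq> 0" "c + 4 * m \<noteq> 2" using c by auto
    ultimately have "min_cut (best_bridges n) (c + 4 * m) = 1" unfolding min_cut_def by metis
    then show ?thesis using diag[OF Popt[OF that]] by simp
  qed
  have s4: "{1..Suc 0} = {1}" "{1..2} = {1, 2::nat}" "{1..3} = {1, 2, 3::nat}" "{1..4} = {1, 2, 3, 4::nat}"
    "{1..5} = {1, 2, 3, 4, 5::nat}" "{1..6} = {1, 2, 3, 4, 5, 6::nat}" by auto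
  have e2: "cut n W 2 2 = 4" using diag[OF Peven[of 2]] n_ge by (simp add: min_cut_def)
  have W12: "W 1 2 = 1"
    using cut_diag_Suc_Suc[of 0] e2 n_ge by (simp add: lower_def cut_0 eval_nat_numeral)
  \<comment> \<open>None of the four edges leaving \<open>{1, 2}\<close> passes over the block
    \<open>{3, 4}\<close>, so they are all the four possible edges between these blocks.\<close>
  have W34s: "W 1 3 = 1 \<and> W 2 3 = 1 \<and> W 1 4 = 1 \<and> W 2 4 = 1"
  proof -
    have "cut n W 2 2 = cut n W 2 3 + (W 1 3 + W 2 3)" "cut n W 2 3 = cut n W 2 4 + (W 1 4 + W 2 4)"
      using cut_Suc_right[of 2 2] cut_Suc_right[of 3 2] n_ge by (simp_all add: s4 eval_nat_numeral)
    moreover have "cut n W 2 4 = 0" using n_ge by (intro off Peven) auto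
    moreover have "W 1 3 \<le> 1" "W 2 3 \<le> 1" "W 1 4 \<le> 1" "W 2 4 \<le> 1" using n_ge by (auto intro!: sle)
    ultimately show ?thesis using e2 by linarith
  qed
  have e4: "cut n W 4 4 = 2" using even2[of 4] n_ge by simp
  have lw: "lower 3 = W 1 3 + W 2 3" "lower 4 = W 1 4 + W 2 4 + W 3 4"
    "lower 5 = W 1 5 + W 2 5 + W 3 5 + W 4 5" "lower 6 = W 1 6 + W 2 6 + W 3 6 + W 4 6 + W 5 6"
    using lower_Suc[of 2] lower_Suc[of 3] lower_Suc[of 4] lower_Suc[of 5]
    by (simp_all add: eval_nat_numeral)
  have W34: "W 3 4 = 0"
  proof -
    have "cut n W 4 4 + 2 * (lower 3 + lower 4) = cut n W 2 2 + 6"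
      using cut_diag_Suc_Suc[of 2] n_ge by (simp add: eval_nat_numeral)
    then show ?thesis using e2 e4 lw W34s by simp
  qed
  have z24: "W i k = 0" if "1 \<le> i" "i \<le> 2" "4 < k" "k \<le> n" for i k
    using that n_ge zero[of 2 4 i k] Peven[of 2] Peven[of 4] by auto
  have odd_c: "odd (c + 4 * m)" "5 \<le> c + 4 * m" for m using c by auto
  \<comment> \<open>The only edge across the bridge position must end in the one-vertex block
    \<open>c + 4 * m + 1\<close>. It starts at the bridge vertex, since no edge passes over that
    block either.\<close>
  have col1: "W i (c + 4 * m + 1) = (if i = c + 4 * m then 1 else 0)"
    if k: "c + 4 * m + 1 \<le> n" and i: "1 \<le> i" "i < c + 4 * m + 1" for m i
  proof -
    let ?b = "c + 4 * m"
    have "?b \<in> P" using k by (intro Popt) simp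
    moreover have "?b - 1 \<in> P" "?b + 1 \<in> P" using odd_c[of m] k by (auto intro!: Peven)
    ultimately have P1: "?b - 1 \<in> P" "?b \<in> P" "?b + 1 \<in> P" by blast+
    have z: "W i (?b + 1) = 0" if "1 \<le> i" "i \<le> ?b - 1" for i
      using that k odd_c[of m] P1 by (intro zero[of "?b - 1" ?b]) auto
    have "cut n W ?b ?b = cut n W ?b (?b + 1) + (\<Sum>i=1..?b. W i (?b + 1))"
      using cut_Suc_right[of ?b ?b] k by simp
    also have "(\<Sum>i=1..?b. W i (?b + 1)) = W ?b (?b + 1)"
    proof -
      have eq: "?b - 1 + 1 = ?b" using odd_c[of m] by simp
      show ?thesis using sum_eq_last(1)[of "?b - 1" "\<lambda>i. W i (?b + 1)", OF z] unfolding eq .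
    qed
    finally have "cut n W ?b ?b = cut n W ?b (?b + 1) + W ?b (?b + 1)" .
    moreover have "cut n W ?b (?b + 1) = 0" using P1 by (intro off) auto
    moreover have "cut n W ?b ?b = 1" using k by (intro opt1) simp
    ultimately have "W ?b (?b + 1) = 1" by linarith
    then show ?thesis using z[of i] i by auto
  qed
  \<comment> \<open>Both edges across position \<open>c + 4 * m + 1\<close> come from that vertex
    and end in the next block of two vertices; counting back edges over the block then forces the
    edge inside it.\<close>
  have col23: "(i < c + 4 * m + 2 \<longrightarrow> W i (c + 4 * m + 2) = (if i = c + 4 * m + 1 then 1 else 0)) \<and>
       (W i (c + 4 * m + 3) = (if i = c + 4 * m + 1 \<or> i = c + 4 * m + 2 then 1 else 0))"
    if k: "c + 4 * m + 3 \<le> n" and i: "1 \<le> i" "i < c + 4 * m + 3" for m i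
  proof -
    let ?b = "c + 4 * m"
    have "?b \<in> P" using k by (intro Popt) simp
    moreover have "?b + 1 \<in> P" "?b + 3 \<in> P" using odd_c[of m] k by (auto intro!: Peven)
    ultimately have P1: "?b \<in> P" "?b + 1 \<in> P" "?b + 3 \<in> P" by blast+
    have z: "W i k' = 0" if "1 \<le> i" "i \<le> ?b" "k' = ?b + 2 \<or> k' = ?b + 3" for i k'
      using that k odd_c[of m] P1 by (intro zero[of ?b "?b + 1"]) auto
    have "cut n W (?b + 1) (?b + 1) = cut n W (?b + 1) (?b + 3) +
        (\<Sum>i=1..?b + 1. W i (?b + 3)) + (\<Sum>i=1..?b + 1. W i (?b + 2))"
      using cut_Suc_right[of "?b + 1" "?b + 1"] cut_Suc_right[of "?b + 2" "?b + 1"] k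
      by (simp add: eval_nat_numeral)
    moreover have "(\<Sum>i=1..?b + 1. W i k') = W (?b + 1) k'" if "k' = ?b + 2 \<or> k' = ?b + 3" for k'
      by (rule sum_eq_last(1)) (rule z[OF _ _ that]; assumption)
    ultimately have "W (?b + 1) (?b + 3) + W (?b + 1) (?b + 2) = 2"
      using off[OF P1(2,3)] even2[of "?b + 1"] odd_c[of m] k by simp
    moreover have "W (?b + 1) (?b + 3) \<le> 1" "W (?b + 1) (?b + 2) \<le> 1" using k by (auto intro!: sle)
    ultimately have 1: "W (?b + 1) (?b + 2) = 1" "W (?b + 1) (?b + 3) = 1" by auto
    have l2: "lower (?b + 2) = 1"
    proof -
      have "lower (?b + 2) = (\<Sum>i=1..?b + 1. W i (?b + 2))" using lower_Suc[of "?b + 1"] by simp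
      also have "\<dots> = W (?b + 1) (?b + 2)" by (rule sum_eq_last(1)) (rule z; simp)
      finally show ?thesis using 1 by simp
    qed
    have l3: "lower (?b + 3) = 1 + W (?b + 2) (?b + 3)"
    proof -
      have "lower (?b + 3) = (\<Sum>i=1..?b + 2. W i (?b + 3))"
        using lower_Suc[of "?b + 2"] by (simp add: eval_nat_numeral)
      also have "\<dots> = W (?b + 1) (?b + 3) + W (?b + 2) (?b + 3)"
        by (rule sum_eq_last(2)) (rule z; simp)
      finally show ?thesis using 1 by simp
    qed
    have "cut n W (?b + 3) (?b + 3) + 2 * (lower (?b + 2) + lower (?b + 3)) = cut n W (?b + 1) (?b + 1) + 6"
      using cut_diag_Suc_Suc[of "?b + 1"] k by (simp add: eval_nat_numeral)
    then have "W (?b + 2) (?b + 3) = 1"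
      using l2 l3 even2[of "?b + 1"] even2[of "?b + 3"] odd_c[of m] k by simp
    moreover have "i \<le> ?b \<or> i = ?b + 1 \<or> i = ?b + 2" using i by linarith
    ultimately show ?thesis using 1 z[of i "?b + 2"] z[of i "?b + 3"] i
      by (auto simp: eval_nat_numeral)
  qed
  \<comment> \<open>The two edges leaving the block of two vertices end in the following one-vertex
    block, so by simplicity one comes from each vertex.\<close>
  have col4: "W i (c + 4 * m + 4) = (if i = c + 4 * m + 2 \<or> i = c + 4 * m + 3 then 1 else 0)"
    if k: "c + 4 * m + 4 \<le> n" and i: "1 \<le> i" "i < c + 4 * m + 4" for m i
  proof -
    let ?b = "c + 4 * m"
    have b4: "c + 4 * Suc m = ?b + 4" by simp
    have "?b + 4 \<in> P" using Popt[of "Suc m"] k unfolding b4 by blast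
    moreover have "?b + 1 \<in> P" "?b + 3 \<in> P" using odd_c[of m] k by (auto intro!: Peven)
    ultimately have P1: "?b + 1 \<in> P" "?b + 3 \<in> P" "?b + 4 \<in> P" by blast+
    have z: "W i (?b + 4) = 0" if "1 \<le> i" "i \<le> ?b + 1" for i
      using that k P1 by (intro zero[of "?b + 1" "?b + 3"]) auto
    have "cut n W (?b + 3) (?b + 3) = cut n W (?b + 3) (?b + 4) + (\<Sum>i=1..?b + 3. W i (?b + 4))"
      using cut_Suc_right[of "?b + 3" "?b + 3"] k by (simp add: eval_nat_numeral)
    also have "(\<Sum>i=1..?b + 3. W i (?b + 4)) = W (?b + 2) (?b + 4) + W (?b + 3) (?b + 4)"
      using sum_eq_last(2)[of "?b + 1" "\<lambda>i. W i (?b + 4)"] z by (simp add: eval_nat_numeral)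
    finally have "W (?b + 2) (?b + 4) + W (?b + 3) (?b + 4) = 2"
      using off[OF P1(2,3)] even2[of "?b + 3"] odd_c[of m] k by simp
    moreover have "W (?b + 2) (?b + 4) \<le> 1" "W (?b + 3) (?b + 4) \<le> 1" using k by (auto intro!: sle)
    ultimately have "W (?b + 2) (?b + 4) = 1" "W (?b + 3) (?b + 4) = 1" by auto
    moreover have "i \<le> ?b + 1 \<or> i = ?b + 2 \<or> i = ?b + 3" using i by linarith
    ultimately show ?thesis using z[of i] i by auto
  qed
  have c4: "4 \<le> c" using c by auto
  have high: "W i k = (if hadj c i k then 1 else 0)" if ck: "c < k" and i: "1 \<le> i" "i < k" "k \<le> n" for i k
  proof -
    obtain m r where r: "k = c + 4 * m + r" "r = 1 \<or> r = 2 \<or> r = 3 \<or> r = 4"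
      using position_cases[OF ck] by blast
    from r(2) show ?thesis
    proof (elim disjE)
      assume "r = 1"
      then have k: "k = c + 4 * m + 1" using r by simp
      show ?thesis unfolding k hadj_diamond[OF c4] using col1[of m i] i k by simp
    next
      assume "r = 2"
      then have k: "k = c + 4 * m + 2" using r by simp
      \<comment> \<open>\<open>n - c\<close> is 0 or 1 modulo 4, so the numbering never ends inside
        a block of two vertices.\<close>
      have "k \<noteq> n"
      proof
        assume "k = n"
        then show False using k n by presburger
      qed
      then have "c + 4 * m + 3 \<le> n" using i k by simp
      then show ?thesis unfolding k hadj_diamond[OF c4] using col23[of m i] i k by simp
    next
      assume "r = 3"
      then have k: "k = c + 4 * m + 3" using r by simp
      show ?thesis unfolding k hadj_diamond[OF c4] using col23[of m i] i k by simp
    next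
      assume "r = 4"
      then have k: "k = c + 4 * m + 4" using r by simp
      show ?thesis unfolding k hadj_diamond[OF c4] using col4[of m i] i k by simp
    qed
  qed
  have low: "W i k = (if hadj c i k then 1 else 0)" if "1 \<le> i" "i < k" "k \<le> 4" for i k
  proof -
    have "i = 1 \<and> k = 2 \<or> i = 1 \<and> k = 3 \<or> i = 2 \<and> k = 3 \<or> i = 1 \<and> k = 4 \<or> i = 2 \<and> k = 4 \<or> i = 3 \<and> k = 4"
      using that by presburger
    then show ?thesis using W12 W34s W34 by (elim disjE) (auto simp: hadj_small)
  qed
  show ?thesis
  proof (cases "c = 5")
    case True
    have P5: "4 \<in> P" "5 \<in> P" using Peven[of 4] Popt[of 0] True n_ge by auto
    have "cut n W 4 4 = cut n W 4 5 + (W 1 5 + W 2 5 + W 3 5 + W 4 5)"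
      using cut_Suc_right[of 4 4] n_ge by (simp add: s4 eval_nat_numeral)
    moreover have "cut n W 4 5 = 0" using off P5 by simp
    moreover have "W 1 5 = 0" "W 2 5 = 0" using z24 n_ge by auto
    moreover have "W 3 5 \<le> 1" "W 4 5 \<le> 1" using n_ge by (auto intro!: sle)
    ultimately have W5: "W 3 5 = 1" "W 4 5 = 1" "W 1 5 = 0" "W 2 5 = 0" using e4 by auto
    have "W i k = (if hadj c i k then 1 else 0)" if i: "1 \<le> i" "i < k" "k \<le> n" for i k
    proof -
      consider "k \<le> 4" | "k = 5" | "c < k" using True by linarith
      then show ?thesis
      proof cases
        case 2
        then have "i = 1 \<or> i = 2 \<or> i = 3 \<or> i = 4" using i by presburger
        then show ?thesis using W5 2 True by (elim disjE) (auto simp: hadj_small)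
      qed (use low high i in auto)
    qed
    then show ?thesis by blast
  next
    case False
    then have c7: "c = 7" using c by simp
    have P7: "4 \<in> P" "6 \<in> P" "7 \<in> P" using Peven[of 4] Peven[of 6] Popt[of 0] c7 n_ge by auto
    have z46: "W i 7 = 0" if "1 \<le> i" "i \<le> 4" for i
      using that n_ge P7 by (intro zero[of 4 6]) auto
    have z: "W 1 5 = 0" "W 2 5 = 0" "W 1 6 = 0" "W 2 6 = 0" "W 1 7 = 0" "W 2 7 = 0" "W 3 7 = 0" "W 4 7 = 0"
      using z24 z46 n_ge by auto
    have "cut n W 4 4 = cut n W 4 5 + (W 1 5 + W 2 5 + W 3 5 + W 4 5)"
      "cut n W 4 5 = cut n W 4 6 + (W 1 6 + W 2 6 + W 3 6 + W 4 6)"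
      "cut n W 6 6 = cut n W 6 7 + (W 1 7 + W 2 7 + W 3 7 + W 4 7 + W 5 7 + W 6 7)"
      using cut_Suc_right[of 4 4] cut_Suc_right[of 5 4] cut_Suc_right[of 6 6] n_ge by (simp_all add: s4 eval_nat_numeral)
    moreover have "cut n W 4 6 = 0" "cut n W 6 7 = 0" using off P7 by simp_all
    moreover have "cut n W 6 6 = 2" using even2[of 6] n_ge by simp
    moreover have "W 5 7 \<le> 1" "W 6 7 \<le> 1" using n_ge by (auto intro!: sle)
    ultimately have s56: "W 3 5 + W 4 5 + W 3 6 + W 4 6 = 2" and W7: "W 5 7 = 1" "W 6 7 = 1"
      using e4 z by auto
    have "cut n W 6 6 + 2 * (lower 5 + lower 6) = cut n W 4 4 + 6"
      using cut_diag_Suc_Suc[of 4] n_ge by (simp add: eval_nat_numeral)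
    then have W56: "W 5 6 = 1" using \<open>cut n W 6 6 = 2\<close> e4 lw z s56 by simp
    have up: "(\<Sum>k\<in>{u, v}. W j k) \<le> (\<Sum>k=Suc j..Suc n. W j k)" if "j < u" "u \<le> n" "j < v" "v \<le> n" for j u v
      using that by (intro sum_mono2) auto
    have deg: "lower j + (\<Sum>k=Suc j..Suc n. W j k) = 3" if "1 \<le> j" "j \<le> n" for j
      using degree[OF that] by (simp add: lower_def)
    \<comment> \<open>Vertices 3 and 4 have two edges back to 1 and 2; vertices 5 and 6 have an edge
      to each other and one to 7. Each of the four thus has room for one more edge, and the two
      edges between the blocks form a perfect matching.\<close>
    have "W 3 5 + W 3 6 \<le> 1" "W 4 5 + W 4 6 \<le> 1" "W 3 5 + W 4 5 \<le> 1" "W 3 6 + W 4 6 \<le> 1"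
      using up[of 3 5 6] up[of 4 5 6] up[of 5 6 7] up[of 6 7 7] deg[of 3] deg[of 4] deg[of 5] deg[of 6]
        n_ge lw z W34s W34 W56 W7 by simp_all
    then have alt: "W 3 5 = 1 \<and> W 4 6 = 1 \<and> W 3 6 = 0 \<and> W 4 5 = 0 \<or> W 3 5 = 0 \<and> W 4 6 = 0 \<and> W 3 6 = 1 \<and> W 4 5 = 1"
      using s56 by arith
    have rows: "i = 1 \<or> i = 2 \<or> i = 3 \<or> i = 4 \<or> i = 5 \<or> i = 6" if "1 \<le> i" "i < k" "k \<le> 7" for i k :: nat
      using that by presburger
    from alt show ?thesis
    proof
      assume a: "W 3 5 = 1 \<and> W 4 6 = 1 \<and> W 3 6 = 0 \<and> W 4 5 = 0"
      have "W i k = (if hadj c i k then 1 else 0)" if i: "1 \<le> i" "i < k" "k \<le> n" for i k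
      proof -
        consider "k \<le> 4" | "k = 5" | "k = 6" | "k = 7" | "c < k" using c7 by linarith
        then show ?thesis
        proof cases
          case 2
          then have "i = 1 \<or> i = 2 \<or> i = 3 \<or> i = 4 \<or> i = 5 \<or> i = 6" using rows[of i k] i by simp
          then show ?thesis using 2 i a z c7
            by (elim disjE) (auto simp: hadj_small)
        next
          case 3
          then have "i = 1 \<or> i = 2 \<or> i = 3 \<or> i = 4 \<or> i = 5 \<or> i = 6" using rows[of i k] i by simp
          then show ?thesis using 3 i a z W56 c7
            by (elim disjE) (auto simp: hadj_small)
        next
          case 4
          then have "i = 1 \<or> i = 2 \<or> i = 3 \<or> i = 4 \<or> i = 5 \<or> i = 6" using rows[of i k] i by simp
          then show ?thesis using 4 i a z W7 c7
            by (elim disjE) (auto simp: hadj_small)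
        qed (use low high i in auto)
      qed
      then show ?thesis by blast
    next
      assume a: "W 3 5 = 0 \<and> W 4 6 = 0 \<and> W 3 6 = 1 \<and> W 4 5 = 1"
      \<comment> \<open>\<open>hadj\<close> is directed from the smaller number, and the swap
        reverses the order of the pair 5, 6; hence the two alternatives.\<close>
      have "W i k = (if hadj c (swap56 i) (swap56 k) \<or> hadj c (swap56 k) (swap56 i) then 1 else 0)"
        if i: "1 \<le> i" "i < k" "k \<le> n" for i k
      proof -
        have not: "\<not> hadj c u v" if "v \<le> u" for u v using that c7 by (auto simp: hadj_def)
        consider "k \<le> 4" | "k = 5" | "k = 6" | "k = 7" | "k = 8" | "8 < k" by linarith
        then show ?thesis
        proof cases
          case 1
          then have "swap56 i = i" "swap56 k = k" using i by (auto simp: swap56_def)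
          then show ?thesis using low[OF i(1,2) 1] not i by simp
        next
          case 2
          then have "i = 1 \<or> i = 2 \<or> i = 3 \<or> i = 4 \<or> i = 5 \<or> i = 6" using rows[of i k] i by simp
          then show ?thesis using 2 i a z c7 not
            by (elim disjE) (auto simp: hadj_small swap56_def)
        next
          case 3
          then have "i = 1 \<or> i = 2 \<or> i = 3 \<or> i = 4 \<or> i = 5 \<or> i = 6" using rows[of i k] i by simp
          then show ?thesis using 3 i a z W56 c7 not
            by (elim disjE) (auto simp: hadj_small swap56_def)
        next
          case 4
          then have "i = 1 \<or> i = 2 \<or> i = 3 \<or> i = 4 \<or> i = 5 \<or> i = 6" using rows[of i k] i by simp
          then show ?thesis using 4 i a z W7 c7 not
            by (elim disjE) (auto simp: hadj_small swap56_def)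
        next
          case 5
          have h8: "hadj c u 8 \<longleftrightarrow> u = 7" for u using hadj_diamond(1)[of 7 u 0] c7 by simp
          have "swap56 k = 8" "swap56 i \<le> 8" "swap56 i = 7 \<longleftrightarrow> i = 7" using 5 i by (auto simp: swap56_def)
          then show ?thesis using high[of k i] i 5 c7 h8 not[of "swap56 i" 8] by auto
        next
          case 6
          then have k: "swap56 k = k" by (simp add: swap56_def)
          have "swap56 i \<le> k" using i 6 by (auto simp: swap56_def)
          moreover have "hadj c (swap56 i) k \<longleftrightarrow> hadj c i k" using 6 c7 by (auto simp: hadj_def swap56_def)
          ultimately show ?thesis using high[of k i] i 6 c7 k not[of "swap56 i" k] by auto
        qed
      qed
      then show ?thesis using c7 by blast
    qed
  qed
qed

end

section \<open>The numbering of the vertices\<close>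

fun head_vertex :: "nat \<Rightarrow> nat \<Rightarrow> vtx" where
  "head_vertex c i = (if i = c then vtx.h else if c = 5 then vtx.a i else vtx.b i)"

definition position :: "nat \<Rightarrow> nat \<Rightarrow> vtx" where
  "position c i = (if i \<le> c then head_vertex c i
     else (let m = Suc ((i - c - 1) div 4); u = (i - c - 1) mod 4 in
       if u = 0 then vtx.p m else if u = 1 then vtx.r m else if u = 2 then vtx.s m else vtx.q m))"

text \<open>Left inverse of the numbering, giving its injectivity; \<open>N\<close> is the number of
  the pendant vertex.\<close>

primrec index :: "nat \<Rightarrow> nat \<Rightarrow> vtx \<Rightarrow> nat" where
  "index c N (vtx.a i) = i"
| "index c N (vtx.b i) = i"
| "index c N vtx.h = c"
| "index c N (vtx.p m) = c + 4 * (m - 1) + 1"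
| "index c N (vtx.r m) = c + 4 * (m - 1) + 2"
| "index c N (vtx.s m) = c + 4 * (m - 1) + 3"
| "index c N (vtx.q m) = c + 4 * (m - 1) + 4"
| "index c N vtx.pendant = N"

lemma position_diamond:
  "position c (c + 4 * m + 1) = vtx.p (Suc m)"
  "position c (c + 4 * m + 2) = vtx.r (Suc m)"
  "position c (c + 4 * m + 3) = vtx.s (Suc m)"
  "position c (c + 4 * m + 4) = vtx.q (Suc m)"
proof -
  have "c + 4 * m + 1 - c - 1 = 4 * m" "c + 4 * m + 2 - c - 1 = 4 * m + 1"
    "c + 4 * m + 3 - c - 1 = 4 * m + 2" "c + 4 * m + 4 - c - 1 = 4 * m + 3" by simp_all
  moreover have "(4 * m) mod 4 = 0" "(4 * m + 1) mod 4 = 1" "(4 * m + 2) mod 4 = 2" "(4 * m + 3) mod 4 = 3"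
    "(4 * m) div 4 = m" "(4 * m + 1) div 4 = m" "(4 * m + 2) div 4 = m" "(4 * m + 3) div 4 = m"
    by presburger+
  ultimately show
    "position c (c + 4 * m + 1) = vtx.p (Suc m)"
    "position c (c + 4 * m + 2) = vtx.r (Suc m)"
    "position c (c + 4 * m + 3) = vtx.s (Suc m)"
    "position c (c + 4 * m + 4) = vtx.q (Suc m)"
    unfolding position_def by (simp_all del: One_nat_def)
qed

lemma position_head: "i \<le> c \<Longrightarrow> position c i = head_vertex c i" by (simp add: position_def)

lemma position_bridge: "position c (c + 4 * t) = end_vertex t"
proof (cases t)
  case 0 then show ?thesis by (simp add: position_head end_vertex_def)
next
  case (Suc m)
  have eq: "c + 4 * t = c + 4 * m + 4" using Suc by simp
  show ?thesis unfolding eq position_diamond(4) using Suc by (simp add: end_vertex_def)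
qed

lemma index_position:
  assumes "c = 5 \<or> c = 7" "1 \<le> i"
  shows "index c N (position c i) = i"
proof (cases "i \<le> c")
  case True
  then show ?thesis using assms by (auto simp: position_head)
next
  case False
  then obtain m r where r: "i = c + 4 * m + r" "r = 1 \<or> r = 2 \<or> r = 3 \<or> r = 4"
    using position_cases[of c i] by auto
  from r(2) show ?thesis unfolding r(1)
    by (elim disjE) (simp_all only: position_diamond index.simps diff_Suc_1)
qed

definition head_of :: "nat \<Rightarrow> head_kind" where
  "head_of c = (if c = 5 then head_kind.A else head_kind.B)"

lemma chain_verts_position:
  assumes c: "c = 5 \<or> c = 7"
  shows "chain_verts (head_of c) t = position c ` {1..c + 4 * t}"
proof (induction t)
  case 0
  have "{1..5} = {1, 2, 3, 4, 5::nat}" "{1..7} = {1, 2, 3, 4, 5, 6, 7::nat}" by auto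
  then show ?case using c
    by (auto simp: chain_verts_def head_of_def position_head)
next
  case (Suc t)
  have "{1..c + 4 * Suc t} = {1..c + 4 * t} \<union> {c + 4 * t + 1, c + 4 * t + 2, c + 4 * t + 3, c + 4 * t + 4}"
    by auto
  then have "position c ` {1..c + 4 * Suc t} = chain_verts (head_of c) t \<union> diamond_verts (Suc t)"
    by (simp only: image_Un image_insert image_empty Suc.IH position_diamond diamond_verts_def)
  moreover have ivl: "{1..Suc t} = insert (Suc t) {1..t}" by auto
  have "chain_verts (head_of c) (Suc t) = chain_verts (head_of c) t \<union> diamond_verts (Suc t)"
    unfolding chain_verts_def ivl UN_insert by (simp only: Un_ac)
  ultimately show ?case by simp
qed

lemma hadj_less: "c = 5 \<or> c = 7 \<Longrightarrow> hadj c i k \<Longrightarrow> 1 \<le> i \<and> i < k"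
  by (auto simp: hadj_def split: if_splits)

lemma hadj_pairs_insert:
  assumes "\<And>i. hadj c i (Suc N) \<longleftrightarrow> i \<in> S"
  shows "{(g i, g k) |i k. hadj c i k \<and> k \<le> Suc N} = {(g i, g k) |i k. hadj c i k \<and> k \<le> N} \<union> (\<lambda>i. (g i, g (Suc N))) ` S"
  using assms by (auto simp: le_Suc_eq)

lemma chain_edges_position:
  assumes c: "c = 5 \<or> c = 7"
  shows "chain_edges (head_of c) t = {(position c i, position c k) |i k. hadj c i k \<and> k \<le> c + 4 * t}"
proof (induction t)
  case 0
  have none: "{(g i, g k) |i k. hadj c i k \<and> k \<le> Suc 0} = {}" for g :: "nat \<Rightarrow> vtx"
    using hadj_less[OF c] by (auto simp: hadj_def split: if_splits)
  have s2: "hadj c i (Suc (Suc 0)) \<longleftrightarrow> i \<in> {1}" for i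
    using hadj_small(2) by (simp add: numeral_2_eq_2)
  have s3: "hadj c i (Suc 2) \<longleftrightarrow> i \<in> {1, 2}" for i using hadj_small(3) by simp
  have s4: "hadj c i (Suc 3) \<longleftrightarrow> i \<in> {1, 2}" for i using hadj_small(4) by simp
  have e4: "{(g i, g k) |i k. hadj c i k \<and> k \<le> 4} = {(g 1, g 2), (g 1, g 3), (g 2, g 3), (g 1, g 4), (g 2, g 4)}"
    for g :: "nat \<Rightarrow> vtx"
    using hadj_pairs_insert[OF s2, of g] hadj_pairs_insert[OF s3, of g] hadj_pairs_insert[OF s4, of g] none[of g]
    by (simp add: numeral_2_eq_2[symmetric]) auto
  from c show ?case
  proof
    assume c5: "c = 5"
    have s5: "hadj c i (Suc 4) \<longleftrightarrow> i \<in> {3, 4}" for i using hadj_small(5) c5 by simp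
    show ?thesis
      using hadj_pairs_insert[OF s5, of "position c"] e4[of "position c"] c5
      by (auto simp: chain_edges_def head_of_def position_head)
  next
    assume c7: "c = 7"
    have s5: "hadj c i (Suc 4) \<longleftrightarrow> i \<in> {3}" for i using hadj_small(6) c7 by simp
    have s6: "hadj c i (Suc 5) \<longleftrightarrow> i \<in> {4, 5}" for i using hadj_small(7) c7 by simp
    have s7: "hadj c i (Suc 6) \<longleftrightarrow> i \<in> {5, 6}" for i using hadj_small(8) c7 by simp
    show ?thesis
      using hadj_pairs_insert[OF s5, of "position c"] hadj_pairs_insert[OF s6, of "position c"]
        hadj_pairs_insert[OF s7, of "position c"] e4[of "position c"] c7
      by (auto simp: chain_edges_def head_of_def position_head)
  qed
next
  case (Suc t)
  have c4: "4 \<le> c" using c by auto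
  let ?b = "c + 4 * t"
  have s1: "hadj c i (Suc ?b) \<longleftrightarrow> i \<in> {?b}" for i using hadj_diamond(1)[OF c4, of i t] by simp
  have s2: "hadj c i (Suc (?b + 1)) \<longleftrightarrow> i \<in> {?b + 1}" for i using hadj_diamond(2)[OF c4, of i t] by simp
  have s3: "hadj c i (Suc (?b + 2)) \<longleftrightarrow> i \<in> {?b + 1, ?b + 2}" for i
    using hadj_diamond(3)[OF c4, of i t] by (simp add: eval_nat_numeral)
  have s4: "hadj c i (Suc (?b + 3)) \<longleftrightarrow> i \<in> {?b + 2, ?b + 3}" for i
    using hadj_diamond(4)[OF c4, of i t] by (simp add: eval_nat_numeral)
  have eqs: "Suc ?b = ?b + 1" "Suc (?b + 1) = ?b + 2" "Suc (?b + 2) = ?b + 3" "Suc (?b + 3) = ?b + 4"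
    "c + 4 * Suc t = ?b + 4" by simp_all
  define ES where "ES k0 = {(position c i, position c k) |i k. hadj c i k \<and> k \<le> k0}" for k0
  have "ES (c + 4 * Suc t) = ES ?b \<union> {(position c ?b, position c (?b + 1))}
      \<union> {(position c (?b + 1), position c (?b + 2))}
      \<union> {(position c (?b + 1), position c (?b + 3)), (position c (?b + 2), position c (?b + 3))}
      \<union> {(position c (?b + 2), position c (?b + 4)), (position c (?b + 3), position c (?b + 4))}"
    using hadj_pairs_insert[OF s1, of "position c"] hadj_pairs_insert[OF s2, of "position c"]
      hadj_pairs_insert[OF s3, of "position c"] hadj_pairs_insert[OF s4, of "position c"]
    unfolding eqs ES_def by simp
  also have "ES ?b = chain_edges (head_of c) t" using Suc.IH by (simp add: ES_def)
  finally have 1: "ES (c + 4 * Suc t) = chain_edges (head_of c) t \<union> {(end_vertex t, vtx.p (Suc t))} \<union> diamond_edges (Suc t)"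
    unfolding position_diamond position_bridge diamond_edges_def by auto
  have ivl: "{1..Suc t} = insert (Suc t) {1..t}" by auto
  have "chain_edges (head_of c) (Suc t) = chain_edges (head_of c) t \<union> {(end_vertex t, vtx.p (Suc t))} \<union> diamond_edges (Suc t)"
  proof (cases "t = 0")
    case True
    then show ?thesis by (auto simp: chain_edges_def end_vertex_def)
  next
    case False
    have "{(vtx.q i, vtx.p (i + 1)) |i. 1 \<le> i \<and> i < Suc t} =
      {(vtx.q i, vtx.p (i + 1)) |i. 1 \<le> i \<and> i < t} \<union> {(vtx.q t, vtx.p (Suc t))}"
      using False by (auto simp: less_Suc_eq)
    then show ?thesis using False unfolding chain_edges_def end_vertex_def ivl by auto
  qed
  then show ?case using 1 by (simp add: ES_def)
qed

text \<open>If \<open>n = c + 4 * t\<close>, the number of the pendant vertex lies just beyond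
  \<open>n\<close>, so the same numbering serves the graphs with and without it.\<close>

definition ordered_position :: "nat \<Rightarrow> nat \<Rightarrow> nat \<Rightarrow> vtx" where
  "ordered_position c t i = (if i = c + 4 * t + 1 then vtx.pendant else position c i)"

lemma H_graph_cases:
  assumes "8 \<le> n"
  obtains c t where "c = 5 \<or> c = 7" "n = c + 4 * t" "H_graph n = chain_graph (head_of c) t"
  | c t where "c = 5 \<or> c = 7" "n = c + 4 * t + 1" "H_graph n = chain_graph_pendant (head_of c) t"
proof -
  define m where "m = n div 4"
  have nm: "n = 4 * m + n mod 4" "2 \<le> m" using assms by (auto simp: m_def)
  consider "n mod 4 = 1" | "n mod 4 = 2" | "n mod 4 = 3" | "n mod 4 = 0" by linarith
  then show ?thesis
  proof cases
    case 1
    then have "n = 5 + 4 * (m - 1)" "(n - 5) div 4 = m - 1" using nm by auto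
    then show ?thesis using 1 by (intro that(1)[of 5 "m - 1"]) (auto simp: H_graph_def head_of_def)
  next
    case 2
    then have "n = 5 + 4 * (m - 1) + 1" "(n - 6) div 4 = m - 1" using nm by auto
    then show ?thesis using 2 by (intro that(2)[of 5 "m - 1"]) (auto simp: H_graph_def head_of_def)
  next
    case 3
    then have "n = 7 + 4 * (m - 1)" "(n - 7) div 4 = m - 1" using nm by auto
    then show ?thesis using 3 by (intro that(1)[of 7 "m - 1"]) (auto simp: H_graph_def head_of_def)
  next
    case 4
    then have "n = 7 + 4 * (m - 2) + 1" "(n - 8) div 4 = m - 2" using nm by auto
    then show ?thesis using 4 by (intro that(2)[of 7 "m - 2"]) (auto simp: H_graph_def head_of_def)
  qed
qed

theorem H_graph_ordered:
  assumes "8 \<le> n"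
  shows "\<exists>c t g. (c = 5 \<or> c = 7) \<and> (n = c + 4 * t \<or> n = c + 4 * t + 1) \<and>
    bij_betw g {1..n} (pverts (H_graph n)) \<and>
    (\<forall>i\<in>{1..n}. \<forall>k\<in>{1..n}. (g i, g k) \<in> parcs (H_graph n) \<longleftrightarrow> hadj c i k \<or> hadj c k i) \<and>
    parcs (H_graph n) \<subseteq> pverts (H_graph n) \<times> pverts (H_graph n)"
proof -
  have *: "\<exists>g. bij_betw g {1..n} V \<and>
    (\<forall>i\<in>{1..n}. \<forall>k\<in>{1..n}. (g i, g k) \<in> E \<union> E\<inverse> \<longleftrightarrow> hadj c i k \<or> hadj c k i) \<and> E \<union> E\<inverse> \<subseteq> V \<times> V"
    if c: "c = 5 \<or> c = 7" and n: "n \<le> c + 4 * t + 1" and V: "V = ordered_position c t ` {1..n}"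
      and E: "E = {(ordered_position c t i, ordered_position c t k) |i k. hadj c i k \<and> k \<le> n}" for c t V E
  proof (intro exI[of _ "ordered_position c t"] conjI)
    let ?g = "ordered_position c t"
    have inj: "inj_on ?g {1..n}"
    proof (rule inj_on_inverseI)
      fix i assume "i \<in> {1..n}"
      then show "index c (c + 4 * t + 1) (?g i) = i"
        using index_position[OF c, of i] by (simp add: ordered_position_def)
    qed
    then show "bij_betw ?g {1..n} V" unfolding V by (rule inj_on_imp_bij_betw)
    have mem: "(?g i, ?g k) \<in> E \<longleftrightarrow> hadj c i k" if "i \<in> {1..n}" "k \<in> {1..n}" for i k
    proof
      assume "(?g i, ?g k) \<in> E"
      then obtain i' k' where ik: "hadj c i' k'" "k' \<le> n" "?g i = ?g i'" "?g k = ?g k'" unfolding E by blast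
      then have "i' \<in> {1..n}" "k' \<in> {1..n}" using hadj_less[OF c ik(1)] by auto
      then have "i = i'" "k = k'" using inj ik that by (auto dest: inj_onD)
      then show "hadj c i k" using ik by simp
    next
      assume "hadj c i k" then show "(?g i, ?g k) \<in> E" unfolding E using that by auto
    qed
    then show "\<forall>i\<in>{1..n}. \<forall>k\<in>{1..n}. (?g i, ?g k) \<in> E \<union> E\<inverse> \<longleftrightarrow> hadj c i k \<or> hadj c k i" by auto
    show "E \<union> E\<inverse> \<subseteq> V \<times> V" unfolding E V using hadj_less[OF c] by fastforce
  qed
  from assms show ?thesis
  proof (cases rule: H_graph_cases)
    case (1 c t)
    have eq: "ordered_position c t i = position c i" if "i \<le> n" for i
      using that 1 by (simp add: ordered_position_def)
    have "pverts (H_graph n) = ordered_position c t ` {1..n}"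
      using 1 chain_verts_position[OF 1(1), of t] eq by (simp add: chain_graph_def graph_of_def)
    moreover have "chain_edges (head_of c) t = {(ordered_position c t i, ordered_position c t k) |i k. hadj c i k \<and> k \<le> n}"
    proof -
      have pos: "(ordered_position c t i, ordered_position c t k) = (position c i, position c k)"
        if "hadj c i k \<and> k \<le> n" for i k
        using that hadj_less[OF 1(1), of i k] eq by auto
      show ?thesis unfolding chain_edges_position[OF 1(1)] 1(2)[symmetric]
        by (intro Collect_cong ex_cong1) (use pos in auto)
    qed
    moreover have "parcs (H_graph n) = chain_edges (head_of c) t \<union> (chain_edges (head_of c) t)\<inverse>"
      using 1 by (simp add: chain_graph_def graph_of_def)
    ultimately show ?thesis using *[OF 1(1), of t "pverts (H_graph n)" "chain_edges (head_of c) t"] 1(1,2) by auto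
  next
    case (2 c t)
    have eq: "ordered_position c t i = position c i" if "i \<le> c + 4 * t" for i
      using that by (simp add: ordered_position_def)
    have n': "{1..n} = insert (c + 4 * t + 1) {1..c + 4 * t}" using 2 by auto
    have "pverts (H_graph n) = ordered_position c t ` {1..n}"
      unfolding n' using 2 chain_verts_position[OF 2(1), of t] eq
      by (simp add: chain_graph_pendant_def graph_of_def) (simp add: ordered_position_def)
    moreover have "insert (end_vertex t, vtx.pendant) (chain_edges (head_of c) t) =
      {(ordered_position c t i, ordered_position c t k) |i k. hadj c i k \<and> k \<le> n}"
    proof -
      have pos: "(ordered_position c t i, ordered_position c t k) = (position c i, position c k)"
        if "hadj c i k \<and> k \<le> c + 4 * t" for i k
        using that hadj_less[OF 2(1), of i k] eq by auto
      have "{(ordered_position c t i, ordered_position c t k) |i k. hadj c i k \<and> k \<le> c + 4 * t} = chain_edges (head_of c) t"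
        unfolding chain_edges_position[OF 2(1)]
        by (intro Collect_cong ex_cong1) (use pos in auto)
      moreover have "hadj c i (Suc (c + 4 * t)) \<longleftrightarrow> i \<in> {c + 4 * t}" for i
        using hadj_diamond(1)[of c i t] 2(1) by auto
      note hadj_pairs_insert[OF this, of "ordered_position c t"]
      moreover have "ordered_position c t (c + 4 * t) = end_vertex t"
        "ordered_position c t (Suc (c + 4 * t)) = vtx.pendant"
        by (simp_all add: eq position_bridge) (simp add: ordered_position_def)
      ultimately show ?thesis using 2(2) by simp
    qed
    moreover have "parcs (H_graph n) = insert (end_vertex t, vtx.pendant) (chain_edges (head_of c) t)
       \<union> (insert (end_vertex t, vtx.pendant) (chain_edges (head_of c) t))\<inverse>"
      using 2 by (simp add: chain_graph_pendant_def graph_of_def)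
    ultimately show ?thesis
      using *[OF 2(1), of t "pverts (H_graph n)" "insert (end_vertex t, vtx.pendant) (chain_edges (head_of c) t)"] 2(1,2)
      by auto
  qed
qed

section \<open>Graphs as ordered networks\<close>

lemma connected_nonregular_graphsD:
  assumes "G \<in> connected_nonregular_graphs n 3" "1 \<le> n"
  shows "pair_graph G" "card (pverts G) = n" "Digraph_Component.connected (with_proj G)"
    "\<And>v. v \<in> pverts G \<Longrightarrow> card {u. (v, u) \<in> parcs G} \<le> 3"
    "\<exists>v\<in>pverts G. card {u. (v, u) \<in> parcs G} < 3"
proof -
  show G: "pair_graph G" and "card (pverts G) = n" and "Digraph_Component.connected (with_proj G)"
    using assms by (auto simp: connected_nonregular_graphs_def)
  have fin: "finite (pverts G)" by (rule pair_graph_finite[OF G])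
  have mx: "Max ((\<lambda>v. card {u. (v, u) \<in> parcs G}) ` pverts G) = 3"
    using assms G by (auto simp: connected_nonregular_graphs_def max_degree_def out_degree_pair_graph)
  show le: "card {u. (v, u) \<in> parcs G} \<le> 3" if "v \<in> pverts G" for v
    unfolding mx[symmetric] using fin that by (intro Max_ge) auto
  obtain u v where "u \<in> pverts G" "v \<in> pverts G" "card {w. (u, w) \<in> parcs G} \<noteq> card {w. (v, w) \<in> parcs G}"
    using assms G by (auto simp: connected_nonregular_graphs_def nonregular_def out_degree_pair_graph)
  then show "\<exists>v\<in>pverts G. card {u. (v, u) \<in> parcs G} < 3"
    using le[of u] le[of v] by (metis le_neq_implies_less)
qed

lemma connected_nonregular_graphsI:
  assumes G: "pair_graph G" and "card (pverts G) = n" "Digraph_Component.connected (with_proj G)"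
    and le: "\<And>v. v \<in> pverts G \<Longrightarrow> card {u. (v, u) \<in> parcs G} \<le> 3"
    and v: "v \<in> pverts G" "card {u. (v, u) \<in> parcs G} < 3"
    and w: "w \<in> pverts G" "card {u. (w, u) \<in> parcs G} = 3"
  shows "G \<in> connected_nonregular_graphs n 3"
proof -
  have fin: "finite (pverts G)" by (rule pair_graph_finite[OF G])
  have "Max ((\<lambda>v. card {u. (v, u) \<in> parcs G}) ` pverts G) = 3"
  proof (rule Max_eqI)
    show "3 \<in> (\<lambda>v. card {u. (v, u) \<in> parcs G}) ` pverts G" using w by (intro image_eqI[of _ _ w]) auto
  qed (use fin le in auto)
  then have "max_degree G = 3" by (simp add: max_degree_def out_degree_pair_graph[OF G])
  moreover have "nonregular G"
    unfolding nonregular_def out_degree_pair_graph[OF G] using v w by (metis less_irrefl)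
  ultimately show ?thesis using assms(1-3) by (simp add: connected_nonregular_graphs_def)
qed

text \<open>For \<open>k > n\<close> the entry is the missing degree. The truncated subtraction is
  exact because degrees are at most 3 in \<open>ordered_graph\<close>.\<close>

definition net :: "nat \<Rightarrow> 'a pair_pre_digraph \<Rightarrow> (nat \<Rightarrow> 'a) \<Rightarrow> nat \<Rightarrow> nat \<Rightarrow> nat" where
  "net n G g i k = (if k \<le> n then (if (g i, g k) \<in> parcs G then 1 else 0)
     else 3 - card {u. (g i, u) \<in> parcs G})"

lemma sum_triangle:
  fixes F :: "nat \<Rightarrow> nat \<Rightarrow> real"
  assumes "\<And>i k. F i k = F k i" "\<And>i. F i i = 0"
  shows "(\<Sum>i=1..N. \<Sum>k=1..N. F i k) = 2 * (\<Sum>i=1..N. \<Sum>k=Suc i..N. F i k)"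
proof (induction N)
  case (Suc N)
  have cl: "sum g {1..Suc N} = sum g {1..N} + g (Suc N)" for g :: "nat \<Rightarrow> real" by simp
  have "(\<Sum>k=1..N. F (Suc N) k) = (\<Sum>i=1..N. F i (Suc N))" by (intro sum.cong refl assms(1))
  then have 1: "(\<Sum>i=1..Suc N. \<Sum>k=1..Suc N. F i k) = (\<Sum>i=1..N. \<Sum>k=1..N. F i k) + 2 * (\<Sum>i=1..N. F i (Suc N))"
    unfolding cl sum.distrib by (simp add: assms(2))
  have "(\<Sum>i=1..Suc N. \<Sum>k=Suc i..Suc N. F i k) = (\<Sum>i=1..N. \<Sum>k=Suc i..Suc N. F i k)"
    by simp
  also have "\<dots> = (\<Sum>i=1..N. (\<Sum>k=Suc i..N. F i k) + F i (Suc N))"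
    by (intro sum.cong refl) auto
  finally show ?case using 1 Suc by (simp add: sum.distrib)
qed simp

locale ordered_graph =
  fixes n :: nat and G :: "'a pair_pre_digraph" and g :: "nat \<Rightarrow> 'a"
  assumes n8: "8 \<le> n" and G: "pair_graph G"
    and g: "bij_betw g {1..n} (pverts G)"
    and connected: "Digraph_Component.connected (with_proj G)"
    and deg_le: "\<And>v. v \<in> pverts G \<Longrightarrow> card {u. (v, u) \<in> parcs G} \<le> 3"
    and deg_less: "\<exists>v\<in>pverts G. card {u. (v, u) \<in> parcs G} < 3"
begin

abbreviation "W \<equiv> net n G g"

lemma g_mem: "i \<in> {1..n} \<Longrightarrow> g i \<in> pverts G" using g by (auto simp: bij_betw_def)

lemma sum_verts: "(\<Sum>v\<in>pverts G. h v) = (\<Sum>i=1..n. h (g i))"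
  by (rule sum.reindex_bij_betw[OF g, symmetric])

lemma card_nbrs: "card {u. (g i, u) \<in> parcs G} = (\<Sum>k=1..n. if (g i, g k) \<in> parcs G then 1 else 0)"
proof -
  have S: "{u. (g i, u) \<in> parcs G} = {u \<in> pverts G. (g i, u) \<in> parcs G}"
    using pair_graph_wf[OF G] by auto
  have "card {u \<in> pverts G. (g i, u) \<in> parcs G} = (\<Sum>u\<in>pverts G. if (g i, u) \<in> parcs G then 1 else 0)"
    using pair_graph_finite[OF G] by (simp flip: sum.inter_filter)
  also have "\<dots> = (\<Sum>k=1..n. if (g i, g k) \<in> parcs G then 1 else 0)" by (rule sum_verts)
  finally show ?thesis unfolding S .
qed

lemma boundary_weight: "i \<in> {1..n} \<Longrightarrow> W i (Suc n) + card {u. (g i, u) \<in> parcs G} = 3"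
  using deg_le[OF g_mem] by (simp add: net_def)

lemma degree_sum:
  assumes "1 \<le> j" "j \<le> n"
  shows "(\<Sum>i=1..<j. W i j) + (\<Sum>k=Suc j..Suc n. W j k) = 3"
proof -
  let ?a = "\<lambda>k. if (g j, g k) \<in> parcs G then 1 else (0::nat)"
  have "(\<Sum>k=1..n. ?a k) = (\<Sum>k=1..<j. ?a k) + (\<Sum>k=j..<Suc n. ?a k)"
    using assms by (subst sum.atLeastLessThan_concat) (auto simp: atLeastLessThanSuc_atLeastAtMost)
  also have "(\<Sum>k=j..<Suc n. ?a k) = ?a j + (\<Sum>k=Suc j..n. ?a k)"
    using assms sum.atLeast_Suc_atMost[of j n ?a] by (simp add: atLeastLessThanSuc_atLeastAtMost)
  also have "?a j = 0" using pair_graph_irrefl[OF G] by simp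
  also have "(\<Sum>k=1..<j. ?a k) = (\<Sum>i=1..<j. W i j)"
    using assms pair_graph_sym[OF G] by (intro sum.cong) (auto simp: net_def)
  also have "(\<Sum>k=Suc j..n. ?a k) = (\<Sum>k=Suc j..n. W j k)"
    by (intro sum.cong) (auto simp: net_def)
  finally have "card {u. (g j, u) \<in> parcs G} = (\<Sum>i=1..<j. W i j) + (\<Sum>k=Suc j..n. W j k)"
    by (simp add: card_nbrs)
  then show ?thesis using boundary_weight[of j] assms by simp
qed

lemma reach_crossing:
  assumes "(u, v) \<in> r\<^sup>*" "u \<in> S" "v \<notin> S"
  shows "\<exists>x y. (x, y) \<in> r \<and> x \<in> S \<and> y \<notin> S"
  using assms by (induction rule: rtrancl_induct) auto

text \<open>For \<open>j < n\<close> a path from \<open>g 1\<close> to \<open>g n\<close> has to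
  leave the initial segment. At \<open>j = n\<close> only boundary edges leave, and a vertex of
  degree below 3 supplies one.\<close>

lemma cut_ge_1:
  assumes "1 \<le> j" "j \<le> n"
  shows "1 \<le> cut n W j j"
proof -
  have "\<exists>i k. 1 \<le> i \<and> i \<le> j \<and> j < k \<and> k \<le> Suc n \<and> 1 \<le> W i k"
  proof (cases "j = n")
    case True
    obtain v where "v \<in> pverts G" "card {u. (v, u) \<in> parcs G} < 3" using deg_less by blast
    then obtain i where "i \<in> {1..n}" "card {u. (g i, u) \<in> parcs G} < 3"
      using g by (metis bij_betw_imp_surj_on imageE)
    then have "1 \<le> i" "i \<le> j" "1 \<le> W i (Suc n)" using boundary_weight[of i] True by auto
    then show ?thesis using True by blast
  next
    case False
    have inj: "inj_on g {1..n}" using g by (auto simp: bij_betw_def)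
    have "g 1 \<in> pverts G" "g n \<in> pverts G" using g_mem n8 by auto
    then have "(g 1, g n) \<in> (parcs G)\<^sup>*" using connected connected_pair_graph_iff[OF G] by auto
    moreover have "g 1 \<in> g ` {1..j}" using assms by auto
    moreover have "g n \<notin> g ` {1..j}" using inj assms False by (auto dest!: inj_onD)
    ultimately obtain x y where xy: "(x, y) \<in> parcs G" "x \<in> g ` {1..j}" "y \<notin> g ` {1..j}"
      using reach_crossing[of "g 1" "g n" "parcs G" "g ` {1..j}"] by blast
    then obtain i where i: "i \<in> {1..j}" "x = g i" by blast
    have "y \<in> pverts G" using pair_graph_wf[OF G] xy by blast
    then obtain k where k: "k \<in> {1..n}" "y = g k" using g by (metis bij_betw_imp_surj_on imageE)
    have "j < k" using xy(3) k by force
    then have "1 \<le> i \<and> i \<le> j \<and> j < k \<and> k \<le> Suc n \<and> 1 \<le> W i k"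
      using i k xy(1) by (auto simp: net_def)
    then show ?thesis by blast
  qed
  then obtain i k where ik: "1 \<le> i" "i \<le> j" "j < k" "k \<le> Suc n" "1 \<le> W i k" by blast
  have "W i k \<le> (\<Sum>k=Suc j..Suc n. W i k)" using ik by (intro member_le_sum) auto
  also have "\<dots> \<le> cut n W j j" unfolding cut_def using ik by (intro member_le_sum) auto
  finally show ?thesis using ik by linarith
qed

sublocale network n W
proof
  show "8 \<le> n" by (rule n8)
  show "W i k \<le> 1" if "1 \<le> i" "i < k" "k \<le> n" for i k using that by (simp add: net_def)
  show "(\<Sum>i=1..<j. W i j) + (\<Sum>k=Suc j..Suc n. W j k) = 3" if "1 \<le> j" "j \<le> n" for j
    using that by (rule degree_sum)
  show "1 \<le> cut n W j j" if "1 \<le> j" "j \<le> n" for j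
    using that by (rule cut_ge_1)
qed

text \<open>The boundary edges contribute \<open>(3 - D i) * (y i)\<^sup>2\<close> and fill up the
  diagonal: the energy is the form of 3 I - A, the Laplacian of the completed network on functions
  vanishing at the boundary.\<close>

lemma energy_quad_form:
  assumes y: "y (Suc n) = 0" and w: "\<And>i. i \<in> {1..n} \<Longrightarrow> w (g i) = y i"
  shows "energy n W y = 3 * (\<Sum>i=1..n. (y i)\<^sup>2) - quad_form (pverts G) (adj G) w"
proof -
  define A where "A i k = adj G (g i) (g k)" for i k
  define D where "D i = real (card {u. (g i, u) \<in> parcs G})" for i
  have sym: "A i k = A k i" for i k unfolding A_def by (rule adj_sym[OF G])
  have D: "D i = (\<Sum>k=1..n. A i k)" for i
    unfolding D_def card_nbrs A_def adj_def of_nat_sum by (intro sum.cong) auto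
  have bw: "real (W i (Suc n)) = 3 - D i" if "i \<in> {1..n}" for i
    using boundary_weight[OF that] unfolding D_def by linarith
  have "energy n W y = (\<Sum>i=1..n. (\<Sum>k=Suc i..n. A i k * (y i - y k)\<^sup>2) + (3 - D i) * (y i)\<^sup>2)"
    unfolding energy_def
  proof (intro sum.cong refl)
    fix i assume i: "i \<in> {1..n}"
    have "(\<Sum>k=Suc i..Suc n. real (W i k) * (y i - y k)\<^sup>2) =
      (\<Sum>k=Suc i..n. real (W i k) * (y i - y k)\<^sup>2) + (3 - D i) * (y i)\<^sup>2"
      using i bw[OF i] y by simp
    also have "(\<Sum>k=Suc i..n. real (W i k) * (y i - y k)\<^sup>2) = (\<Sum>k=Suc i..n. A i k * (y i - y k)\<^sup>2)"
      by (intro sum.cong refl) (auto simp: A_def adj_def net_def)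
    finally show "(\<Sum>k=Suc i..Suc n. real (W i k) * (y i - y k)\<^sup>2) =
      (\<Sum>k=Suc i..n. A i k * (y i - y k)\<^sup>2) + (3 - D i) * (y i)\<^sup>2" .
  qed
  then have 1: "energy n W y = (\<Sum>i=1..n. \<Sum>k=Suc i..n. A i k * (y i - y k)\<^sup>2) + (\<Sum>i=1..n. (3 - D i) * (y i)\<^sup>2)"
    by (simp add: sum.distrib)
  have 2: "(\<Sum>i=1..n. \<Sum>k=1..n. A i k * (y i - y k)\<^sup>2) = 2 * (\<Sum>i=1..n. \<Sum>k=Suc i..n. A i k * (y i - y k)\<^sup>2)"
    using sym by (intro sum_triangle) (auto simp: power2_commute)
  have q: "quad_form (pverts G) (adj G) w = (\<Sum>i=1..n. \<Sum>k=1..n. A i k * y i * y k)"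
    unfolding quad_form_def sum_verts A_def by (intro sum.cong refl) (simp add: w)
  have s1: "(\<Sum>i=1..n. \<Sum>k=1..n. A i k * (y i)\<^sup>2) = (\<Sum>i=1..n. D i * (y i)\<^sup>2)"
    by (simp add: D sum_distrib_right)
  have s2: "(\<Sum>i=1..n. \<Sum>k=1..n. A i k * (y k)\<^sup>2) = (\<Sum>i=1..n. D i * (y i)\<^sup>2)"
    unfolding s1[symmetric] by (subst sum.swap) (simp add: sym)
  have "(\<Sum>i=1..n. \<Sum>k=1..n. A i k * (y i - y k)\<^sup>2) =
     (\<Sum>i=1..n. \<Sum>k=1..n. A i k * (y i)\<^sup>2 + A i k * (y k)\<^sup>2 - 2 * (A i k * y i * y k))"
    by (intro sum.cong refl) (simp add: power2_diff algebra_simps)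
  also have "\<dots> = 2 * (\<Sum>i=1..n. D i * (y i)\<^sup>2) - 2 * quad_form (pverts G) (adj G) w"
    unfolding sum.distrib sum_subtractf s1 s2 q sum_distrib_left[symmetric] by simp
  finally have "(\<Sum>i=1..n. \<Sum>k=Suc i..n. A i k * (y i - y k)\<^sup>2) = (\<Sum>i=1..n. D i * (y i)\<^sup>2) - quad_form (pverts G) (adj G) w"
    using 2 by simp
  moreover have "(\<Sum>i=1..n. (3 - D i) * (y i)\<^sup>2) = 3 * (\<Sum>i=1..n. (y i)\<^sup>2) - (\<Sum>i=1..n. D i * (y i)\<^sup>2)"
    by (simp add: algebra_simps sum_subtractf sum_distrib_left)
  ultimately show ?thesis using 1 by simp
qed

definition deficit :: real where "deficit = 3 - graph_spectral_radius G"

lemma verts_ne: "pverts G \<noteq> {}" using g_mem[of 1] n8 by auto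

lemma energy_ge:
  assumes y: "y (Suc n) = 0"
  shows "deficit * (\<Sum>i=1..n. (y i)\<^sup>2) \<le> energy n W y"
proof -
  define w where "w v = y (the_inv_into {1..n} g v)" for v
  have w: "w (g i) = y i" if "i \<in> {1..n}" for i
    using that g by (simp add: w_def the_inv_into_f_f bij_betw_def)
  have "quad_form (pverts G) (adj G) w \<le> graph_spectral_radius G * (\<Sum>v\<in>pverts G. (w v)\<^sup>2)"
    by (rule graph_spectral_radius_rayleigh(1)[OF G verts_ne])
  also have "(\<Sum>v\<in>pverts G. (w v)\<^sup>2) = (\<Sum>i=1..n. (y i)\<^sup>2)"
    unfolding sum_verts by (intro sum.cong refl) (simp add: w)
  finally show ?thesis using energy_quad_form[of y w, OF y w] by (simp add: deficit_def algebra_simps)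
qed

text \<open>The deficit is positive because some edge ends at the boundary, where the positive
  vector drops to 0, so the energy is not 0.\<close>

lemma perron_energy:
  assumes x: "\<And>v. v \<in> pverts G \<Longrightarrow> 0 < x v"
      "quad_form (pverts G) (adj G) x = graph_spectral_radius G * (\<Sum>v\<in>pverts G. (x v)\<^sup>2)"
    and z: "z = (\<lambda>i. if i \<in> {1..n} then x (g i) else 0)"
  shows "energy n W z = deficit * (\<Sum>i=1..n. (z i)\<^sup>2)" "0 < deficit"
proof -
  have "energy n W z = 3 * (\<Sum>i=1..n. (z i)\<^sup>2) - quad_form (pverts G) (adj G) x"
    by (rule energy_quad_form) (auto simp: z)
  moreover have "(\<Sum>v\<in>pverts G. (x v)\<^sup>2) = (\<Sum>i=1..n. (z i)\<^sup>2)"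
    unfolding sum_verts z by (intro sum.cong) auto
  ultimately show eq: "energy n W z = deficit * (\<Sum>i=1..n. (z i)\<^sup>2)"
    using x(2) by (simp add: deficit_def algebra_simps)
  have zp: "0 < z i" if "i \<in> {1..n}" for i using that x(1) g_mem by (simp add: z)
  have pos: "0 < (\<Sum>i=1..n. (z i)\<^sup>2)"
    using zp n8 by (intro sum_pos) (auto simp: zero_less_power2 less_imp_neq[symmetric])
  have "0 < energy n W z"
  proof -
    have "cut n W n n \<noteq> 0" using cut_ge_1[of n] n8 by simp
    then obtain i where i: "i \<in> {1..n}" "W i (Suc n) \<noteq> 0"
      by (auto simp: cut_def)
    have "0 < real (W i (Suc n)) * (z i - z (Suc n))\<^sup>2"
      using i zp[of i] by (auto simp: z)
    also have "\<dots> \<le> (\<Sum>k=Suc i..Suc n. real (W i k) * (z i - z k)\<^sup>2)"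
      using i by (intro member_le_sum[of "Suc n" _ "\<lambda>k. real (W i k) * (z i - z k)\<^sup>2"]) auto
    also have "\<dots> \<le> energy n W z"
      unfolding energy_def using i
      by (intro member_le_sum[of i _ "\<lambda>i. \<Sum>k=Suc i..Suc n. real (W i k) * (z i - z k)\<^sup>2"]) (auto intro!: sum_nonneg simp del: sum.cl_ivl_Suc)
    finally show ?thesis .
  qed
  then show "0 < deficit" using pos unfolding eq by (simp add: zero_less_mult_iff)
qed

end

section \<open>Sorting, isomorphism invariance, and the extremal graph as a member of the
  class\<close>

lemma sorted_enumeration:
  fixes x :: "'a \<Rightarrow> real"
  assumes "finite V" "card V = n"
  shows "\<exists>g. bij_betw g {1..n} V \<and> (\<forall>i k. 1 \<le> i \<longrightarrow> i \<le> k \<longrightarrow> k \<le> n \<longrightarrow> x (g k) \<le> x (g i))"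
proof -
  obtain xs0 where xs0: "set xs0 = V" "distinct xs0" using finite_distinct_list[OF assms(1)] by blast
  define xs where "xs = sort_key (\<lambda>v. - x v) xs0"
  have xs: "set xs = V" "distinct xs" "sorted (map (\<lambda>v. - x v) xs)"
    using xs0 by (simp_all add: xs_def)
  have len: "length xs = n" using xs assms(2) distinct_card by metis
  have "bij_betw (\<lambda>i. i - 1) {1..n} {..<n}"
    by (rule bij_betw_byWitness[where f' = Suc]) auto
  moreover have "bij_betw ((!) xs) {..<n} V"
    using xs len by (intro bij_betw_nth) auto
  ultimately have "bij_betw ((!) xs \<circ> (\<lambda>i. i - 1)) {1..n} V" by (rule bij_betw_trans)
  moreover have "x (xs ! (k - 1)) \<le> x (xs ! (i - 1))" if "1 \<le> i" "i \<le> k" "k \<le> n" for i k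
  proof -
    have "map (\<lambda>v. - x v) xs ! (i - 1) \<le> map (\<lambda>v. - x v) xs ! (k - 1)"
      using that len by (intro sorted_nth_mono[OF xs(3)]) auto
    then show ?thesis using that len by simp
  qed
  ultimately show ?thesis by (intro exI[of _ "(!) xs \<circ> (\<lambda>i. i - 1)"]) auto
qed

lemma spectral_radius_le_of_bij:
  assumes G: "pair_graph G" and H: "pair_graph H" and ne: "pverts H \<noteq> {}"
    and f: "bij_betw f (pverts G) (pverts H)"
    and adj: "\<And>u v. u \<in> pverts G \<Longrightarrow> v \<in> pverts G \<Longrightarrow> (u, v) \<in> parcs G \<longleftrightarrow> (f u, f v) \<in> parcs H"
  shows "graph_spectral_radius H \<le> graph_spectral_radius G"
proof -
  have neG: "pverts G \<noteq> {}" using f ne by (auto simp: bij_betw_def)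
  obtain x where x: "\<exists>v\<in>pverts H. x v \<noteq> 0"
    "quad_form (pverts H) (adj H) x = graph_spectral_radius H * (\<Sum>v\<in>pverts H. (x v)\<^sup>2)"
    using graph_spectral_radius_rayleigh(2)[OF H ne] by blast
  have s: "(\<Sum>v\<in>pverts H. h v) = (\<Sum>v\<in>pverts G. h (f v))" for h :: "'b \<Rightarrow> real"
    by (rule sum.reindex_bij_betw[OF f, symmetric])
  have "quad_form (pverts H) (adj H) x = quad_form (pverts G) (adj G) (\<lambda>v. x (f v))"
    unfolding quad_form_def s by (intro sum.cong refl) (simp add: adj_def adj)
  also have "\<dots> \<le> graph_spectral_radius G * (\<Sum>v\<in>pverts G. (x (f v))\<^sup>2)"
    by (rule graph_spectral_radius_rayleigh(1)[OF G neG])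
  also have "(\<Sum>v\<in>pverts G. (x (f v))\<^sup>2) = (\<Sum>v\<in>pverts H. (x v)\<^sup>2)" by (simp add: s)
  finally have "graph_spectral_radius H * (\<Sum>v\<in>pverts H. (x v)\<^sup>2) \<le> graph_spectral_radius G * (\<Sum>v\<in>pverts H. (x v)\<^sup>2)"
    unfolding x(2) .
  moreover have "0 < (\<Sum>v\<in>pverts H. (x v)\<^sup>2)"
    using x(1) pair_graph_finite[OF H] by (metis sum_pos2 zero_le_power2 zero_less_power2)
  ultimately show ?thesis by (simp add: mult_le_cancel_right)
qed

lemma spectral_radius_iso:
  assumes G: "pair_graph G" and H: "pair_graph H" and ne: "pverts H \<noteq> {}"
    and iso: "digraph_iso (with_proj G) (with_proj H)"
  shows "graph_spectral_radius G = graph_spectral_radius H"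
proof -
  interpret G: pair_graph G by (rule G)
  obtain f where f: "bij_betw f (pverts G) (pverts H)"
    "\<And>u v. u \<in> pverts G \<Longrightarrow> v \<in> pverts G \<Longrightarrow> (u, v) \<in> parcs G \<longleftrightarrow> (f u, f v) \<in> parcs H"
    using iso unfolding digraph_iso_pair_graph_iff[OF G H] by blast
  have iso': "digraph_iso (with_proj H) (with_proj G)"
    by (rule digraph_iso_swap[OF G.wf_digraph_axioms iso])
  obtain f' where f': "bij_betw f' (pverts H) (pverts G)"
    "\<And>u v. u \<in> pverts H \<Longrightarrow> v \<in> pverts H \<Longrightarrow> (u, v) \<in> parcs H \<longleftrightarrow> (f' u, f' v) \<in> parcs G"
    using iso' unfolding digraph_iso_pair_graph_iff[OF H G] by blast
  have neG: "pverts G \<noteq> {}" using f ne by (auto simp: bij_betw_def)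
  show ?thesis
    using spectral_radius_le_of_bij[OF G H ne f] spectral_radius_le_of_bij[OF H G neG f'] by linarith
qed

lemma hadj_nbrs:
  assumes c: "c = 5 \<or> c = 7" and k: "1 \<le> k"
  shows "\<exists>S. finite S \<and> card S \<le> 3 \<and> {i. hadj c i k \<or> hadj c k i} \<subseteq> S"
proof -
  have three: "finite {u, v, w} \<and> card {u, v, w} \<le> 3" for u v w :: nat
    by (auto simp: card_insert_if)
  have "\<exists>u v w. {i. hadj c i k \<or> hadj c k i} \<subseteq> {u, v, w}"
  proof (cases "k \<le> c")
    case True
    have "k = 1 \<or> k = 2 \<or> k = 3 \<or> k = 4 \<or> k = 5 \<and> c = 5 \<or> k = 5 \<and> c = 7 \<or> k = 6 \<and> c = 7 \<or> k = 7 \<and> c = 7"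
      using True c k by presburger
    then consider "k = 1" | "k = 2" | "k = 3 \<or> k = 4" "c = 5" | "k = 3" "c = 7" | "k = 4" "c = 7"
      | "k = 5" "c = 5" | "k = 5" "c = 7" | "k = 6" "c = 7" | "k = 7" "c = 7" using c by blast
    then show ?thesis
    proof cases
      case 1 then have "{i. hadj c i k \<or> hadj c k i} \<subseteq> {2, 3, 4}" using c by (elim disjE) (auto simp: hadj_def split: if_splits)
      then show ?thesis by blast
    next
      case 2 then have "{i. hadj c i k \<or> hadj c k i} \<subseteq> {1, 3, 4}" using c by (elim disjE) (auto simp: hadj_def split: if_splits)
      then show ?thesis by blast
    next
      case 3
      have "{i. hadj 5 i 3 \<or> hadj 5 3 i} \<subseteq> {1, 2, 5}" "{i. hadj 5 i 4 \<or> hadj 5 4 i} \<subseteq> {1, 2, 5}"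
        by (auto simp: hadj_def split: if_splits)
      then have "{i. hadj c i k \<or> hadj c k i} \<subseteq> {1, 2, 5}" using 3 by blast
      then show ?thesis by blast
    next
      case 4 then have "{i. hadj c i k \<or> hadj c k i} \<subseteq> {1, 2, 5}" by (auto simp: hadj_def split: if_splits)
      then show ?thesis by blast
    next
      case 5 then have "{i. hadj c i k \<or> hadj c k i} \<subseteq> {1, 2, 6}" by (auto simp: hadj_def split: if_splits)
      then show ?thesis by blast
    next
      case 6 then have "{i. hadj c i k \<or> hadj c k i} \<subseteq> {3, 4, 6}" by (auto simp: hadj_def split: if_splits)
      then show ?thesis by blast
    next
      case 7 then have "{i. hadj c i k \<or> hadj c k i} \<subseteq> {3, 6, 7}" by (auto simp: hadj_def split: if_splits)
      then show ?thesis by blast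
    next
      case 8 then have "{i. hadj c i k \<or> hadj c k i} \<subseteq> {4, 5, 7}" by (auto simp: hadj_def split: if_splits)
      then show ?thesis by blast
    next
      case 9 then have "{i. hadj c i k \<or> hadj c k i} \<subseteq> {5, 6, 8}" by (auto simp: hadj_def split: if_splits)
      then show ?thesis by blast
    qed
  next
    case False
    then obtain m r where r: "k = c + 4 * m + r" "r = 1 \<or> r = 2 \<or> r = 3 \<or> r = 4"
      using position_cases[of c k] by auto
    have c4: "4 \<le> c" using c by auto
    have up: "i = k + 1 \<or> i = k + 2 \<and> ((i - c) mod 4 = 0 \<or> (i - c) mod 4 = 3)" if h: "hadj c k i" for i
    proof -
      have "k < i" using hadj_less[OF c h] by simp
      then show ?thesis using h False c4 by (auto simp: hadj_def)
    qed
    from r(2) show ?thesis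
    proof (elim disjE)
      assume "r = 1"
      then have "{i. hadj c i k \<or> hadj c k i} \<subseteq> {k - 1, k + 1, k + 2}"
        using r(1) up hadj_diamond(1)[OF c4, of _ m] by auto
      then show ?thesis by blast
    next
      assume "r = 2"
      then have "{i. hadj c i k \<or> hadj c k i} \<subseteq> {k - 1, k + 1, k + 2}"
        using r(1) up hadj_diamond(2)[OF c4, of _ m] by auto
      then show ?thesis by blast
    next
      assume r3: "r = 3"
      then have "(k + 2 - c) mod 4 = 1" using r by (simp add: mod_Suc)
      then have "i = k + 1" if "hadj c k i" for i using up[OF that] by auto
      moreover have "i = k - 1 \<or> i = k - 2" if "hadj c i k" for i
        using that hadj_diamond(3)[OF c4, of i m] r(1) r3 by auto
      ultimately have "{i. hadj c i k \<or> hadj c k i} \<subseteq> {k - 2, k - 1, k + 1}" by blast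
      then show ?thesis by blast
    next
      assume r4: "r = 4"
      then have "(k + 2 - c) mod 4 = 2" using r by (simp add: mod_Suc)
      then have "i = k + 1" if "hadj c k i" for i using up[OF that] by auto
      moreover have "i = k - 1 \<or> i = k - 2" if "hadj c i k" for i
        using that hadj_diamond(4)[OF c4, of i m] r(1) r4 by auto
      ultimately have "{i. hadj c i k \<or> hadj c k i} \<subseteq> {k - 2, k - 1, k + 1}" by blast
      then show ?thesis by blast
    qed
  qed
  then show ?thesis using three by blast
qed

text \<open>An earlier neighbour for every vertex but the first makes the graph connected, by
  descent to vertex 1.\<close>

lemma hadj_pred_exists:
  assumes c: "c = 5 \<or> c = 7" and k: "2 \<le> k"
  shows "\<exists>i. hadj c i k"
proof (cases "c < k")
  case True
  then have "hadj c (k - 1) k" using c by (auto simp: hadj_def)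
  then show ?thesis by blast
next
  case False
  then have "k = 2 \<or> k = 3 \<or> k = 4 \<or> k = 5 \<and> c = 5 \<or> k = 5 \<and> c = 7 \<or> k = 6 \<and> c = 7 \<or> k = 7 \<and> c = 7"
    using c k by presburger
  then show ?thesis using hadj_small by (elim disjE) auto
qed

lemma H_graph_properties:
  assumes n: "8 \<le> n"
  shows "\<exists>c t g. H_graph n \<in> connected_nonregular_graphs n 3 \<and>
    (c = 5 \<or> c = 7) \<and> (n = c + 4 * t \<or> n = c + 4 * t + 1) \<and>
    bij_betw g {1..n} (pverts (H_graph n)) \<and>
    (\<forall>i\<in>{1..n}. \<forall>k\<in>{1..n}. (g i, g k) \<in> parcs (H_graph n) \<longleftrightarrow> hadj c i k \<or> hadj c k i)"
proof -
  let ?H = "H_graph n"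
  obtain c t g where c: "c = 5 \<or> c = 7" and nt: "n = c + 4 * t \<or> n = c + 4 * t + 1"
    and g: "bij_betw g {1..n} (pverts ?H)"
    and adj: "\<And>i k. i \<in> {1..n} \<Longrightarrow> k \<in> {1..n} \<Longrightarrow> (g i, g k) \<in> parcs ?H \<longleftrightarrow> hadj c i k \<or> hadj c k i"
    and wf: "parcs ?H \<subseteq> pverts ?H \<times> pverts ?H"
    using H_graph_ordered[OF n] by blast
  have surj: "\<exists>i\<in>{1..n}. v = g i" if "v \<in> pverts ?H" for v
    using that g by (auto simp: bij_betw_def)
  have gm: "g i \<in> pverts ?H" if "i \<in> {1..n}" for i using that g by (auto simp: bij_betw_def)
  have inj: "inj_on g {1..n}" using g by (simp add: bij_betw_def)
  have fin: "finite (pverts ?H)" using g by (metis bij_betw_finite finite_atLeastAtMost)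
  have fina: "finite (parcs ?H)" using wf fin by (meson finite_SigmaI finite_subset)
  have sym: "(v, u) \<in> parcs ?H" if "(u, v) \<in> parcs ?H" for u v
  proof -
    obtain i k where "i \<in> {1..n}" "k \<in> {1..n}" "u = g i" "v = g k" using surj wf \<open>(u, v) \<in> parcs ?H\<close> by blast
    then show ?thesis using adj that by blast
  qed
  have irr: "(u, u) \<notin> parcs ?H" for u
  proof
    assume u: "(u, u) \<in> parcs ?H"
    then obtain i where "i \<in> {1..n}" "u = g i" using surj wf by blast
    then show False using adj[of i i] u hadj_less[OF c, of i i] by auto
  qed
  have pg: "pair_graph ?H"
  proof
    show "fst e \<in> pverts ?H" "snd e \<in> pverts ?H" if "e \<in> parcs ?H" for e using wf that by auto
    show "finite (pverts ?H)" "finite (parcs ?H)" by (fact fin, fact fina)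
    show "fst e \<noteq> snd e" if "e \<in> parcs ?H" for e using irr that by (metis prod.collapse)
    show "symmetric (with_proj ?H)" using sym by (auto simp: symmetric_def intro: symI)
  qed
  have reach1: "k \<in> {1..n} \<Longrightarrow> (g 1, g k) \<in> (parcs ?H)\<^sup>*" for k
  proof (induction k rule: less_induct)
    case (less k)
    show ?case
    proof (cases "k = 1")
      case False
      then have "2 \<le> k" using less.prems by auto
      then obtain i where i: "hadj c i k" using hadj_pred_exists[OF c] by blast
      then have ik: "i < k" "i \<in> {1..n}" using hadj_less[OF c i] less.prems by auto
      then have "(g i, g k) \<in> parcs ?H" using adj i less.prems by blast
      then show ?thesis using less.IH[OF ik] by (meson rtrancl.rtrancl_into_rtrancl)
    qed simp
  qed
  have "sym ((parcs ?H)\<^sup>*)" using sym by (intro sym_rtrancl symI) auto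
  then have "(u, v) \<in> (parcs ?H)\<^sup>*" if "u \<in> pverts ?H" "v \<in> pverts ?H" for u v
    using surj[OF that(1)] surj[OF that(2)] reach1 by (metis rtrancl_trans symD)
  moreover have "pverts ?H \<noteq> {}" using gm[of 1] n by auto
  ultimately have con: "Digraph_Component.connected (with_proj ?H)"
    using connected_pair_graph_iff[OF pg] by blast
  have nb: "{u. (g k, u) \<in> parcs ?H} = g ` {i \<in> {1..n}. hadj c i k \<or> hadj c k i}" if "k \<in> {1..n}" for k
  proof (rule Set.set_eqI, rule iffI)
    fix u assume u: "u \<in> {u. (g k, u) \<in> parcs ?H}"
    then obtain i where "i \<in> {1..n}" "u = g i" using surj wf by blast
    then show "u \<in> g ` {i \<in> {1..n}. hadj c i k \<or> hadj c k i}" using adj[OF that, of i] u by auto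
  next
    fix u assume "u \<in> g ` {i \<in> {1..n}. hadj c i k \<or> hadj c k i}"
    then show "u \<in> {u. (g k, u) \<in> parcs ?H}" using adj[OF that] by auto
  qed
  have card_nb: "card {u. (g k, u) \<in> parcs ?H} = card {i \<in> {1..n}. hadj c i k \<or> hadj c k i}" if "k \<in> {1..n}" for k
    unfolding nb[OF that] by (rule card_image) (rule inj_on_subset[OF inj], auto)
  have "?H \<in> connected_nonregular_graphs n 3"
  proof (rule connected_nonregular_graphsI[OF pg _ con])
    show "card (pverts ?H) = n" using bij_betw_same_card[OF g] by simp
    show "card {u. (v, u) \<in> parcs ?H} \<le> 3" if v: "v \<in> pverts ?H" for v
    proof -
      obtain k where k: "k \<in> {1..n}" "v = g k" using surj[OF v] by blast
      obtain S where S: "finite S" "card S \<le> 3" "{i. hadj c i k \<or> hadj c k i} \<subseteq> S"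
        using hadj_nbrs[OF c, of k] k by auto
      have "card {i \<in> {1..n}. hadj c i k \<or> hadj c k i} \<le> card S"
        using S by (intro card_mono) auto
      then show ?thesis using card_nb[OF k(1)] k S by simp
    qed
    show "g n \<in> pverts ?H" "g 1 \<in> pverts ?H" using gm n by auto
    have "{i \<in> {1..n}. hadj c i n \<or> hadj c n i} \<subseteq> {n - 1, n - 2}"
    proof
      fix i assume "i \<in> {i \<in> {1..n}. hadj c i n \<or> hadj c n i}"
      then have "i \<le> n" "hadj c i n \<or> hadj c n i" by auto
      then have "hadj c i n" using hadj_less[OF c, of n i] by auto
      then show "i \<in> {n - 1, n - 2}" using n c by (auto simp: hadj_def)
    qed
    then have "card {i \<in> {1..n}. hadj c i n \<or> hadj c n i} \<le> card {n - 1, n - 2}" by (intro card_mono) auto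
    also have "\<dots> \<le> 2" by (simp add: card_insert_if)
    finally show "card {u. (g n, u) \<in> parcs ?H} < 3" using card_nb[of n] n by simp
    have "{i \<in> {1..n}. hadj c i 1 \<or> hadj c 1 i} = {2, 3, 4}"
      using n c by (elim disjE) (auto simp: hadj_def split: if_splits)
    then show "card {u. (g 1, u) \<in> parcs ?H} = 3" using card_nb[of 1] n by simp
  qed
  then show ?thesis using c nt g adj by blast
qed

section \<open>Comparison and optimality conditions for band forms\<close>

lemma band_form_cong:
  assumes "\<And>l m. 1 \<le> l \<Longrightarrow> l \<le> m \<Longrightarrow> m \<le> n \<Longrightarrow> C l m = C' l m" "\<And>i. 1 \<le> i \<Longrightarrow> i \<le> n \<Longrightarrow> d i = d' i"
  shows "band_form n C d = band_form n C' d'"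
  unfolding band_form_def using assms by (intro sum.cong refl) (auto simp: min_def max_def)

lemma band_form_mono:
  assumes "\<And>l m. 1 \<le> l \<Longrightarrow> l \<le> m \<Longrightarrow> m \<le> n \<Longrightarrow> C l m \<le> C' l m" "\<And>i. 1 \<le> i \<Longrightarrow> i \<le> n \<Longrightarrow> 0 \<le> d i"
  shows "band_form n C d \<le> band_form n C' d"
  unfolding band_form_def using assms by (intro sum_mono mult_right_mono) (auto simp: min_def max_def)

text \<open>The difference of the two forms is a sum of nonnegative terms, so all of them vanish;
  where both gaps are positive, the coefficients must agree.\<close>

lemma band_form_eq_imp:
  assumes "\<And>l m. 1 \<le> l \<Longrightarrow> l \<le> m \<Longrightarrow> m \<le> n \<Longrightarrow> C l m \<le> C' l m" "\<And>i. 1 \<le> i \<Longrightarrow> i \<le> n \<Longrightarrow> 0 \<le> d i"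
    and eq: "band_form n C d = band_form n C' d"
    and lm: "1 \<le> l" "l \<le> m" "m \<le> n" "0 < d l" "0 < d m"
  shows "C l m = C' l m"
proof -
  let ?T = "\<lambda>l m. (C' (min l m) (max l m) - C (min l m) (max l m)) * d l * d m"
  have nn: "0 \<le> ?T l m" if "l \<in> {1..n}" "m \<in> {1..n}" for l m
    using that assms(1)[of "min l m" "max l m"] assms(2) by auto
  have "(\<Sum>l=1..n. \<Sum>m=1..n. ?T l m) = 0"
    using eq by (simp add: band_form_def sum_subtractf algebra_simps)
  moreover have "(\<Sum>l=1..n. \<Sum>m=1..n. ?T l m) = 0 \<longleftrightarrow> (\<forall>l\<in>{1..n}. (\<Sum>m=1..n. ?T l m) = 0)"
    using nn by (intro sum_nonneg_eq_0_iff sum_nonneg) auto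
  ultimately have "(\<Sum>m=1..n. ?T l m) = 0" using lm by auto
  moreover have "(\<Sum>m=1..n. ?T l m) = 0 \<longleftrightarrow> (\<forall>m\<in>{1..n}. ?T l m = 0)"
    using nn lm by (intro sum_nonneg_eq_0_iff) auto
  moreover have "m \<in> {1..n}" using lm by auto
  ultimately have "?T l m = 0" by blast
  then show ?thesis using lm by (simp add: min_absorb1 max_absorb2)
qed

text \<open>First-order condition for the minimiser \<open>z\<close> in the direction of the
  indicator of \<open>{1..j}\<close>, whose gap vector is the unit vector at \<open>j\<close>: the
  flow across position \<open>j\<close> equals \<open>lam\<close> times the sum of the entries up to
  \<open>j\<close>.\<close>

lemma flow_balance:
  assumes le: "\<And>y. y (Suc n) = 0 \<Longrightarrow> lam * (\<Sum>i=1..n. (y i)\<^sup>2) \<le> band_form n C (gap y)"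
    and z: "z (Suc n) = 0" "lam * (\<Sum>i=1..n. (z i)\<^sup>2) = band_form n C (gap z)"
    and j: "1 \<le> j" "j \<le> n"
  shows "(\<Sum>m=1..n. C (min j m) (max j m) * gap z m) = lam * (\<Sum>i=1..j. z i)"
proof -
  let ?A = "\<lambda>l m. C (min l m) (max l m)"
  let ?e = "\<lambda>i. if i = j then 1 else (0::real)"
  let ?S = "\<Sum>m=1..n. ?A j m * gap z m"
  have bq: "band_form n C d = quad_form {1..n} ?A d" for d by (simp add: band_form_def quad_form_def)
  have lin: "(\<Sum>v\<in>{1..n}. ?e v * (\<Sum>u\<in>{1..n}. ?A v u * gap z u)) = ?S"
  proof -
    have "(\<Sum>v\<in>{1..n}. ?e v * (\<Sum>u\<in>{1..n}. ?A v u * gap z u)) = (\<Sum>v\<in>{1..n}. if v = j then ?S else 0)"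
      by (intro sum.cong) auto
    then show ?thesis using j by simp
  qed
  have key: "2 * t * (lam * (\<Sum>i=1..j. z i) - ?S) + t\<^sup>2 * (lam * real j - quad_form {1..n} ?A ?e) \<le> 0" for t
  proof -
    define y where "y i = z i + (if i \<le> j then t else 0)" for i
    have gy: "gap y = (\<lambda>i. gap z i + t * ?e i)" by (auto simp: gap_def y_def)
    have "y (Suc n) = 0" using z(1) j by (simp add: y_def)
    then have "lam * (\<Sum>i=1..n. (y i)\<^sup>2) \<le> band_form n C (gap y)" by (rule le)
    also have "band_form n C (gap y) = quad_form {1..n} ?A (gap z) + 2 * t * ?S + t\<^sup>2 * quad_form {1..n} ?A ?e"
      unfolding bq gy by (subst quad_form_add) (simp_all only: lin min.commute max.commute)
    also have "(\<Sum>i=1..n. (y i)\<^sup>2) = (\<Sum>i=1..n. (z i)\<^sup>2) + (\<Sum>i=1..n. if i \<in> {1..j} then 2 * t * z i + t\<^sup>2 else 0)"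
      unfolding sum.distrib[symmetric] by (intro sum.cong refl) (auto simp: y_def power2_sum)
    also have "(\<Sum>i=1..n. if i \<in> {1..j} then 2 * t * z i + t\<^sup>2 else 0) = (\<Sum>i\<in>{1..n} \<inter> {1..j}. 2 * t * z i + t\<^sup>2)"
      by (rule sum.inter_restrict[symmetric]) simp
    also have "{1..n} \<inter> {1..j} = {1..j}" using j by auto
    also have "(\<Sum>i\<in>{1..j}. 2 * t * z i + t\<^sup>2) = 2 * t * (\<Sum>i=1..j. z i) + real j * t\<^sup>2"
      by (simp add: sum.distrib sum_distrib_left)
    finally show ?thesis using z(2) unfolding bq by (simp add: algebra_simps)
  qed
  have "lam * (\<Sum>i=1..j. z i) - ?S = 0" using key by (rule linear_coeff_zero)
  then show ?thesis by simp
qed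

lemma model_row:
  assumes j: "1 \<le> j" "j \<le> n" "3 \<le> n"
  shows "(\<Sum>m=1..n. model B (min j m) (max j m) * d m) = min_cut B j * d j
    + (if j < n then (min_cut B j + min_cut B (Suc j) - 3) / 2 * d (Suc j) else 0)
    + (if 1 < j then (min_cut B (j - 1) + min_cut B j - 3) / 2 * d (j - 1) else 0)
    + (if j = 1 then d 3 else 0) + (if j = 3 then d 1 else 0)"
proof -
  have "(\<Sum>m=1..n. model B (min j m) (max j m) * d m) =
    (\<Sum>m=1..n. (if m = j then min_cut B j * d j else 0)
      + (if m = Suc j then (min_cut B j + min_cut B (Suc j) - 3) / 2 * d (Suc j) else 0)
      + (if m = j - 1 then (min_cut B (j - 1) + min_cut B j - 3) / 2 * d (j - 1) else 0)
      + (if m = 3 then (if j = 1 then d 3 else 0) else 0) + (if m = 1 then (if j = 3 then d 1 else 0) else 0))"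
  proof (intro sum.cong refl)
    fix m assume m: "m \<in> {1..n}"
    consider "m = j" | "m = Suc j" | "j = Suc m" | "Suc j < m" | "Suc m < j" by linarith
    then show "model B (min j m) (max j m) * d m = (if m = j then min_cut B j * d j else 0)
      + (if m = Suc j then (min_cut B j + min_cut B (Suc j) - 3) / 2 * d (Suc j) else 0)
      + (if m = j - 1 then (min_cut B (j - 1) + min_cut B j - 3) / 2 * d (j - 1) else 0)
      + (if m = 3 then (if j = 1 then d 3 else 0) else 0) + (if m = 1 then (if j = 3 then d 1 else 0) else 0)"
      by cases (use m j in \<open>auto simp: model_def\<close>)
  qed
  also have "\<dots> = min_cut B j * d j
    + (if j < n then (min_cut B j + min_cut B (Suc j) - 3) / 2 * d (Suc j) else 0)
    + (if 1 < j then (min_cut B (j - 1) + min_cut B j - 3) / 2 * d (j - 1) else 0)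
    + (if j = 1 then d 3 else 0) + (if j = 3 then d 1 else 0)"
    using j by (auto simp: sum.distrib)
  finally show ?thesis .
qed

section \<open>Comparison of the Perron vectors\<close>

lemma summand_le:
  fixes u :: real
  assumes "u + v1 + v2 + v3 + v4 = w" "0 \<le> v1" "0 \<le> v2" "0 \<le> v3" "0 \<le> v4"
  shows "u \<le> w"
  using assms by linarith

text \<open>Equal energies identify coefficients only where the gaps are positive. A bridge row
  reads \<open>d i = lam * F i\<close>. An odd gap outside the bridges is at most
  \<open>lam * F i / 3\<close>, so in an even row from 4 on, concavity of \<open>F\<close> leaves at
  least \<open>lam * F j / 3\<close> for \<open>2 * d j\<close>.\<close>

lemma model_gaps_positive:
  fixes z :: "nat \<Rightarrow> real"
  assumes n: "8 \<le> n" and lam: "0 < lam" "lam < 4"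
    and z_pos: "\<And>i. 1 \<le> i \<Longrightarrow> i \<le> n \<Longrightarrow> 0 < z i"
    and d_nn: "\<And>i. 1 \<le> i \<Longrightarrow> i \<le> n \<Longrightarrow> 0 \<le> gap z i"
    and row: "\<And>j. 1 \<le> j \<Longrightarrow> j \<le> n \<Longrightarrow>
      (\<Sum>m=1..n. model (best_bridges n) (min j m) (max j m) * gap z m) = lam * (\<Sum>i=1..j. z i)"
    and j: "1 \<le> j" "j \<le> n" "even j \<or> j \<in> best_bridges n"
  shows "0 < gap z j"
proof -
  let ?B = "best_bridges n"
  define d where "d = gap z"
  define F where "F j = (\<Sum>i=1..j. z i)" for j
  have mc: "min_cut ?B i = (if i = 0 then 0 else if i = 2 then 4 else if even i then 2 else if i \<in> ?B then 1 else 3)" for i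
    by (simp add: min_cut_def)
  have rw: "min_cut ?B j * d j
    + (if j < n then (min_cut ?B j + min_cut ?B (Suc j) - 3) / 2 * d (Suc j) else 0)
    + (if 1 < j then (min_cut ?B (j - 1) + min_cut ?B j - 3) / 2 * d (j - 1) else 0)
    + (if j = 1 then d 3 else 0) + (if j = 3 then d 1 else 0) = lam * F j"
    if "1 \<le> j" "j \<le> n" for j
    using model_row[OF that, of ?B d] row[OF that] n by (simp add: d_def F_def)
  have dn: "0 \<le> d i" if "1 \<le> i" "i \<le> n" for i using d_nn that by (simp add: d_def)
  have Fp: "0 < F i" if "1 \<le> i" "i \<le> n" for i
    unfolding F_def using that by (intro sum_pos z_pos) auto
  have opt5: "i \<in> ?B \<Longrightarrow> 5 \<le> i \<and> odd i" for i by (auto simp: best_bridges_def)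
  have opt_pos: "0 < d i" if i: "i \<in> ?B" "i \<le> n" for i
  proof -
    have i5: "5 \<le> i" "odd i" using opt5 i by auto
    have "i \<noteq> 0" "i \<noteq> 2" "Suc i \<noteq> 0" "Suc i \<noteq> 2" "even (Suc i)" "i - 1 \<noteq> 0" "i - 1 \<noteq> 2" "even (i - 1)"
      using i5 by auto
    then have "min_cut ?B i = 1" "min_cut ?B (Suc i) = 2" "min_cut ?B (i - 1) = 2"
      unfolding mc using i i5 by metis+
    then have "d i = lam * F i" using rw[of i] i i5 by (cases "i < n") simp_all
    then show ?thesis using lam Fp[of i] i i5 by simp
  qed
  have coef: "(if i \<in> ?B then 0 else d i) \<le> lam * F i / 3" if i: "odd i" "3 \<le> i" "i \<le> n" for i
  proof (cases "i \<in> ?B")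
    case True
    then show ?thesis using lam Fp[of i] i by simp
  next
    case False
    have m: "min_cut ?B i = 3" using False i by (auto simp: mc)
    have n1: "0 \<le> (if i < n then (min_cut ?B i + min_cut ?B (Suc i) - 3) / 2 * d (Suc i) else 0)"
      using m dn[of "Suc i"] i by (auto simp: mc intro!: mult_nonneg_nonneg)
    have n2: "0 \<le> (if 1 < i then (min_cut ?B (i - 1) + min_cut ?B i - 3) / 2 * d (i - 1) else 0)"
      using m dn[of "i - 1"] i by (auto simp: mc intro!: mult_nonneg_nonneg)
    have n3: "0 \<le> (if i = 1 then d 3 else 0)" and n4: "0 \<le> (if i = 3 then d 1 else 0)"
      using dn[of 1] dn[of 3] n by auto
    have "1 \<le> i" using i by simp
    from summand_le[OF rw[OF this i(3)] n1 n2 n3 n4] have "3 * d i \<le> lam * F i" unfolding m .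
    then show ?thesis using False by simp
  qed
  have even_pos: "0 < d j" if j: "even j" "4 \<le> j" "j \<le> n" for j
  proof -
    have m: "min_cut ?B j = 2" using j by (auto simp: mc)
    have lo: "(min_cut ?B (j - 1) + min_cut ?B j - 3) / 2 * d (j - 1) = (if j - 1 \<in> ?B then 0 else d (j - 1))"
      using j m by (auto simp: mc)
    have hi: "(min_cut ?B j + min_cut ?B (Suc j) - 3) / 2 * d (Suc j) = (if Suc j \<in> ?B then 0 else d (Suc j))"
      using j m by (auto simp: mc)
    have eq: "2 * d j + (if j < n then (if Suc j \<in> ?B then 0 else d (Suc j)) else 0)
      + (if j - 1 \<in> ?B then 0 else d (j - 1)) = lam * F j"
    proof -
      have j13: "j \<noteq> 1" "j \<noteq> 3" "1 < j" using j by auto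
      have "1 \<le> j" using j by simp
      from rw[OF this j(3)] show ?thesis
        unfolding lo hi unfolding m if_not_P[OF j13(1)] if_not_P[OF j13(2)] if_P[OF j13(3)] add_0_right .
    qed
    have c1: "(if j - 1 \<in> ?B then 0 else d (j - 1)) \<le> lam * F (j - 1) / 3"
      using j by (intro coef) auto
    have F1: "F j = F (j - 1) + z j" using j by (cases j) (auto simp: F_def)
    have zj: "0 < z j" using z_pos j by simp
    show ?thesis
    proof (cases "j < n")
      case True
      have c2: "(if Suc j \<in> ?B then 0 else d (Suc j)) \<le> lam * F (Suc j) / 3"
        using j True by (intro coef) auto
      have "F (Suc j) = F j + z (Suc j)" by (simp add: F_def)
      moreover have "z (Suc j) \<le> z j" using d_nn[of j] j by (simp add: gap_def)
      ultimately have "F (Suc j) + F (j - 1) \<le> 2 * F j" using F1 by simp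
      then have "lam * F (Suc j) + lam * F (j - 1) \<le> 2 * (lam * F j)"
        using lam by (metis (no_types, opaque_lifting) distrib_left less_imp_le mult.left_commute mult_left_mono)
      moreover have "0 < lam * F j" using lam Fp[of j] j by simp
      ultimately show ?thesis using eq c1 c2 True by simp
    next
      case False
      have "lam * F (j - 1) \<le> lam * F j" using F1 zj lam by simp
      moreover have "0 < lam * F j" using lam Fp[of j] j by simp
      ultimately show ?thesis using eq c1 False by simp
    qed
  qed
  \<comment> \<open>At position 2 the couplings are too large for that estimate. If
    \<open>d 2 = 0\<close>, rows 1 and 2 give \<open>4 * d 1 = lam * d 1\<close>, so
    \<open>d 1 = 0\<close> by \<open>lam < 4\<close>. Then \<open>z\<close> is constant on 1, 2, 3,
    and rows 1 and 3 force \<open>d 4 = 0\<close>, contrary to the case of even positions from 4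
    on.\<close>
  have two_pos: "0 < d 2"
  proof (rule ccontr)
    assume "\<not> 0 < d 2"
    then have d2: "d 2 = 0" using dn[of 2] n by simp
    have F: "F 1 = z 1" "F 2 = z 1 + z 2" "F 3 = z 1 + z 2 + z 3"
      by (simp_all add: F_def eval_nat_numeral)
    have B: "1 \<notin> ?B" "3 \<notin> ?B" using opt5[of 1] opt5[of 3] by auto
    have mcs: "min_cut ?B 1 = 3" "min_cut ?B 2 = 4" "min_cut ?B 3 = 3" "min_cut ?B 4 = 2" "min_cut ?B 0 = 0"
      using B by (auto simp: mc)
    have S: "Suc 1 = 2" "Suc 2 = 3" "Suc 3 = 4" "2 - 1 = (1::nat)" "3 - 1 = (2::nat)" by simp_all
    have r1: "3 * d 1 + d 3 = lam * z 1" using rw[of 1] n d2 unfolding S mcs F by simp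
    have r2: "2 * d 3 + 2 * d 1 = lam * (z 1 + z 2)" using rw[of 2] n d2 unfolding S mcs F by simp
    have r3: "3 * d 3 + d 4 + d 1 = lam * (z 1 + z 2 + z 3)" using rw[of 3] n d2 unfolding S mcs F by simp
    have g: "z 1 - z 2 = d 1" "z 2 = z 3" using d2 by (simp_all add: d_def gap_def eval_nat_numeral)
    have "2 * (3 * d 1 + d 3) - (2 * d 3 + 2 * d 1) = 2 * (lam * z 1) - lam * (z 1 + z 2)" unfolding r1 r2 ..
    then have "4 * d 1 = lam * (z 1 - z 2)" by (simp add: algebra_simps)
    then have "4 * d 1 = lam * d 1" unfolding g(1) .
    then have d1: "d 1 = 0" using lam by simp
    then have "z 2 = z 1" "z 3 = z 1" using g by simp_all
    then have "d 4 = 0" using r1 r3 d1 by simp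
    then show False using even_pos[of 4] n by simp
  qed
  show ?thesis
  proof (cases "j \<in> ?B")
    case True then show ?thesis using opt_pos j by (simp add: d_def)
  next
    case False
    then have "even j" using j by blast
    then have "j = 2 \<or> 4 \<le> j" using j(1) by presburger
    then show ?thesis using even_pos two_pos \<open>even j\<close> j by (auto simp: d_def)
  qed
qed

text \<open>A small \<open>lam\<close> makes the flow small, so \<open>z\<close> falls slowly and
  positions 6 to 9 still carry a fixed share of the sum. This gives
  \<open>F n \<ge> 1.3496 * F 5\<close>, just enough for the factor 11/20 needed in
  \<open>dual_val_opt_odd\<close>.\<close>

lemma concentration:
  fixes z F :: "nat \<Rightarrow> real"
  assumes n: "9 \<le> n" and lam: "30890 * lam \<le> 1116" "0 < lam"
    and z_pos: "\<And>i. 1 \<le> i \<Longrightarrow> i \<le> n \<Longrightarrow> 0 < z i"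
    and z_anti: "\<And>i. 1 \<le> i \<Longrightarrow> i \<le> n \<Longrightarrow> z i \<le> z 1"
    and F: "\<And>j. F j = (\<Sum>i=1..j. z i)"
    and g: "3 * gap z 1 \<le> lam * F 1" "4 * gap z 2 \<le> lam * F 2" "3 * gap z 3 \<le> lam * F 3"
      "2 * gap z 4 \<le> lam * F 4" "gap z 5 \<le> lam * F 5" "2 * gap z 6 \<le> lam * F 6"
      "gap z 7 \<le> lam * F 7" "2 * gap z 8 \<le> lam * F 8"
  shows "20 * (F 5)\<^sup>2 \<le> 11 * (F n)\<^sup>2" "5 * z 1 \<le> F n"
proof -
  define u where "u = lam * z 1"
  have z1: "0 < z 1" using z_pos n by simp
  have u: "30890 * u \<le> 1116 * z 1" using mult_right_mono[OF lam(1), of "z 1"] z1 by (simp add: u_def)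
  have Fj: "lam * F j \<le> real j * u" if "j \<le> n" for j
  proof -
    have "F j \<le> (\<Sum>i=1..j. z 1)" unfolding F using that z_anti by (intro sum_mono) auto
    then have "lam * F j \<le> lam * (real j * z 1)" using lam by (intro mult_left_mono) auto
    then show ?thesis by (simp add: u_def mult_ac)
  qed
  have fs: "lam * F 1 \<le> 1 * u" "lam * F 2 \<le> 2 * u" "lam * F 3 \<le> 3 * u" "lam * F 4 \<le> 4 * u"
    "lam * F 5 \<le> 5 * u" "lam * F 6 \<le> 6 * u" "lam * F 7 \<le> 7 * u" "lam * F 8 \<le> 8 * u"
    using Fj[of 1] Fj[of 2] Fj[of 3] Fj[of 4] Fj[of 5] Fj[of 6] Fj[of 7] Fj[of 8] n by simp_all
  have gz: "gap z 1 = z 1 - z 2" "gap z 2 = z 2 - z 3" "gap z 3 = z 3 - z 4" "gap z 4 = z 4 - z 5"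
    "gap z 5 = z 5 - z 6" "gap z 6 = z 6 - z 7" "gap z 7 = z 7 - z 8" "gap z 8 = z 8 - z 9"
    by (simp_all add: gap_def eval_nat_numeral)
  have F5: "F 5 = z 1 + z 2 + z 3 + z 4 + z 5" unfolding F by (simp add: eval_nat_numeral)
  have F9: "F 9 = F 5 + z 6 + z 7 + z 8 + z 9" unfolding F by (simp add: eval_nat_numeral)
  have Fn: "F 9 \<le> F n"
    unfolding F using n by (intro sum_mono2) (auto intro!: less_imp_le[OF z_pos])
  have F5le: "F 5 \<le> 5 * z 1" unfolding F5 using z_anti[of 2] z_anti[of 3] z_anti[of 4] z_anti[of 5] n by simp
  have F5pos: "0 < F 5" unfolding F5 using z_pos[of 1] z_pos[of 2] z_pos[of 3] z_pos[of 4] z_pos[of 5] n by simp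
  have b: "3 * (z 1 - z 2) \<le> u" "2 * (z 2 - z 3) \<le> u" "z 3 - z 4 \<le> u" "z 4 - z 5 \<le> 2 * u"
    "z 5 - z 6 \<le> 5 * u" "z 6 - z 7 \<le> 3 * u" "z 7 - z 8 \<le> 7 * u" "z 8 - z 9 \<le> 4 * u"
    using g fs unfolding gz by argo+
  \<comment> \<open>Adding up the drops in \<open>b\<close> gives
    \<open>z 6 + z 7 + z 8 + z 9 \<ge> 4 * z 1 - 187 / 3 * u\<close>. With \<open>u\<close> at most
    1116/30890 of \<open>z 1\<close> this is slightly more than \<open>1.748 * z 1\<close>.\<close>
  have key: "1000 * F n \<ge> 1000 * F 5 + 1748 * z 1"
    using b u Fn F9 z1 by argo
  show "5 * z 1 \<le> F n" using key b u F5 z1 by argo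
  have "6748 * F 5 \<le> 5000 * F n" using key F5le by argo
  then have "(6748 * F 5)\<^sup>2 \<le> (5000 * F n)\<^sup>2" using F5pos by (intro power_mono) auto
  then have "6748 * 6748 * (F 5)\<^sup>2 \<le> 5000 * 5000 * (F n)\<^sup>2" by (simp add: power_mult_distrib)
  then show "20 * (F 5)\<^sup>2 \<le> 11 * (F n)\<^sup>2" using zero_le_power2[of "F 5"] by argo
qed

lemma sum_indicator_sq:
  assumes "j \<le> (n::nat)"
  shows "(\<Sum>i=1..n. (if i \<le> j then 1 else 0 :: real)\<^sup>2) = real j"
proof -
  have "(\<Sum>i=1..n. (if i \<le> j then 1 else 0 :: real)\<^sup>2) = (\<Sum>i=1..n. if i \<in> {1..j} then 1 else 0)"
    by (intro sum.cong) auto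
  also have "\<dots> = (\<Sum>i\<in>{1..n} \<inter> {1..j}. 1)" by (rule sum.inter_restrict[symmetric]) simp
  also have "{1..n} \<inter> {1..j} = {1..j}" using assms by auto
  finally show ?thesis by simp
qed

text \<open>The indicator of \<open>{1..j}\<close> as a test vector: its only nonzero gap is at
  \<open>j\<close>, so its energy is the diagonal entry.\<close>

lemma gap_bound_indicator:
  assumes le: "\<And>y. y (Suc n) = 0 \<Longrightarrow> lam * (\<Sum>i=1..n. (y i)\<^sup>2) \<le> band_form n (model B) (gap y)"
    and j: "1 \<le> j" "j \<le> n"
  shows "lam * real j \<le> min_cut B j"
proof -
  define y :: "nat \<Rightarrow> real" where "y i = (if i \<le> j then 1 else 0)" for i
  have "band_form n (model B) (gap y) = (\<Sum>l=1..n. if l = j then min_cut B j else 0)"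
    unfolding band_form_def
  proof (intro sum.cong refl)
    fix l assume "l \<in> {1..n}"
    have "(\<Sum>m=1..n. model B (min l m) (max l m) * gap y l * gap y m) =
      (\<Sum>m=1..n. if m = j then model B (min l j) (max l j) * gap y l else 0)"
      by (intro sum.cong refl) (auto simp: gap_def y_def)
    also have "\<dots> = model B (min l j) (max l j) * gap y l" using j by simp
    also have "\<dots> = (if l = j then min_cut B j else 0)" by (auto simp: gap_def y_def model_def)
    finally show "(\<Sum>m=1..n. model B (min l m) (max l m) * gap y l * gap y m) = (if l = j then min_cut B j else 0)" .
  qed
  also have "\<dots> = min_cut B j" using j by simp
  finally have "band_form n (model B) (gap y) = min_cut B j" .
  moreover have "lam * (\<Sum>i=1..n. (y i)\<^sup>2) \<le> band_form n (model B) (gap y)"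
    using j by (intro le) (simp add: y_def)
  moreover have "(\<Sum>i=1..n. (y i)\<^sup>2) = real j"
    unfolding y_def by (rule sum_indicator_sq[OF j(2)])
  ultimately show ?thesis by simp
qed

text \<open>The test vector is twice \<open>\<Sum>\<^sub>j\<^sub>\<ge>\<^sub>i j / min_cut j\<close>, the sum running over even and bridge positions up to 11.\<close>

lemma gap_bound_test:
  assumes le: "\<And>y. y (Suc n) = 0 \<Longrightarrow> lam * (\<Sum>i=1..n. (y i)\<^sup>2) \<le> band_form n (model B) (gap y)"
    and n: "11 \<le> n" and B: "1 \<notin> B" "7 \<in> B" "11 \<in> B"
  shows "30890 * lam \<le> 1116"
proof -
  define y :: "nat \<Rightarrow> real" where "y i = (if i \<le> 2 then 65 else if i \<le> 4 then 64 else if i \<le> 6 then 60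
    else if i = 7 then 54 else if i = 8 then 40 else if i \<le> 10 then 32 else if i = 11 then 22 else 0)" for i
  have ivl: "{1..11} = {1, 2, 3, 4, 5, 6, 7, 8, 9, 10, 11::nat}"
    by (rule Set.set_eqI) (simp, presburger)
  have "(\<Sum>i=1..n. (y i)\<^sup>2) = (\<Sum>i=1..11. (y i)\<^sup>2)"
    using n by (intro sum.mono_neutral_right) (auto simp: y_def)
  also have "\<dots> = 30890" unfolding ivl by (simp add: y_def)
  finally have s: "(\<Sum>i=1..n. (y i)\<^sup>2) = 30890" .
  have g: "gap y 1 = 0" "gap y 2 = 1" "gap y 3 = 0" "gap y 4 = 4" "gap y 5 = 0" "gap y 6 = 6"
    "gap y 7 = 14" "gap y 8 = 8" "gap y 9 = 0" "gap y 10 = 10" "gap y 11 = 22" by (simp_all add: gap_def y_def)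
  have g0: "gap y i = 0" if "12 \<le> i" for i using that by (simp add: gap_def y_def)
  have mc: "min_cut B 2 = 4" "min_cut B 4 = 2" "min_cut B 6 = 2" "min_cut B 7 = 1" "min_cut B 8 = 2"
    "min_cut B 10 = 2" "min_cut B 11 = 1" using B by (simp_all add: min_cut_def)
  let ?t = "\<lambda>i. min_cut B i * (gap y i)\<^sup>2 + (min_cut B (i - 1) + min_cut B i - 3) * gap y (i - 1) * gap y i"
  have "band_form n (model B) (gap y) = (\<Sum>i=1..n. ?t i) + 2 * gap y 1 * gap y 3"
    using n B by (intro band_form_model) auto
  also have "(\<Sum>i=1..n. ?t i) = (\<Sum>i=1..11. ?t i)"
    using n by (intro sum.mono_neutral_right) (auto simp: g0)
  also have "(\<Sum>i=1..11. ?t i) = 1116"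
  proof -
    have S: "Suc 0 = 1" "(2::nat) - 1 = 1" "(3::nat) - 1 = 2" "(4::nat) - 1 = 3" "(5::nat) - 1 = 4" "(6::nat) - 1 = 5"
      "(7::nat) - 1 = 6" "(8::nat) - 1 = 7" "(9::nat) - 1 = 8" "(10::nat) - 1 = 9" "(11::nat) - 1 = 10" by simp_all
    have "(\<Sum>i=1..11. ?t i) = ?t 1 + ?t 2 + ?t 3 + ?t 4 + ?t 5 + ?t 6 + ?t 7 + ?t 8 + ?t 9 + ?t 10 + ?t 11"
      unfolding ivl by simp
    also have "\<dots> = 1116" unfolding S g mc by simp
    finally show ?thesis .
  qed
  finally have "band_form n (model B) (gap y) = 1116" using g by simp
  moreover have "y (Suc n) = 0" using n by (simp add: y_def)
  ultimately show ?thesis using le[of y] s by simp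
qed

text \<open>At the gaps of \<open>z\<close> the linear part equals
  \<open>2 * lam * |z|\<^sup>2\<close>, and the model form is at most the energy
  \<open>lam * |z|\<^sup>2\<close>.\<close>

lemma (in network) dual_val_ge:
  assumes z0: "z (Suc n) = 0" and en: "energy n W z = lam * (\<Sum>i=1..n. (z i)\<^sup>2)"
    and nn: "\<And>i. 1 \<le> i \<Longrightarrow> i \<le> n \<Longrightarrow> 0 \<le> gap z i"
    and B: "bridges \<subseteq> B" "1 \<notin> B" "3 \<notin> B"
    and f: "\<And>j. f j = (\<Sum>i=1..j. lam * z i)"
    and d: "\<And>i. 1 \<le> i \<Longrightarrow> i \<le> n \<Longrightarrow> d i = gap z i"
  shows "lam * (\<Sum>i=1..n. (z i)\<^sup>2) \<le> dual_val n B f d"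
proof -
  have "(\<Sum>i=1..n. f i * d i) = (\<Sum>i=1..n. f i * gap z i)" using d by (intro sum.cong) auto
  also have "\<dots> = (\<Sum>i=1..n. (lam * z i) * z i)" unfolding f by (rule sum_mult_gap[of z n "\<lambda>i. lam * z i", OF z0, symmetric])
  also have "\<dots> = lam * (\<Sum>i=1..n. (z i)\<^sup>2)" by (simp add: sum_distrib_left power2_eq_square mult.assoc)
  finally have 1: "(\<Sum>i=1..n. f i * d i) = lam * (\<Sum>i=1..n. (z i)\<^sup>2)" .
  have "band_form n (model B) d \<le> band_form n (\<lambda>l m. real (cut n W l m)) d"
    using model_le_cut[OF B] nn d by (intro band_form_mono) auto
  also have "\<dots> = band_form n (\<lambda>l m. real (cut n W l m)) (gap z)"
    using d by (intro band_form_cong) auto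
  also have "\<dots> = lam * (\<Sum>i=1..n. (z i)\<^sup>2)" using en by (simp add: energy_eq_band_form)
  finally show ?thesis using 1 n_ge B(2) by (simp add: dual_val_eq)
qed

text \<open>Every \<open>d\<close> consists of the gaps of its tail sums \<open>y\<close>, which
  vanish at \<open>Suc n\<close>. The Rayleigh bound for \<open>y\<close> then leaves the entrywise
  inequality \<open>2 * x * (lam * y) - (lam * y)\<^sup>2 \<le> x\<^sup>2\<close>.\<close>

lemma dual_val_le:
  fixes x f d :: "nat \<Rightarrow> real"
  assumes le: "\<And>y. y (Suc n) = 0 \<Longrightarrow> lam * (\<Sum>i=1..n. (y i)\<^sup>2) \<le> band_form n (model B) (gap y)"
    and "0 < lam" "3 \<le> n" "1 \<notin> B" and f: "\<And>j. f j = (\<Sum>i=1..j. x i)"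
  shows "lam * dual_val n B f d \<le> (\<Sum>i=1..n. (x i)\<^sup>2)"
proof -
  define y where "y i = (if i \<le> n then \<Sum>m=i..n. d m else 0)" for i
  have y0: "y (Suc n) = 0" by (simp add: y_def)
  have gy: "gap y i = d i" if "1 \<le> i" "i \<le> n" for i
    using that sum.atLeast_Suc_atMost[of i n d] by (auto simp: gap_def y_def)
  have "(\<Sum>i=1..n. f i * d i) = (\<Sum>i=1..n. f i * gap y i)" using gy by (intro sum.cong) auto
  also have "\<dots> = (\<Sum>i=1..n. x i * y i)" unfolding f by (rule sum_mult_gap[of y n x, OF y0, symmetric])
  finally have 1: "(\<Sum>i=1..n. f i * d i) = (\<Sum>i=1..n. x i * y i)" .
  have "band_form n (model B) d = band_form n (model B) (gap y)"
    using gy by (intro band_form_cong) auto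
  then have "lam * (\<Sum>i=1..n. (y i)\<^sup>2) \<le> band_form n (model B) d" using le[of y, OF y0] by simp
  then have "dual_val n B f d \<le> 2 * (\<Sum>i=1..n. x i * y i) - lam * (\<Sum>i=1..n. (y i)\<^sup>2)"
    using assms 1 by (simp add: dual_val_eq)
  then have "lam * dual_val n B f d \<le> lam * (2 * (\<Sum>i=1..n. x i * y i) - lam * (\<Sum>i=1..n. (y i)\<^sup>2))"
    using \<open>0 < lam\<close> by (intro mult_left_mono) auto
  also have "\<dots> = (\<Sum>i=1..n. 2 * x i * (lam * y i) - (lam * y i)\<^sup>2)"
    by (simp add: sum_subtractf sum_distrib_left power2_eq_square algebra_simps)
  also have "\<dots> \<le> (\<Sum>i=1..n. (x i)\<^sup>2)" by (intro sum_mono square_bound)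
  finally show ?thesis .
qed

section \<open>Isomorphism from equal edge numbers, and the final comparison\<close>

lemma swap56_bij: "6 \<le> n \<Longrightarrow> bij_betw swap56 {1..n} {1..n}"
  by (rule bij_betw_byWitness[where f' = swap56]) (auto simp: swap56_def)

lemma (in ordered_graph) iso_of_edges:
  assumes H: "pair_graph H" and h: "bij_betw h {1..n} (pverts H)"
    and s: "bij_betw s {1..n} {1..n}"
    and edges: "\<And>i k. 1 \<le> i \<Longrightarrow> i < k \<Longrightarrow> k \<le> n \<Longrightarrow> W i k = 1 \<longleftrightarrow> (h (s i), h (s k)) \<in> parcs H"
  shows "digraph_iso (with_proj G) (with_proj H)"
proof -
  define f where "f = h \<circ> s \<circ> the_inv_into {1..n} g"
  have "bij_betw (the_inv_into {1..n} g) (pverts G) {1..n}" by (rule bij_betw_the_inv_into[OF g])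
  then have bij: "bij_betw f (pverts G) (pverts H)"
    unfolding f_def comp_assoc using s h by (blast intro: bij_betw_trans)
  have fg: "f (g i) = h (s i)" if "i \<in> {1..n}" for i
    using that g by (simp add: f_def the_inv_into_f_f bij_betw_def)
  have lt: "(g i, g k) \<in> parcs G \<longleftrightarrow> (h (s i), h (s k)) \<in> parcs H" if "1 \<le> i" "i < k" "k \<le> n" for i k
    using edges[OF that] that by (auto simp: net_def split: if_splits)
  have all: "(g i, g k) \<in> parcs G \<longleftrightarrow> (h (s i), h (s k)) \<in> parcs H" if "i \<in> {1..n}" "k \<in> {1..n}" for i k
  proof -
    consider "i < k" | "k < i" | "i = k" by linarith
    then show ?thesis
    proof cases
      case 1 then show ?thesis using lt that by auto
    next
      case 2
      then have "(g k, g i) \<in> parcs G \<longleftrightarrow> (h (s k), h (s i)) \<in> parcs H" using lt that by auto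
      then show ?thesis using pair_graph_sym[OF G, of "g i" "g k"] pair_graph_sym[OF H, of "h (s i)" "h (s k)"] by blast
    next
      case 3 then show ?thesis using pair_graph_irrefl[OF G] pair_graph_irrefl[OF H] by auto
    qed
  qed
  have "(u, v) \<in> parcs G \<longleftrightarrow> (f u, f v) \<in> parcs H" if "u \<in> pverts G" "v \<in> pverts G" for u v
  proof -
    have "u \<in> g ` {1..n}" "v \<in> g ` {1..n}" using g that by (simp_all add: bij_betw_def)
    then obtain i k where ik: "i \<in> {1..n}" "u = g i" "k \<in> {1..n}" "v = g k" by blast
    show ?thesis unfolding ik fg[OF ik(1)] fg[OF ik(3)] by (rule all[OF ik(1,3)])
  qed
  then show ?thesis unfolding digraph_iso_pair_graph_iff[OF G H] using bij by blast
qed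

lemma (in network) separated_bridges: "separated n bridges"
  using bridge_separation by (fastforce simp: separated_def bridges_def)

theorem H_graph_extremal:
  assumes n: "8 \<le> n" and Gc: "G \<in> connected_nonregular_graphs n 3"
  shows "graph_spectral_radius G \<le> graph_spectral_radius (H_graph n) \<and>
    (graph_spectral_radius G = graph_spectral_radius (H_graph n) \<longrightarrow>
      digraph_iso (with_proj G) (with_proj (H_graph n)))"
proof -
  let ?H = "H_graph n"
  have n1: "1 \<le> n" using n by simp
  obtain c t h where Hc: "?H \<in> connected_nonregular_graphs n 3"
    and c: "c = 5 \<or> c = 7" and nt: "n = c + 4 * t \<or> n = c + 4 * t + 1"
    and h: "bij_betw h {1..n} (pverts ?H)"
    and adjH: "\<And>i k. i \<in> {1..n} \<Longrightarrow> k \<in> {1..n} \<Longrightarrow> (h i, h k) \<in> parcs ?H \<longleftrightarrow> hadj c i k \<or> hadj c k i"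
    using H_graph_properties[OF n] by blast
  note HD = connected_nonregular_graphsD[OF Hc n1] and GD = connected_nonregular_graphsD[OF Gc n1]
  interpret H: ordered_graph n ?H h
    by (rule ordered_graph.intro[OF n HD(1) h HD(3,4,5)])
  interpret M: model_network n "net n ?H h" c t
  proof
    show "c = 5 \<or> c = 7" "n = c + 4 * t \<or> n = c + 4 * t + 1" by (fact c, fact nt)
    show "net n ?H h i k = (if hadj c i k then 1 else 0)" if "1 \<le> i" "i < k" "k \<le> n" for i k
      using that adjH[of i k] hadj_less[OF c, of k i] by (auto simp: net_def)
  qed
  define L where "L = H.deficit"
  have HB: "L * (\<Sum>i=1..n. (y i)\<^sup>2) \<le> band_form n (model (best_bridges n)) (gap y)" if y: "y (Suc n) = 0" for y
  proof -
    have "band_form n (\<lambda>l m. real (cut n (net n ?H h) l m)) (gap y) = band_form n (model (best_bridges n)) (gap y)"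
      using M.cut_eq_model by (intro band_form_cong) auto
    then show ?thesis using H.energy_ge[of y, OF y] by (simp add: L_def energy_eq_band_form)
  qed
  obtain xH where "\<And>v. v \<in> pverts ?H \<Longrightarrow> 0 < xH v"
    "quad_form (pverts ?H) (adj ?H) xH = graph_spectral_radius ?H * (\<Sum>v\<in>pverts ?H. (xH v)\<^sup>2)"
    using perron_vector_exists[OF HD(1,3)] by blast
  from H.perron_energy(2)[OF this refl] have Lpos: "0 < L" by (simp add: L_def)
  obtain xG where xG: "\<And>v. v \<in> pverts G \<Longrightarrow> 0 < xG v"
    "quad_form (pverts G) (adj G) xG = graph_spectral_radius G * (\<Sum>v\<in>pverts G. (xG v)\<^sup>2)"
    using perron_vector_exists[OF GD(1,3)] by blast
  obtain g where g: "bij_betw g {1..n} (pverts G)"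
    and g_anti: "\<And>i k. 1 \<le> i \<Longrightarrow> i \<le> k \<Longrightarrow> k \<le> n \<Longrightarrow> xG (g k) \<le> xG (g i)"
    using sorted_enumeration[OF pair_graph_finite[OF GD(1)] GD(2), of xG] by blast
  interpret G: ordered_graph n G g
    by (rule ordered_graph.intro[OF n GD(1) g GD(3,4,5)])
  define lam where "lam = G.deficit"
  define z where "z = (\<lambda>i. if i \<in> {1..n} then xG (g i) else 0)"
  note perron = G.perron_energy[OF xG z_def, folded lam_def]
  have lam: "0 < lam" by (rule perron(2))
  have z0: "z (Suc n) = 0" by (simp add: z_def)
  have zp: "0 < z i" if "1 \<le> i" "i \<le> n" for i using that xG(1) G.g_mem by (simp add: z_def)
  have za: "z k \<le> z i" if "1 \<le> i" "i \<le> k" "k \<le> n" for i k using that g_anti by (simp add: z_def)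
  have gz: "0 \<le> gap z i" if "1 \<le> i" "i \<le> n" for i
    using that za[of i "Suc i"] zp[of i] z0 by (cases "i = n") (auto simp: gap_def)
  define x where "x i = lam * z i" for i
  define f where "f j = (\<Sum>i=1..j. x i)" for j
  interpret w: weights n x f
    by unfold_locales (use n lam zp za in \<open>auto simp: x_def f_def\<close>)
  \<comment> \<open>Outside \<open>{1..n}\<close> the gap of \<open>z\<close> can be negative:
    \<open>z 0 = 0\<close> makes gap 0 equal to \<open>- z 1\<close>. The moves of bridges require
    nonnegative values everywhere.\<close>
  define d where "d i = (if 1 \<le> i \<and> i \<le> n then gap z i else 0)" for i
  have d_nn: "0 \<le> d i" for i using gz by (simp add: d_def)
  define S where "S = (\<Sum>i=1..n. (z i)\<^sup>2)"
  have Spos: "0 < S" unfolding S_def using zp n by (intro sum_pos) (auto simp: less_imp_neq[symmetric])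
  have lower: "lam * S \<le> dual_val n B f d" if "G.bridges \<subseteq> B" "1 \<notin> B" "3 \<notin> B" for B
    unfolding S_def using that z0 perron(1) gz
    by (intro G.dual_val_ge) (auto simp: f_def x_def d_def)
  have opt13: "1 \<notin> best_bridges n" "3 \<notin> best_bridges n" by (auto simp: best_bridges_def)
  have b13: "1 \<notin> G.bridges" "3 \<notin> G.bridges" by (auto simp: G.bridges_def)
  have upper: "L * dual_val n (best_bridges n) f d' \<le> lam * (lam * S)" for d'
  proof -
    have "L * dual_val n (best_bridges n) f d' \<le> (\<Sum>i=1..n. (x i)\<^sup>2)"
      using HB Lpos n opt13 by (intro dual_val_le) (auto simp: f_def)
    also have "\<dots> = lam * (lam * S)"
      by (simp add: x_def S_def power_mult_distrib sum_distrib_left power2_eq_square mult_ac)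
    finally show ?thesis .
  qed
  \<comment> \<open>The chain is \<open>lam * S \<le> dual_val n G.bridges f d < dual_val n
    (best_bridges n) f d' \<le> lam * (lam * S) / L\<close>.\<close>
  have strict: "L < lam" if "dual_val n G.bridges f d < dual_val n (best_bridges n) f d'" for d'
  proof -
    have "lam * S < dual_val n (best_bridges n) f d'" using lower[of G.bridges] b13 that by simp
    then have "L * (lam * S) < L * dual_val n (best_bridges n) f d'" using Lpos by simp
    also have "\<dots> \<le> lam * (lam * S)" by (rule upper)
    finally show ?thesis using lam Spos by (simp add: mult_less_cancel_right)
  qed
  have gap_flow: "real (cut n (net n G g) j j) * gap z j \<le> lam * (\<Sum>i=1..j. z i)" if j: "1 \<le> j" "j \<le> n" for j
  proof -
    let ?C = "\<lambda>l m. real (cut n (net n G g) l m)"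
    have "?C j j * gap z j \<le> (\<Sum>m=1..n. ?C (min j m) (max j m) * gap z m)"
      using j gz member_le_sum[of j "{1..n}" "\<lambda>m. ?C (min j m) (max j m) * gap z m"] by simp
    also have "\<dots> = lam * (\<Sum>i=1..j. z i)"
    proof (rule flow_balance[where z = z and n = n, OF _ z0 _ j])
      show "lam * (\<Sum>i=1..n. (z i)\<^sup>2) = band_form n ?C (gap z)"
        using perron(1) by (simp add: energy_eq_band_form)
      show "lam * (\<Sum>i=1..n. (y i)\<^sup>2) \<le> band_form n ?C (gap y)" if "y (Suc n) = 0" for y
        using G.energy_ge[of y, OF that] by (simp add: lam_def energy_eq_band_form)
    qed
    finally show ?thesis .
  qed
  have main: "L < lam \<or> G.bridges = best_bridges n"
  proof (cases "even n \<or> n \<in> G.bridges")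
    case True
    then show ?thesis
      using w.dual_val_opt[OF G.separated_bridges _ True, of d] d_nn strict by blast
  next
    case False
    then have odd: "odd n" "n \<notin> G.bridges" by auto
    have "L < lam"
    proof (rule ccontr)
      \<comment> \<open>Under this assumption the upper bounds for \<open>L\<close>, obtained by
        test vectors in the explicit form of the extremal graph, hold for \<open>lam\<close> too.
        They limit how fast \<open>z\<close> can decrease.\<close>
      assume "\<not> L < lam"
      then have lL: "lam \<le> L" by simp
      have n9: "9 \<le> n" using odd n by presburger
      have n_opt: "n \<in> best_bridges n" using odd n by (auto simp: best_bridges_def)
      have "L * real n \<le> min_cut (best_bridges n) n" by (rule gap_bound_indicator, rule HB, assumption) (use n in auto)
      also have "min_cut (best_bridges n) n = 1" using n_opt odd n by (auto simp: min_cut_def)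
      finally have "L * real n \<le> 1" .
      moreover have "L * 9 \<le> L * real n" using n9 Lpos by (intro mult_left_mono) auto
      ultimately have l9: "9 * lam \<le> 1" using lL by simp
      define F where "F j = (\<Sum>i=1..j. z i)" for j
      have fF: "f j = lam * F j" for j by (simp add: f_def F_def x_def sum_distrib_left)
      have gf: "real (cut n (net n G g) j j) * gap z j \<le> lam * F j" if "1 \<le> j" "j \<le> n" for j
        using gap_flow[OF that] by (simp add: F_def)
      have gfk: "k * gap z j \<le> lam * F j" if "1 \<le> j" "j \<le> n" "k \<le> real (cut n (net n G g) j j)" for j k
        using gf[OF that(1,2)] mult_right_mono[OF that(3) gz[OF that(1,2)]] by linarith
      have head: "4 * x 1 \<le> 3 * f n"
      proof -
        have "3 * gap z 1 \<le> lam * F 1" using n G.cut_diag_small(1) by (intro gfk) auto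
        then have "3 * (z 1 - z 2) \<le> lam * z 1" by (simp add: F_def gap_def eval_nat_numeral)
        also have "9 * (lam * z 1) \<le> 1 * z 1" using mult_right_mono[OF l9, of "z 1"] zp[of 1] n by simp
        finally have "27 * (z 1 - z 2) \<le> z 1" by simp
        moreover have "z 1 + z 2 \<le> F n"
        proof -
          have "(\<Sum>i=1..2. z i) \<le> F n" unfolding F_def using n by (intro sum_mono2) (auto intro!: less_imp_le[OF zp])
          then show ?thesis by (simp add: eval_nat_numeral)
        qed
        moreover have "0 < z 1" using zp n by simp
        ultimately have "4 * z 1 \<le> 3 * F n" by argo
        then show ?thesis using lam mult_left_mono[of "4 * z 1" "3 * F n" lam] by (simp add: x_def fF algebra_simps)
      qed
      have conc: "20 * (f 5)\<^sup>2 \<le> 11 * (f n)\<^sup>2 \<and> 5 * x 1 \<le> f n" if n3: "n mod 4 = 3"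
      proof -
        have n11: "11 \<le> n" using n3 n by presburger
        have "n = 7 + 4 * ((n - 7) div 4)" using n3 n by presburger
        moreover have "n = 11 + 4 * ((n - 11) div 4)" using n3 n11 by presburger
        ultimately have "7 \<in> best_bridges n" "11 \<in> best_bridges n" unfolding best_bridges_def by fastforce+
        then have "30890 * L \<le> 1116" using n11 opt13 by (intro gap_bound_test[of n L "best_bridges n"] HB) auto
        then have l: "30890 * lam \<le> 1116" using lL by simp
        have e: "4 \<le> cut n (net n G g) 2 2" "3 \<le> cut n (net n G g) 3 3" "2 \<le> cut n (net n G g) 4 4"
          "1 \<le> cut n (net n G g) 5 5" "2 \<le> cut n (net n G g) 6 6" "1 \<le> cut n (net n G g) 7 7"
          "2 \<le> cut n (net n G g) 8 8"
          using G.cut_diag_small G.cut_diag_even[of 4] G.cut_diag_even[of 6] G.cut_diag_even[of 8]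
            G.cut_ge_1[of 5] G.cut_ge_1[of 7] n by auto
        have gs: "3 * gap z 1 \<le> lam * F 1" "4 * gap z 2 \<le> lam * F 2" "3 * gap z 3 \<le> lam * F 3"
          "2 * gap z 4 \<le> lam * F 4" "1 * gap z 5 \<le> lam * F 5" "2 * gap z 6 \<le> lam * F 6"
          "1 * gap z 7 \<le> lam * F 7" "2 * gap z 8 \<le> lam * F 8"
          by (rule gfk; use e n G.cut_diag_small(1) in simp)+
        have "20 * (F 5)\<^sup>2 \<le> 11 * (F n)\<^sup>2 \<and> 5 * z 1 \<le> F n"
          using concentration[of n lam z F] n9 l lam zp za gs by (simp add: F_def)
        then have "lam\<^sup>2 * (20 * (F 5)\<^sup>2) \<le> lam\<^sup>2 * (11 * (F n)\<^sup>2)" "lam * (5 * z 1) \<le> lam * F n"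
          using lam by (auto intro!: mult_left_mono)
        then show ?thesis by (simp add: fF x_def power_mult_distrib algebra_simps)
      qed
      obtain d' where "dual_val n G.bridges f d < dual_val n (best_bridges n) f d'"
        using w.dual_val_opt_odd[OF G.separated_bridges odd head conc] by blast
      then show False using strict lL by fastforce
    qed
    then show ?thesis ..
  qed
  have final: "L \<le> lam \<and> (lam = L \<longrightarrow> digraph_iso (with_proj G) (with_proj ?H))" if eq: "G.bridges = best_bridges n"
  proof -
    let ?C = "\<lambda>l m. real (cut n (net n G g) l m)"
    have mle: "model (best_bridges n) l m \<le> ?C l m" if "1 \<le> l" "l \<le> m" "m \<le> n" for l m
      using G.model_le_cut[of "best_bridges n"] eq opt13 that by auto
    have bC: "band_form n ?C (gap z) = lam * S" using perron(1) by (simp add: energy_eq_band_form S_def)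
    have bM: "band_form n (model (best_bridges n)) (gap z) \<le> lam * S"
      unfolding bC[symmetric] using mle gz by (intro band_form_mono) auto
    have LS: "L * S \<le> band_form n (model (best_bridges n)) (gap z)" unfolding S_def by (rule HB[of z, OF z0])
    have "L * S \<le> lam * S" using LS bM by simp
    then have le: "L \<le> lam" using Spos by simp
    moreover have "digraph_iso (with_proj G) (with_proj ?H)" if ll: "lam = L"
    proof -
      have bMe: "band_form n (model (best_bridges n)) (gap z) = lam * S" using LS bM ll by simp
      \<comment> \<open>For \<open>lam = L\<close> the vector \<open>z\<close> also minimises the
        Rayleigh quotient of the model form, so the flow balance holds with the model
        coefficients.\<close>
      have row: "(\<Sum>m=1..n. model (best_bridges n) (min j m) (max j m) * gap z m) = lam * (\<Sum>i=1..j. z i)"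
        if "1 \<le> j" "j \<le> n" for j
      proof (rule flow_balance[where z = z and n = n, OF _ z0 _ that])
        show "lam * (\<Sum>i=1..n. (z i)\<^sup>2) = band_form n (model (best_bridges n)) (gap z)"
          using bMe by (simp add: S_def)
        show "lam * (\<Sum>i=1..n. (y i)\<^sup>2) \<le> band_form n (model (best_bridges n)) (gap y)"
          if "y (Suc n) = 0" for y using HB[of y, OF that] ll by simp
      qed
      \<comment> \<open>The minimal cut 3 at position 1 gives \<open>lam \<le> 3\<close>, which
        settles the condition \<open>lam < 4\<close> of \<open>model_gaps_positive\<close>.\<close>
      have "L * real 1 \<le> min_cut (best_bridges n) 1" by (rule gap_bound_indicator, rule HB, assumption) (use n in auto)
      then have "lam < 4" using ll opt13 by (simp add: min_cut_def)
      have pos: "0 < gap z j" if "1 \<le> j" "j \<le> n" "even j \<or> j \<in> best_bridges n" for j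
        using that n lam \<open>lam < 4\<close> zp gz row by (intro model_gaps_positive[of n lam z j]) auto
      define P where "P = {l. 1 \<le> l \<and> l \<le> n \<and> (even l \<or> l \<in> best_bridges n)}"
      have CM: "model (best_bridges n) l m = ?C l m" if "l \<in> P" "m \<in> P" "l \<le> m" for l m
        using that pos bMe bC by (intro band_form_eq_imp[OF mle gz]) (auto simp: P_def)
      have diag: "?C l l = min_cut (best_bridges n) l" if "l \<in> P" for l
        using CM[OF that that] by (simp add: model_def)
      have off: "cut n (net n G g) l m = 0" if lm: "l \<in> P" "m \<in> P" "l < m" for l m
      proof -
        have "model (best_bridges n) l m = 0"
        proof (cases "m = Suc l")
          case True
          have "l \<noteq> 1" "m \<noteq> 3" using lm opt13 by (auto simp: P_def)
          then have l: "l \<noteq> 0" "l \<noteq> 2" "m \<noteq> 2" "m \<noteq> 0" using True lm by (auto simp: P_def)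
          show ?thesis
          proof (cases "even l")
            case True
            then have "odd m" "m \<in> best_bridges n" using lm \<open>m = Suc l\<close> by (auto simp: P_def)
            then show ?thesis using True l \<open>m = Suc l\<close> by (simp add: model_def min_cut_def)
          next
            case False
            then have "even m" "l \<in> best_bridges n" using lm \<open>m = Suc l\<close> by (auto simp: P_def)
            then show ?thesis using False l \<open>m = Suc l\<close> by (simp add: model_def min_cut_def)
          qed
        next
          case False
          moreover have "l \<noteq> 1" using lm opt13 by (auto simp: P_def)
          ultimately show ?thesis using lm by (simp add: model_def)
        qed
        then show ?thesis using CM[OF lm(1,2)] lm by simp
      qed
      have "(\<forall>i k. 1 \<le> i \<longrightarrow> i < k \<longrightarrow> k \<le> n \<longrightarrow> net n G g i k = (if hadj c i k then 1 else 0)) \<or>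
        c = 7 \<and> (\<forall>i k. 1 \<le> i \<longrightarrow> i < k \<longrightarrow> k \<le> n \<longrightarrow>
        net n G g i k = (if hadj c (swap56 i) (swap56 k) \<or> hadj c (swap56 k) (swap56 i) then 1 else 0))"
        by (rule G.edges_determined[OF c nt P_def diag off])
      then show ?thesis
      proof
        assume a: "\<forall>i k. 1 \<le> i \<longrightarrow> i < k \<longrightarrow> k \<le> n \<longrightarrow> net n G g i k = (if hadj c i k then 1 else 0)"
        show ?thesis
        proof (rule G.iso_of_edges[OF HD(1) h bij_betw_id])
          fix i k assume ik: "1 \<le> i" "i < k" "k \<le> n"
          then have "\<not> hadj c k i" using hadj_less[OF c, of k i] by auto
          then show "net n G g i k = 1 \<longleftrightarrow> (h (id i), h (id k)) \<in> parcs ?H"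
            using ik a adjH[of i k] by auto
        qed
      next
        assume a: "c = 7 \<and> (\<forall>i k. 1 \<le> i \<longrightarrow> i < k \<longrightarrow> k \<le> n \<longrightarrow>
          net n G g i k = (if hadj c (swap56 i) (swap56 k) \<or> hadj c (swap56 k) (swap56 i) then 1 else 0))"
        have sw: "bij_betw swap56 {1..n} {1..n}" using n by (intro swap56_bij) simp
        show ?thesis
        proof (rule G.iso_of_edges[OF HD(1) h sw])
          fix i k assume ik: "1 \<le> i" "i < k" "k \<le> n"
          then have "swap56 i \<in> {1..n}" "swap56 k \<in> {1..n}" using sw by (auto simp: bij_betw_def)
          then show "net n G g i k = 1 \<longleftrightarrow> (h (swap56 i), h (swap56 k)) \<in> parcs ?H"
            using ik a adjH[of "swap56 i" "swap56 k"] by auto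
        qed
      qed
    qed
    ultimately show ?thesis by blast
  qed
  have R: "graph_spectral_radius G = 3 - lam" "graph_spectral_radius ?H = 3 - L"
    by (simp_all add: lam_def L_def G.deficit_def H.deficit_def)
  from main show ?thesis
  proof
    assume "L < lam" then show ?thesis unfolding R by simp
  next
    assume "G.bridges = best_bridges n"
    from final[OF this] show ?thesis unfolding R by auto
  qed
qed

theorem theorem4p5:
  fixes n :: nat
  assumes "n \<ge> 8"
  shows "H_graph n \<in> connected_nonregular_graphs n 3 \<and>
    (\<forall>G \<in> (connected_nonregular_graphs n 3 :: 'a pair_pre_digraph set).
       graph_spectral_radius G \<le> graph_spectral_radius (H_graph n) \<and>
       (graph_spectral_radius G = graph_spectral_radius (H_graph n) \<longleftrightarrow>
          digraph_iso (with_proj G) (with_proj (H_graph n))))"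
proof (intro conjI ballI)
  show H: "H_graph n \<in> connected_nonregular_graphs n 3"
    using H_graph_properties[OF assms] by blast
  have n1: "1 \<le> n" using assms by simp
  fix G :: "'a pair_pre_digraph" assume G: "G \<in> connected_nonregular_graphs n 3"
  show "graph_spectral_radius G \<le> graph_spectral_radius (H_graph n)"
    using H_graph_extremal[OF assms G] by blast
  have "card (pverts (H_graph n)) \<noteq> 0" using connected_nonregular_graphsD(2)[OF H n1] assms by simp
  then have "pverts (H_graph n) \<noteq> {}" by auto
  then show "graph_spectral_radius G = graph_spectral_radius (H_graph n) \<longleftrightarrow>
      digraph_iso (with_proj G) (with_proj (H_graph n))"
    using H_graph_extremal[OF assms G] spectral_radius_iso[OF connected_nonregular_graphsD(1)[OF G n1] connected_nonregular_graphsD(1)[OF H n1]]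
    by blast
qed

end
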